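(* Assume that at least one of the following holds: (a) $A-iB^*TB\colon\mathbb{V}_h(\Omega)\to\mathbb{V}_h(\Omega)^*$ is invertible; (b) $\operatorname{Im}\{\langle\mathcal{A}_\Gamma(v,q),(\overline v,\overline q)\rangle\}\le0$ for all $v\in H^{1/2}(\Gamma)$ and all $q\in H^{-1/2}(\Gamma)$. Then $$\dim\operatorname{Ker}(A_{\Omega\times\Gamma})=\dim\big(\operatorname{Ker}(A)\cap\operatorname{Ker}(B)\big)+\dim\operatorname{Ker}(\mathrm{Id}+\Pi S).$$
   Context: Conventions. All vector spaces are complex; duality pairings $\langle\cdot,\cdot\rangle$ are bilinear (no complex conjugation) and act componentwise on Cartesian products. For a bounded linear $L\colon H\to V$, the adjoint $L^*\colon V^*\to H^*$ is defined by $\langle L^*p,u\rangle=\langle p,Lu\rangle$ (no conjugation), and $\overline{L}$ by $\overline{L}(\overline u)=\overline{L(u)}$. $\operatorname{Im}\{z\}$ denotes the imaginary part of a complex number $z$. Setting. $\Omega\subset\mathbb{R}^d$ ($d=2,3$) is a bounded polyhedral open set, $\Gamma=\partial\Omega$; $H^{1/2}(\Gamma)$ is the space of traces of $H^1(\Omega)$ and $H^{-1/2}(\Gamma)$ its dual. $\kappa\colon\mathbb{R}^d\to\mathbb{C}$ is measurable and essentially bounded, with $\operatorname{Im}\{\kappa(x)^2\}\ge0$ for all $x\in\Omega$, and equal to a constant $\tilde k>0$ outside $\Omega$. $\mathcal{A}_\Gamma\colon H^{1/2}(\Gamma)\times H^{-1/2}(\Gamma)\to H^{-1/2}(\Gamma)\times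 H^{1/2}(\Gamma)$ is a given bounded linear operator. Discretization. $\Omega$ is covered by a regular simplicial mesh; $V_h(\Omega)\subset H^1(\Omega)$ is the space of continuous $\mathbb{P}_k$-Lagrange finite element functions; for a subset $\Theta\subset\overline\Omega$ that is a union of mesh cells or of mesh faces, $V_h(\Theta)=\{v|_\Theta: v\in V_h(\Omega)\}$. $Q_h(\Gamma)\subset H^{-1/2}(\Gamma)$ is a finite-dimensional subspace. $V_h(\Omega,\Gamma)=V_h(\Omega)\times Q_h(\Gamma)$. The operator $A_{\Omega\times\Gamma}\colon V_h(\Omega,\Gamma)\to V_h(\Omega,\Gamma)^*$ is $$\langle A_{\Omega\times\Gamma}(u,p),(v,q)\rangle=\int_\Omega(\nabla u\cdot\nabla v-\kappa^2uv)\,dx+\langle\mathcal{A}_\Gamma(u|_\Gamma,p),(v|_\Gamma,q)\rangle.$$ Domain decomposition. $\overline\Omega=\overline\Omega_1\cup\dots\cup\overline\Omega_J$ with pairwise disjoint polyhedral open sets $\Omega_j$ that are unions of mesh cells, $\Gamma_j=\partial\Omega_j$, $\Sigma=\Gamma\cup\Gamma_1\cup\dots\cup\Gamma_J$. Set $V_h^{b}(\Gamma)=V_h(\Gamma)\times Q_h(\Gamma)$, $\mathbb{V}_h(\Omega)=V_h^{b}(\Gamma)\times V_h(\Omega_1)\times\dots\times V_h(\Omega_J)$, $\mathbb{V}_h(\Sigma)=V_h(\Gamma)\times V_h(\Gamma_1)\times\dots\times V_h(\Gamma_J)$. The trace operator $B\colon\mathbb{V}_h(\Omega)\to\mathbb{V}_h(\Sigma)$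 is $B((v,q),u_1,\dots,u_J)=(v,u_1|_{\Gamma_1},\dots,u_J|_{\Gamma_J})$. The restriction operator $R\colon V_h(\Sigma)\to\mathbb{V}_h(\Sigma)$ is $R(u)=(u|_\Gamma,u|_{\Gamma_1},\dots,u|_{\Gamma_J})$. $A=\operatorname{diag}(A_\Gamma,A_{\Omega_1},\dots,A_{\Omega_J})\colon\mathbb{V}_h(\Omega)\to\mathbb{V}_h(\Omega)^*$, where $\langle A_\Gamma(u),v\rangle=\langle\mathcal{A}_\Gamma(u),v\rangle$ for $u,v\in V_h^b(\Gamma)$ and $\langle A_{\Omega_j}(u),v\rangle=\int_{\Omega_j}(\nabla u\cdot\nabla v-\kappa^2uv)\,dx$ for $u,v\in V_h(\Omega_j)$. Impedance, exchange and scattering operators. $T\colon\mathbb{V}_h(\Sigma)\to\mathbb{V}_h(\Sigma)^*$ is any linear operator with $T^*=T=\overline T$ and $\langle T(u),\overline u\rangle>0$ for all $u\neq0$. $\Pi=2TR(R^*TR)^{-1}R^*-\mathrm{Id}\colon\mathbb{V}_h(\Sigma)^*\to\mathbb{V}_h(\Sigma)^*$. $S=\mathrm{Id}+2iTB(A-iB^*TB)^{\dagger}B^*\colon\mathbb{V}_h(\Sigma)^*\to\mathbb{V}_h(\Sigma)^*$, where $\dagger$ denotes the Moore-Penrose pseudo-inverse with respect to a fixed Hilbert norm on $\mathbb{V}_h(\Omega)$ (e.g. the product of the $H^{1/2}(\Gamma)\times H^{-1/2}(\Gamma)$ and $H^1(\Omega_j)$ norms) and the dual norm on $\mathbb{V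}_h(\Omega)^*$.
   Formalization: Under alternative (b), the discrete space Q_h(Γ) is additionally assumed to be stable under complex conjugation; without this the claim under (b) fails for some non-conjugation-stable Q_h(Γ). Under (a), Q_h(Γ) is arbitrary. *)

theory Defs
  imports "HOL-Analysis.Analysis" "HOL-Library.Function_Algebras"
begin

section \<open>Complex vector spaces, linear maps and duals on carrier sets\<close>

class complex_vs = ab_group_add +
  fixes scaleC :: "complex \<Rightarrow> 'a \<Rightarrow> 'a" (infixr \<open>*\<^sub>C\<close> 75)
  assumes scaleC_add_right: "a *\<^sub>C (x + y) = a *\<^sub>C x + a *\<^sub>C y"
    and scaleC_add_left: "(a + b) *\<^sub>C x = a *\<^sub>C x + b *\<^sub>C x"
    and scaleC_scaleC: "a *\<^sub>C (b *\<^sub>C x) = (a * b) *\<^sub>C x"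
    and scaleC_one: "1 *\<^sub>C x = x"

instantiation complex :: complex_vs
begin
definition "scaleC a (x :: complex) = a * x"
instance by standard (simp_all add: scaleC_complex_def algebra_simps)
end

instantiation "fun" :: (type, complex_vs) complex_vs
begin
definition "scaleC a f = (\<lambda>x. a *\<^sub>C f x)"
instance
  by standard (simp_all add: scaleC_fun_def fun_eq_iff scaleC_add_right scaleC_add_left
      scaleC_scaleC scaleC_one)
end

instantiation prod :: (complex_vs, complex_vs) complex_vs
begin
definition "scaleC a z = (a *\<^sub>C fst z, a *\<^sub>C snd z)"
instance
  by standard (simp_all add: scaleC_prod_def prod_eq_iff scaleC_add_right scaleC_add_left
      scaleC_scaleC scaleC_one)
end

global_interpretation cvec: vector_space "scaleC :: complex \<Rightarrow> 'a \<Rightarrow> 'a::complex_vs"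
  by standard (simp_all add: scaleC_add_right scaleC_add_left scaleC_scaleC scaleC_one)

definition clinear_on :: "'a::complex_vs set \<Rightarrow> ('a \<Rightarrow> 'b::complex_vs) \<Rightarrow> bool" where
  "clinear_on V f \<longleftrightarrow>
     (\<forall>x\<in>V. \<forall>y\<in>V. f (x + y) = f x + f y) \<and> (\<forall>c. \<forall>x\<in>V. f (c *\<^sub>C x) = c *\<^sub>C f x)"

definition ker_on :: "'a set \<Rightarrow> ('a \<Rightarrow> 'b::zero) \<Rightarrow> 'a set" where
  "ker_on V f = {x \<in> V. f x = 0}"

text \<open>Functionals are normalised to be zero off their carrier, so that equality of functionals on
  \<^term>\<open>V\<close> is equality of HOL functions. All the spaces to which this algebraic dual is applied
  without a continuity condition are finite-dimensional.\<close>

definition cdual :: "'a::complex_vs set \<Rightarrow> ('a \<Rightarrow> complex) set" where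
  "cdual V = {p. clinear_on V p \<and> (\<forall>x. x \<notin> V \<longrightarrow> p x = 0)}"

definition adj :: "'a set \<Rightarrow> ('a \<Rightarrow> 'b) \<Rightarrow> ('b \<Rightarrow> complex) \<Rightarrow> ('a \<Rightarrow> complex)" where
  "adj V L p = (\<lambda>u. if u \<in> V then p (L u) else 0)"

definition hermitian_ip_on :: "'a::complex_vs set \<Rightarrow> ('a \<Rightarrow> 'a \<Rightarrow> complex) \<Rightarrow> bool" where
  "hermitian_ip_on V ip \<longleftrightarrow>
     (\<forall>y\<in>V. clinear_on V (\<lambda>x. ip x y)) \<and>
     (\<forall>x\<in>V. \<forall>y\<in>V. ip y x = cnj (ip x y)) \<and>
     (\<forall>x\<in>V. x \<noteq> 0 \<longrightarrow> 0 < Re (ip x x))"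

definition ip_norm :: "('a \<Rightarrow> 'a \<Rightarrow> complex) \<Rightarrow> 'a \<Rightarrow> real" where
  "ip_norm ip x = sqrt (Re (ip x x))"

definition dual_norm :: "'a set \<Rightarrow> ('a \<Rightarrow> real) \<Rightarrow> ('a \<Rightarrow> complex) \<Rightarrow> real" where
  "dual_norm V N p = (SUP x \<in> {x \<in> V. N x \<le> 1}. cmod (p x))"

text \<open>Moore--Penrose pseudo-inverse of \<^term>\<open>L\<close> on \<^term>\<open>V\<close>, for the norms \<^term>\<open>N\<close> on
  \<^term>\<open>V\<close> and \<^term>\<open>N'\<close> on the target: the least-squares solution of minimal norm.\<close>

definition least_squares :: "'a set \<Rightarrow> ('b \<Rightarrow> real) \<Rightarrow> ('a \<Rightarrow> 'b::minus) \<Rightarrow> 'b \<Rightarrow> 'a set" where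
  "least_squares V N' L f = {u \<in> V. \<forall>w\<in>V. N' (L u - f) \<le> N' (L w - f)}"

definition pinv ::
  "'a set \<Rightarrow> ('a \<Rightarrow> real) \<Rightarrow> ('b \<Rightarrow> real) \<Rightarrow> ('a \<Rightarrow> 'b::minus) \<Rightarrow> 'b \<Rightarrow> 'a" where
  "pinv V N N' L f =
     (THE u. u \<in> least_squares V N' L f \<and> (\<forall>w \<in> least_squares V N' L f. N u \<le> N w))"


section \<open>The Sobolev space \<open>H\<^sup>1\<close>\<close>

type_synonym 'd cfun = "real^'d \<Rightarrow> complex"
type_synonym 'd cdistr = "'d cfun \<Rightarrow> complex"

definition pd :: "'d::finite \<Rightarrow> 'd cfun \<Rightarrow> 'd cfun" where
  "pd i u x = vector_derivative (\<lambda>t. u (x + t *\<^sub>R axis i 1)) (at 0)"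

primrec Ck :: "nat \<Rightarrow> ('d::finite) cfun \<Rightarrow> bool" where
  "Ck 0 u \<longleftrightarrow> continuous_on UNIV u"
| "Ck (Suc n) u \<longleftrightarrow> (\<forall>x. u differentiable (at x)) \<and> (\<forall>i. Ck n (pd i u))"

definition test_functions :: "(real^'d) set \<Rightarrow> ('d::finite) cfun set" where
  "test_functions \<Omega> =
     {\<phi>. (\<forall>n. Ck n \<phi>) \<and> (\<exists>K. compact K \<and> K \<subseteq> \<Omega> \<and> (\<forall>x. x \<notin> K \<longrightarrow> \<phi> x = 0))}"

definition square_integrable :: "(real^'d) set \<Rightarrow> ('d::finite) cfun \<Rightarrow> bool" where
  "square_integrable \<Omega> u \<longleftrightarrow>
     set_borel_measurable lebesgue \<Omega> u \<and> set_integrable lebesgue \<Omega> (\<lambda>x. (cmod (u x))\<^sup>2)"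

definition weak_gradient :: "(real^'d) set \<Rightarrow> ('d::finite) cfun \<Rightarrow> ('d \<Rightarrow> 'd cfun) \<Rightarrow> bool" where
  "weak_gradient \<Omega> u g \<longleftrightarrow>
     (\<forall>i. square_integrable \<Omega> (g i)) \<and>
     (\<forall>\<phi> \<in> test_functions \<Omega>. \<forall>i.
        (LINT x:\<Omega>|lebesgue. u x * pd i \<phi> x) = - (LINT x:\<Omega>|lebesgue. g i x * \<phi> x))"

definition H1 :: "(real^'d) set \<Rightarrow> ('d::finite) cfun set" where
  "H1 \<Omega> = {u. square_integrable \<Omega> u \<and> (\<exists>g. weak_gradient \<Omega> u g)}"

text \<open>Weak gradients agree almost everywhere, so the infimum ranges over a singleton.\<close>

definition H1_norm :: "(real^'d) set \<Rightarrow> ('d::finite) cfun \<Rightarrow> real" where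
  "H1_norm \<Omega> u =
     Inf {sqrt (LINT x:\<Omega>|lebesgue. (cmod (u x))\<^sup>2 + (\<Sum>i\<in>UNIV. (cmod (g i x))\<^sup>2)) | g.
            weak_gradient \<Omega> u g}"


section \<open>Trace spaces\<close>

definition hausdorff_outer :: "real \<Rightarrow> 'a::metric_space set \<Rightarrow> ennreal" where
  "hausdorff_outer s A =
     (SUP \<delta> \<in> {0<..}.
        INF U \<in> {U :: nat \<Rightarrow> 'a set. A \<subseteq> (\<Union>n. U n) \<and> (\<forall>n. bounded (U n) \<and> diameter (U n) \<le> \<delta>)}.
          \<Sum>n. ennreal (unit_ball_vol s * (diameter (U n) / 2) powr s))"

text \<open>The Hausdorff outer measure is countably additive on Borel sets, being a metric outer measure;
  with the above normalisation it is surface area on flat pieces.\<close>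

definition surface_measure :: "(real^'d::finite) measure" where
  "surface_measure = measure_of UNIV (sets borel) (hausdorff_outer (real CARD('d) - 1))"

definition restr :: "'a set \<Rightarrow> ('a \<Rightarrow> complex) \<Rightarrow> ('a \<Rightarrow> complex)" where
  "restr \<Theta> v = (\<lambda>x. if x \<in> \<Theta> then v x else 0)"

text \<open>The trace operator is the continuous extension to \<open>H\<^sup>1(\<Omega>)\<close>, with values in \<open>L\<^sup>2(\<partial>\<Omega>)\<close>, of
  the pointwise restriction of functions in \<open>H\<^sup>1(\<Omega>)\<close> that are continuous up to the boundary. It is
  given by its graph. Functions on \<open>\<partial>\<Omega>\<close> are represented by Borel functions on the whole space that
  are zero off \<open>\<partial>\<Omega>\<close>; a trace is determined up to a surface null set.\<close>

definition is_trace :: "(real^'d) set \<Rightarrow> ('d::finite) cfun \<Rightarrow> 'd cfun \<Rightarrow> bool" where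
  "is_trace \<Omega> u f \<longleftrightarrow>
     u \<in> H1 \<Omega> \<and> f \<in> borel_measurable borel \<and> (\<forall>x. x \<notin> frontier \<Omega> \<longrightarrow> f x = 0) \<and>
     (\<exists>\<phi> :: nat \<Rightarrow> 'd cfun.
        (\<forall>n. \<phi> n \<in> H1 \<Omega> \<and> continuous_on (closure \<Omega>) (\<phi> n)) \<and>
        (\<lambda>n. H1_norm \<Omega> (\<phi> n - u)) \<longlonglongrightarrow> 0 \<and>
        (\<lambda>n. \<integral>\<^sup>+ x \<in> frontier \<Omega>. ennreal ((cmod (\<phi> n x - f x))\<^sup>2) \<partial>surface_measure) \<longlonglongrightarrow> 0)"

definition H12 :: "(real^'d) set \<Rightarrow> ('d::finite) cfun set" where
  "H12 \<Omega> = {f. \<exists>u. is_trace \<Omega> u f}"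

definition H12_norm :: "(real^'d) set \<Rightarrow> ('d::finite) cfun \<Rightarrow> real" where
  "H12_norm \<Omega> f = Inf {H1_norm \<Omega> u | u. is_trace \<Omega> u f}"

text \<open>As functions that are zero almost everywhere on \<open>\<partial>\<Omega>\<close> have norm zero, a bounded functional
  does not depend on the chosen representative.\<close>

definition Hm12 :: "(real^'d) set \<Rightarrow> ('d::finite) cdistr set" where
  "Hm12 \<Omega> = {q \<in> cdual (H12 \<Omega>). \<exists>C. \<forall>v \<in> H12 \<Omega>. cmod (q v) \<le> C * H12_norm \<Omega> v}"

definition Hm12_norm :: "(real^'d) set \<Rightarrow> ('d::finite) cdistr \<Rightarrow> real" where
  "Hm12_norm \<Omega> q = dual_norm (H12 \<Omega>) (H12_norm \<Omega>) q"

definition fun_cnj :: "('a \<Rightarrow> complex) \<Rightarrow> ('a \<Rightarrow> complex)" where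
  "fun_cnj v = (\<lambda>x. cnj (v x))"

text \<open>A subspace of \<open>H\<^sup>-\<^sup>1\<^sup>/\<^sup>2\<close> need not be stable under conjugation. Where an energy argument tests
  a discrete problem with the conjugate of its solution, this has to be required of the discrete
  boundary space.\<close>

definition distr_cnj :: "('d::finite) cdistr \<Rightarrow> 'd cdistr" where
  "distr_cnj q = (\<lambda>v. cnj (q (fun_cnj v)))"

fun bpair :: "('d::finite) cdistr \<times> 'd cfun \<Rightarrow> 'd cfun \<times> 'd cdistr \<Rightarrow> complex" where
  "bpair (p, w) (v, q) = p v + q w"

definition bnd_eq :: "('d::finite) cdistr \<times> 'd cfun \<Rightarrow> 'd cdistr \<times> 'd cfun \<Rightarrow> bool" where
  "bnd_eq y z \<longleftrightarrow> fst y = fst z \<and> (AE x in surface_measure. snd y x = snd z x)"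

text \<open>Linearity is understood modulo equality almost everywhere in the \<open>H\<^sup>1\<^sup>/\<^sup>2\<close> component of the
  target. Together with the bound it implies independence of representatives in the argument.\<close>

definition bounded_boundary_op ::
  "(real^'d) set \<Rightarrow> (('d::finite) cfun \<times> 'd cdistr \<Rightarrow> 'd cdistr \<times> 'd cfun) \<Rightarrow> bool" where
  "bounded_boundary_op \<Omega> \<A> \<longleftrightarrow>
     (\<forall>x \<in> H12 \<Omega> \<times> Hm12 \<Omega>. \<A> x \<in> Hm12 \<Omega> \<times> H12 \<Omega>) \<and>
     (\<forall>x \<in> H12 \<Omega> \<times> Hm12 \<Omega>. \<forall>y \<in> H12 \<Omega> \<times> Hm12 \<Omega>. bnd_eq (\<A> (x + y)) (\<A> x + \<A> y)) \<and>
     (\<forall>c. \<forall>x \<in> H12 \<Omega> \<times> Hm12 \<Omega>. bnd_eq (\<A> (c *\<^sub>C x)) (c *\<^sub>C \<A> x)) \<and>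
     (\<exists>C. \<forall>v \<in> H12 \<Omega>. \<forall>q \<in> Hm12 \<Omega>.
        Hm12_norm \<Omega> (fst (\<A> (v, q))) + H12_norm \<Omega> (snd (\<A> (v, q)))
          \<le> C * (H12_norm \<Omega> v + Hm12_norm \<Omega> q))"


section \<open>Meshes and finite element spaces\<close>

definition simplicial_mesh :: "(real^'d::finite) set set \<Rightarrow> bool" where
  "simplicial_mesh \<T> \<longleftrightarrow> triangulation \<T> \<and> (\<forall>K\<in>\<T>. int CARD('d) simplex K)"

text \<open>A polyhedral open set made of the cells of \<open>\<S>\<close> is the interior of their union; its closure is
  the union itself, since the cells are full-dimensional.\<close>

definition polyhedral_union :: "(real^'d::finite) set set \<Rightarrow> (real^'d) set \<Rightarrow> bool" where
  "polyhedral_union \<T> \<omega> \<longleftrightarrow> (\<exists>\<S> \<subseteq> \<T>. \<omega> = interior (\<Union>\<S>))"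

definition poly_fun :: "nat \<Rightarrow> ('d::finite) cfun \<Rightarrow> bool" where
  "poly_fun k p \<longleftrightarrow> (\<exists>c :: ('d \<Rightarrow> nat) \<Rightarrow> complex. \<forall>x.
     p x = (\<Sum>\<alpha> | (\<Sum>i\<in>UNIV. \<alpha> i) \<le> k. c \<alpha> * of_real (\<Prod>i\<in>UNIV. (x $ i) ^ \<alpha> i)))"

definition lagrange_fem :: "(real^'d) set set \<Rightarrow> nat \<Rightarrow> ('d::finite) cfun set" where
  "lagrange_fem \<T> k =
     {u. continuous_on (\<Union>\<T>) u \<and> (\<forall>x. x \<notin> \<Union>\<T> \<longrightarrow> u x = 0) \<and>
         (\<forall>K\<in>\<T>. \<exists>p. poly_fun k p \<and> (\<forall>x\<in>K. u x = p x))}"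

definition Vh :: "(real^'d) set set \<Rightarrow> nat \<Rightarrow> (real^'d) set \<Rightarrow> ('d::finite) cfun set" where
  "Vh \<T> k \<Theta> = restr \<Theta> ` lagrange_fem \<T> k"

text \<open>Finite element functions are polynomial inside each cell, so their weak gradient is the
  classical one almost everywhere.\<close>

definition volume_form :: "('d::finite) cfun \<Rightarrow> (real^'d) set \<Rightarrow> 'd cfun \<Rightarrow> 'd cfun \<Rightarrow> complex" where
  "volume_form \<kappa> \<omega> u v =
     (LINT x:\<omega>|lebesgue. (\<Sum>i\<in>UNIV. pd i u x * pd i v x) - (\<kappa> x)\<^sup>2 * u x * v x)"

definition Vh_OG :: "(real^'d) set set \<Rightarrow> nat \<Rightarrow> (real^'d) set \<Rightarrow> ('d::finite) cdistr set \<Rightarrow>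
    ('d cfun \<times> 'd cdistr) set" where
  "Vh_OG \<T> k \<Omega> Q = Vh \<T> k (closure \<Omega>) \<times> Q"

definition A_OG :: "(real^'d) set set \<Rightarrow> nat \<Rightarrow> (real^'d) set \<Rightarrow> ('d::finite) cdistr set \<Rightarrow> 'd cfun \<Rightarrow>
    ('d cfun \<times> 'd cdistr \<Rightarrow> 'd cdistr \<times> 'd cfun) \<Rightarrow>
    'd cfun \<times> 'd cdistr \<Rightarrow> ('d cfun \<times> 'd cdistr \<Rightarrow> complex)" where
  "A_OG \<T> k \<Omega> Q \<kappa> \<A> = (\<lambda>(u, p) (v, q).
     if (v, q) \<in> Vh_OG \<T> k \<Omega> Q
     then volume_form \<kappa> \<Omega> u v
          + bpair (\<A> (restr (frontier \<Omega>) u, p)) (restr (frontier \<Omega>) v, q)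
     else 0)"


section \<open>Multi-domain spaces and operators\<close>

text \<open>The subdomains are \<open>\<omega> 1, \<dots>, \<omega> J\<close>; families indexed by \<open>{1..J}\<close> are zero elsewhere.\<close>

type_synonym 'd mvol = "('d cfun \<times> 'd cdistr) \<times> (nat \<Rightarrow> 'd cfun)"
type_synonym 'd mtr = "'d cfun \<times> (nat \<Rightarrow> 'd cfun)"

definition Vh_b :: "(real^'d) set set \<Rightarrow> nat \<Rightarrow> (real^'d) set \<Rightarrow> ('d::finite) cdistr set \<Rightarrow>
    ('d cfun \<times> 'd cdistr) set" where
  "Vh_b \<T> k \<Omega> Q = Vh \<T> k (frontier \<Omega>) \<times> Q"

definition VV_vol :: "(real^'d) set set \<Rightarrow> nat \<Rightarrow> (real^'d) set \<Rightarrow> ('d::finite) cdistr set \<Rightarrow>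
    nat \<Rightarrow> (nat \<Rightarrow> (real^'d) set) \<Rightarrow> 'd mvol set" where
  "VV_vol \<T> k \<Omega> Q J \<omega> = Vh_b \<T> k \<Omega> Q \<times>
     {u. (\<forall>j\<in>{1..J}. u j \<in> Vh \<T> k (closure (\<omega> j))) \<and> (\<forall>j. j \<notin> {1..J} \<longrightarrow> u j = 0)}"

definition VV_tr :: "(real^'d) set set \<Rightarrow> nat \<Rightarrow> (real^'d) set \<Rightarrow>
    nat \<Rightarrow> (nat \<Rightarrow> (real^'d) set) \<Rightarrow> ('d::finite) mtr set" where
  "VV_tr \<T> k \<Omega> J \<omega> = Vh \<T> k (frontier \<Omega>) \<times>
     {u. (\<forall>j\<in>{1..J}. u j \<in> Vh \<T> k (frontier (\<omega> j))) \<and> (\<forall>j. j \<notin> {1..J} \<longrightarrow> u j = 0)}"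

definition skeleton :: "(real^'d) set \<Rightarrow> nat \<Rightarrow> (nat \<Rightarrow> (real^'d) set) \<Rightarrow> (real^'d::finite) set" where
  "skeleton \<Omega> J \<omega> = frontier \<Omega> \<union> (\<Union>j\<in>{1..J}. frontier (\<omega> j))"

definition trace_B :: "nat \<Rightarrow> (nat \<Rightarrow> (real^'d) set) \<Rightarrow> ('d::finite) mvol \<Rightarrow> 'd mtr" where
  "trace_B J \<omega> = (\<lambda>((v, q), u).
     (v, \<lambda>j. if j \<in> {1..J} then restr (frontier (\<omega> j)) (u j) else 0))"

definition restriction_R ::
  "(real^'d) set \<Rightarrow> nat \<Rightarrow> (nat \<Rightarrow> (real^'d) set) \<Rightarrow> ('d::finite) cfun \<Rightarrow> 'd mtr" where
  "restriction_R \<Omega> J \<omega> w =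
     (restr (frontier \<Omega>) w, \<lambda>j. if j \<in> {1..J} then restr (frontier (\<omega> j)) w else 0)"

definition mtr_cnj :: "('d::finite) mtr \<Rightarrow> 'd mtr" where
  "mtr_cnj = (\<lambda>(v, u). (fun_cnj v, \<lambda>j. fun_cnj (u j)))"

definition A_multi :: "(real^'d) set set \<Rightarrow> nat \<Rightarrow> (real^'d) set \<Rightarrow> ('d::finite) cdistr set \<Rightarrow>
    nat \<Rightarrow> (nat \<Rightarrow> (real^'d) set) \<Rightarrow> 'd cfun \<Rightarrow>
    ('d cfun \<times> 'd cdistr \<Rightarrow> 'd cdistr \<times> 'd cfun) \<Rightarrow> 'd mvol \<Rightarrow> ('d mvol \<Rightarrow> complex)" where
  "A_multi \<T> k \<Omega> Q J \<omega> \<kappa> \<A> = (\<lambda>(b, u) (b', u').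
     if (b', u') \<in> VV_vol \<T> k \<Omega> Q J \<omega>
     then bpair (\<A> b) b' + (\<Sum>j\<in>{1..J}. volume_form \<kappa> (\<omega> j) (u j) (u' j))
     else 0)"

text \<open>Admissible impedances on \<^term>\<open>W\<close> with conjugation \<^term>\<open>cj\<close>: \<open>T\<^sup>* = T\<close>, \<open>T\<close> commutes with
  conjugation (the conjugate of a functional \<open>p\<close> being \<open>u \<mapsto> cnj (p (cj u))\<close>), and \<open>T\<close> is positive
  definite.\<close>

definition impedance ::
  "'a::complex_vs set \<Rightarrow> ('a \<Rightarrow> 'a) \<Rightarrow> ('a \<Rightarrow> ('a \<Rightarrow> complex)) \<Rightarrow> bool" where
  "impedance W cj T \<longleftrightarrow>
     (\<forall>u\<in>W. T u \<in> cdual W) \<and> clinear_on W T \<and>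
     (\<forall>u\<in>W. \<forall>v\<in>W. T u v = T v u) \<and>
     (\<forall>u\<in>W. \<forall>v\<in>W. T (cj u) (cj v) = cnj (T u v)) \<and>
     (\<forall>u\<in>W. u \<noteq> 0 \<longrightarrow> T u (cj u) \<in> \<real> \<and> 0 < Re (T u (cj u)))"

text \<open>In the following, \<open>X\<close>, \<open>W\<close> and \<open>V\<close> stand for the single-trace space on the skeleton, the
  multi-trace space and the multi-domain volume space.\<close>

definition exchange_op :: "'x set \<Rightarrow> ('x \<Rightarrow> 'a::complex_vs) \<Rightarrow> ('a \<Rightarrow> ('a \<Rightarrow> complex)) \<Rightarrow>
    ('a \<Rightarrow> complex) \<Rightarrow> ('a \<Rightarrow> complex)" where
  "exchange_op X R T p =
     2 *\<^sub>C T (R (the_inv_into X (\<lambda>u. adj X R (T (R u))) (adj X R p))) - p"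

definition impedance_op :: "'v set \<Rightarrow> ('v \<Rightarrow> ('v \<Rightarrow> complex)) \<Rightarrow> ('v \<Rightarrow> 'a) \<Rightarrow>
    ('a \<Rightarrow> ('a \<Rightarrow> complex)) \<Rightarrow> 'v \<Rightarrow> ('v \<Rightarrow> complex)" where
  "impedance_op V A B T u = A u - \<i> *\<^sub>C adj V B (T (B u))"

definition scattering_op :: "'v set \<Rightarrow> ('v \<Rightarrow> real) \<Rightarrow> ('v \<Rightarrow> ('v \<Rightarrow> complex)) \<Rightarrow> ('v \<Rightarrow> 'a) \<Rightarrow>
    ('a \<Rightarrow> ('a \<Rightarrow> complex)) \<Rightarrow> ('a \<Rightarrow> complex) \<Rightarrow> ('a \<Rightarrow> complex)" where
  "scattering_op V N A B T p =
     p + (2 * \<i>) *\<^sub>C T (B (pinv V N (dual_norm V N) (impedance_op V A B T) (adj V B p)))"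

end

(*
The multi-domain families whose traces come from a function on the skeleton are exactly the
images of the global functions, so the kernel of the global operator is isomorphic to the space K
of such families u with <A u, v> = 0 for all such families v. Since B is onto, A u = B^* p for a
unique p when u is in K, and u |-> p - i T B u maps K linearly into the dual of the trace space.
In the variables p and B u, the scattering operator maps p - i T B u to p + i T B u, and
(p - i T w) + Pi (p + i T w) = 0 holds if and only if w is in the range of R and R^* p = 0. Hence
the image of this map is Ker (Id + Pi S), its kernel is Ker A intersected with Ker B, and the
formula is the rank theorem. The pseudo-inverse enters only through two facts about
A - i B^* T B: its kernel lies in Ker B and its range contains the range of B^*. Both hold when it
is invertible; under the sign condition on the boundary operator both follow by testing with the
conjugate and taking imaginary parts.
*)
theory Submission
  imports Defs
begin

subsection \<open>Finite-dimensional complex spaces\<close>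

text \<open>Most of the analysis serves one purpose: the discrete operators have to be linear. The
  operator on the boundary is linear only up to surface null sets, so every discrete trace must
  first be a genuine element of the trace space, and bounded functionals must be shown not to see
  null sets. For this, finite element functions need their classical gradient as weak gradient; it
  is obtained without surface integrals, from the translation invariance of Lebesgue measure. The
  volume form is a Bochner integral and is linear only once integrability is known. Under the sign
  condition the range is found by duality in finite dimension: it consists of the functionals that
  vanish on every test vector killed by all values of the operator. The operator need not be
  symmetric, so such a test vector is read as the conjugate of a trial vector; this is where the
  discrete boundary space must be stable under conjugation.\<close>

global_interpretation cvec_pair: vector_space_pair
  "scaleC :: complex \<Rightarrow> 'a \<Rightarrow> 'a::complex_vs" "scaleC :: complex \<Rightarrow> 'b \<Rightarrow> 'b::complex_vs"
  ..

abbreviation clinear :: "('a::complex_vs \<Rightarrow> 'b::complex_vs) \<Rightarrow> bool" where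
  "clinear \<equiv> Vector_Spaces.linear scaleC scaleC"

text \<open>Containment in a span rather than equality, so that every subset, subspace or not,
  inherits the property.\<close>

definition fin_dim :: "'a::complex_vs set \<Rightarrow> bool" where
  "fin_dim V \<longleftrightarrow> (\<exists>F. finite F \<and> V \<subseteq> cvec.span F)"

lemma clinear_onD:
  assumes "clinear_on V f"
  shows "x \<in> V \<Longrightarrow> y \<in> V \<Longrightarrow> f (x + y) = f x + f y"
    and "x \<in> V \<Longrightarrow> f (c *\<^sub>C x) = c *\<^sub>C f x"
  using assms by (auto simp: clinear_on_def)

lemma clinear_imp_clinear_on: "clinear f \<Longrightarrow> clinear_on V f"
  by (simp add: clinear_on_def cvec_pair.linear_add cvec_pair.linear_scale)

text \<open>The values on a basis of \<open>V\<close> determine \<open>f\<close> on \<open>V\<close>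
  and can be extended to the whole type. Maps that are linear only on a carrier thereby come within
  reach of the theory of globally linear maps.\<close>

lemma clinear_on_extend:
  assumes "cvec.subspace V" "clinear_on V f"
  obtains g where "clinear g" "\<And>x. x \<in> V \<Longrightarrow> g x = f x"
proof -
  obtain B where B: "B \<subseteq> V" "cvec.independent B" "V \<subseteq> cvec.span B"
    by (rule cvec.maximal_independent_subset)
  obtain g where g: "clinear g" "\<forall>x\<in>B. g x = f x"
    using cvec_pair.linear_independent_extend[OF B(2)] by blast
  have "x \<in> V \<and> g x = f x" if "x \<in> cvec.span B" for x
    using that
  proof (induction rule: cvec.span_induct_alt)
    case base
    have "f 0 = 0"
      using clinear_onD(2)[OF assms(2) cvec.subspace_0[OF assms(1)], of 0] by simp
    then show ?case
      using assms(1) cvec_pair.linear_0[OF g(1)] by (simp add: cvec.subspace_0)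
  next
    case (step c x y)
    then have "x \<in> V" using B by blast
    then show ?case using step g assms
      by (simp add: cvec.subspace_add cvec.subspace_scale cvec_pair.linear_add
          cvec_pair.linear_scale clinear_onD)
  qed
  then show ?thesis using that g(1) B(3) by blast
qed

lemma clinear_on_zero: "cvec.subspace V \<Longrightarrow> clinear_on V f \<Longrightarrow> f 0 = 0"
  using clinear_onD(2)[of V f 0 0] by (simp add: cvec.subspace_0)

lemma clinear_on_diff:
  assumes "cvec.subspace V" "clinear_on V f" "x \<in> V" "y \<in> V"
  shows "f (x - y) = f x - f y"
proof -
  obtain g where g: "clinear g" "\<And>x. x \<in> V \<Longrightarrow> g x = f x"
    using clinear_on_extend assms(1,2) by blast
  then show ?thesis
    using assms cvec_pair.linear_diff[OF g(1), of x y] by (simp add: cvec.subspace_diff)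
qed

lemma fin_dim_subset: "fin_dim V \<Longrightarrow> U \<subseteq> V \<Longrightarrow> fin_dim U"
  by (auto simp: fin_dim_def)

lemma fin_dim_image:
  assumes "fin_dim V" "clinear f"
  shows "fin_dim (f ` V)"
proof -
  obtain F where "finite F" "V \<subseteq> cvec.span F" using assms by (auto simp: fin_dim_def)
  then have "finite (f ` F)" "f ` V \<subseteq> cvec.span (f ` F)"
    using cvec_pair.linear_spans_image[OF assms(2)] by auto
  then show ?thesis by (auto simp: fin_dim_def)
qed

lemma fin_dim_basis:
  assumes "fin_dim V" "cvec.subspace V"
  obtains B where "finite B" "B \<subseteq> V" "cvec.independent B" "cvec.span B = V"
proof -
  obtain B where B: "B \<subseteq> V" "cvec.independent B" "V \<subseteq> cvec.span B"
    by (rule cvec.maximal_independent_subset)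
  obtain F where F: "finite F" "V \<subseteq> cvec.span F" using assms by (auto simp: fin_dim_def)
  have "finite B" using cvec.independent_span_bound[OF F(1) B(2)] B F by blast
  moreover have "cvec.span B = V" using B assms cvec.span_subspace by blast
  ultimately show ?thesis using that B by blast
qed

lemma subspace_clinear_on_image:
  assumes "cvec.subspace V" "clinear_on V f"
  shows "cvec.subspace (f ` V)"
proof -
  obtain g where g: "clinear g" "\<And>x. x \<in> V \<Longrightarrow> g x = f x"
    using clinear_on_extend assms by blast
  have "g ` V = f ` V" using g(2) by (auto simp: image_iff)
  then show ?thesis using cvec_pair.linear_subspace_image[OF g(1) assms(1)] by simp
qed

text \<open>A basis \<open>B\<close> of the kernel is extended to a basis \<open>C\<close> of
  \<open>V\<close>; the vectors of \<open>C - B\<close> are then mapped injectively onto a basis of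
  the range.\<close>

lemma rank_nullity:
  assumes V: "cvec.subspace V" "fin_dim V" and f: "clinear_on V f"
  shows "cvec.dim V = cvec.dim (ker_on V f) + cvec.dim (f ` V)"
proof -
  obtain g where g: "clinear g" "\<And>x. x \<in> V \<Longrightarrow> g x = f x"
    using clinear_on_extend V(1) f by blast
  obtain F where F: "finite F" "V \<subseteq> cvec.span F" using V by (auto simp: fin_dim_def)
  define K where "K = ker_on V f"
  obtain B where B: "B \<subseteq> K" "cvec.independent B" "K \<subseteq> cvec.span B"
    by (rule cvec.maximal_independent_subset)
  have KV: "K \<subseteq> V" by (auto simp: K_def ker_on_def)
  obtain C where C: "B \<subseteq> C" "C \<subseteq> V" "cvec.independent C" "V \<subseteq> cvec.span C"
    using cvec.maximal_independent_subset_extend[of B V] B KV by (metis order_trans)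
  have finC: "finite C" using cvec.independent_span_bound[OF F(1) C(3)] C(2) F(2) by blast
  have spC: "cvec.span C = V" using C V cvec.span_subspace by blast
  let ?D = "C - B"
  \<comment> \<open>Such an \<open>x\<close> lies both in the span of \<open>B\<close> and in that
    of \<open>C - B\<close>, so all its coordinates with respect to \<open>C\<close> vanish.\<close>
  have inj0: "x = 0" if x: "x \<in> cvec.span ?D" "g x = 0" for x
  proof -
    have "x \<in> V" using x(1) spC cvec.span_mono[of ?D C] by blast
    then have "x \<in> cvec.span B" using x g B(3) by (auto simp: K_def ker_on_def)
    then have "cvec.representation C x = cvec.representation B x"
      using C by (intro cvec.representation_extend)
    moreover have "cvec.representation C x = cvec.representation ?D x"
      using C x by (intro cvec.representation_extend) auto
    ultimately have "cvec.representation C x b = 0" for b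
      using cvec.representation_ne_zero[of B x b] cvec.representation_ne_zero[of ?D x b] by fastforce
    moreover have "x \<in> cvec.span C" using \<open>x \<in> V\<close> spC by simp
    ultimately show ?thesis
      using cvec.sum_representation_eq[OF C(3) _ finC order_refl, of x] by simp
  qed
  have inj: "inj_on g (cvec.span ?D)"
    using cvec_pair.linear_inj_on_iff_eq_0[OF g(1) cvec.subspace_span] inj0 by blast
  have indD: "cvec.independent (g ` ?D)"
    using cvec_pair.linear_independent_injective_image[OF g(1) _ inj] C(3)
    by (meson Diff_subset cvec.independent_mono)
  have "f ` V = cvec.span (g ` ?D)"
  proof -
    have "f ` V = g ` V" using g by (auto simp: image_iff)
    also have "\<dots> = cvec.span (g ` C)" using cvec_pair.linear_span_image[OF g(1)] spC by metis
    also have "\<dots> = cvec.span (g ` ?D)"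
    proof (rule antisym)
      have "g ` C \<subseteq> cvec.span (g ` ?D)"
      proof
        fix y assume "y \<in> g ` C"
        then obtain c where c: "c \<in> C" "y = g c" by blast
        show "y \<in> cvec.span (g ` ?D)"
        proof (cases "c \<in> B")
          case True
          then have "g c = 0" using B KV g by (auto simp: K_def ker_on_def subset_iff)
          then show ?thesis using c cvec.span_zero by simp
        next
          case False then show ?thesis using c by (auto intro: cvec.span_base)
        qed
      qed
      then show "cvec.span (g ` C) \<subseteq> cvec.span (g ` ?D)"
        by (meson cvec.span_minimal cvec.subspace_span)
    qed (auto intro!: cvec.span_mono)
    finally show ?thesis .
  qed
  then have "cvec.dim (f ` V) = card (g ` ?D)" using cvec.dim_span_eq_card_independent[OF indD] by simp
  also have "\<dots> = card ?D"
    using inj by (intro card_image) (meson cvec.span_superset inj_on_subset)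
  also have "\<dots> = card C - card B" using C finC by (meson card_Diff_subset finite_subset)
  finally have "cvec.dim (f ` V) = card C - card B" .
  moreover have "cvec.dim V = card C" using cvec.basis_card_eq_dim C by metis
  moreover have "cvec.dim K = card B" using cvec.basis_card_eq_dim B by metis
  moreover have "card B \<le> card C" using C finC by (simp add: card_mono)
  ultimately show ?thesis by (simp add: K_def)
qed

lemma dim_image_eq:
  assumes V: "cvec.subspace V" "fin_dim V" and f: "clinear_on V f"
    and inj: "\<And>x. x \<in> V \<Longrightarrow> f x = 0 \<Longrightarrow> x = 0"
  shows "cvec.dim (f ` V) = cvec.dim V"
proof -
  have "ker_on V f = {0}"
    using inj V(1) clinear_on_zero[OF V(1) f] by (auto simp: ker_on_def cvec.subspace_0)
  moreover have "cvec.dim {0::'a} = 0"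
    using cvec.dim_le_card[of "{0::'a}" "{}"] by simp
  ultimately show ?thesis using rank_nullity[OF V f] by simp
qed

section \<open>Functionals and annihilators\<close>

lemma cdual_subspace: "cvec.subspace (cdual V)"
  by (rule cvec.subspaceI)
    (auto simp: cdual_def clinear_on_def scaleC_fun_def scaleC_complex_def algebra_simps)

lemma cdualD:
  assumes "p \<in> cdual V"
  shows "clinear_on V p" "x \<notin> V \<Longrightarrow> p x = 0"
  using assms by (auto simp: cdual_def)

lemma cdual_eqI:
  assumes "p \<in> cdual V" "q \<in> cdual V" "\<And>x. x \<in> V \<Longrightarrow> p x = q x"
  shows "p = q"
proof
  show "p x = q x" for x
    using assms cdualD(2)[of p V x] cdualD(2)[of q V x] by (cases "x \<in> V") auto
qed

lemma adj_cdual: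
  assumes "cvec.subspace V" "clinear_on V L" "L ` V \<subseteq> W" "p \<in> cdual W"
  shows "adj V L p \<in> cdual V"
  using assms
  by (auto simp: cdual_def adj_def clinear_on_def cvec.subspace_add cvec.subspace_scale image_subset_iff)

text \<open>Induction on the number of functionals. If \<open>g\<close> vanishes on the common
  kernel of the others, it can be left out. Otherwise some \<open>v\<close> in that kernel has
  \<open>g v \<noteq> 0\<close>, and subtracting a multiple of \<open>g\<close> makes
  \<open>f\<close> vanish at \<open>v\<close>.\<close>

lemma functional_in_span:
  assumes "finite G" "cvec.subspace V" "G \<subseteq> cdual V" "f \<in> cdual V"
    and "\<And>v. v \<in> V \<Longrightarrow> (\<forall>g\<in>G. g v = 0) \<Longrightarrow> f v = 0"
  shows "f \<in> cvec.span G"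
  using assms(1,3-)
proof (induction arbitrary: f rule: finite_induct)
  case empty
  then have "f = 0" using cdual_eqI[of f V 0] cvec.subspace_0[OF cdual_subspace] by auto
  then show ?case by (simp add: func_zero)
next
  case (insert g G)
  show ?case
  proof (cases "\<forall>v\<in>V. (\<forall>h\<in>G. h v = 0) \<longrightarrow> g v = 0")
    case True
    then have "f \<in> cvec.span G" using insert by (intro insert.IH) auto
    then show ?thesis using cvec.span_mono[of G "insert g G"] by blast
  next
    case False
    then obtain v where v: "v \<in> V" "\<forall>h\<in>G. h v = 0" "g v \<noteq> 0" by blast
    define f' where "f' = f - (f v / g v) *\<^sub>C g"
    have gV: "g \<in> cdual V" using insert by simp
    have "f' \<in> cvec.span G"
    proof (rule insert.IH)
      show "f' \<in> cdual V" unfolding f'_def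
        by (intro cvec.subspace_diff cvec.subspace_scale cdual_subspace insert gV)
      fix u assume u: "u \<in> V" "\<forall>h\<in>G. h u = 0"
      \<comment> \<open>Shifting \<open>u\<close> along \<open>v\<close> puts it into the kernel of
        \<open>g\<close> without changing the values of the functionals in \<open>G\<close>, and
        \<open>f w\<close> equals \<open>f' u\<close>.\<close>
      define w where "w = u - (g u / g v) *\<^sub>C v"
      have w: "w \<in> V" unfolding w_def using assms(2) u v
        by (intro cvec.subspace_diff cvec.subspace_scale)
      have val: "h w = h u - (g u / g v) * h v" if "h \<in> cdual V" for h
        unfolding w_def using that u v assms(2)
        by (simp add: clinear_on_diff[OF assms(2) cdualD(1)] cvec.subspace_scale
            clinear_onD(2)[OF cdualD(1)] scaleC_complex_def)
      have "h w = 0" if "h \<in> insert g G" for h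
        using that val[OF subsetD[OF insert.prems(1) that]] u(2) v(2,3) by auto
      then have "f w = 0" using insert.prems(3) w by blast
      then show "f' u = 0" using val[OF insert(5)] v
        by (simp add: f'_def scaleC_fun_def scaleC_complex_def field_simps)
    qed (use insert in auto)
    then have "f' \<in> cvec.span (insert g G)"
      using cvec.span_mono[of G "insert g G"] by blast
    moreover have "(f v / g v) *\<^sub>C g \<in> cvec.span (insert g G)"
      by (intro cvec.span_scale cvec.span_base) simp
    ultimately have "f' + (f v / g v) *\<^sub>C g \<in> cvec.span (insert g G)"
      by (rule cvec.span_add)
    then show ?thesis by (simp add: f'_def)
  qed
qed

text \<open>The images of a basis are finitely many functionals that span the range, so
  \<open>functional_in_span\<close> applies to them. Solvability of a linear equation thereby
  becomes a question about test vectors.\<close>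

lemma in_range_of_annihilates:
  assumes V: "cvec.subspace V" "fin_dim V" "cvec.subspace U"
    and L: "clinear_on V L" "L ` V \<subseteq> cdual U" and f: "f \<in> cdual U"
    and ann: "\<And>u. u \<in> U \<Longrightarrow> (\<forall>v\<in>V. L v u = 0) \<Longrightarrow> f u = 0"
  shows "f \<in> L ` V"
proof -
  obtain B where B: "finite B" "B \<subseteq> V" "cvec.span B = V" using fin_dim_basis[OF V(2,1)] by metis
  obtain g where g: "clinear g" "\<And>x. x \<in> V \<Longrightarrow> g x = L x"
    using clinear_on_extend V(1) L(1) by blast
  have gV: "g ` V = L ` V" using g(2) by (auto simp: image_iff)
  have sp: "cvec.span (g ` B) = g ` V" using cvec_pair.linear_span_image[OF g(1)] B by metis
  have gB: "g ` B \<subseteq> cdual U"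
    using image_mono[OF B(2), of g] L(2) unfolding gV by (rule order_trans)
  have "f \<in> cvec.span (g ` B)"
  proof (rule functional_in_span[OF _ V(3) _ f])
    fix u assume u: "u \<in> U" "\<forall>h\<in>g ` B. h u = 0"
    have "h u = 0" if "h \<in> cvec.span (g ` B)" for h
      using that by (induction rule: cvec.span_induct_alt) (use u in \<open>auto simp: scaleC_fun_def scaleC_complex_def\<close>)
    then have "L v u = 0" if "v \<in> V" for v by (simp add: sp gV that)
    then show "f u = 0" using ann[OF u(1)] by simp
  qed (use B gB in auto)
  then show ?thesis using sp gV by simp
qed

subsection \<open>Hermitian products\<close>

locale hermitian_space =
  fixes V :: "'a::complex_vs set" and ip :: "'a \<Rightarrow> 'a \<Rightarrow> complex"
  assumes V: "cvec.subspace V" and fin: "fin_dim V" and ip: "hermitian_ip_on V ip"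
begin

lemma clinear_left: "z \<in> V \<Longrightarrow> clinear_on V (\<lambda>x. ip x z)"
  and sym: "x \<in> V \<Longrightarrow> y \<in> V \<Longrightarrow> ip y x = cnj (ip x y)"
  and pos: "x \<in> V \<Longrightarrow> x \<noteq> 0 \<Longrightarrow> 0 < Re (ip x x)"
proof -
  note h = ip[unfolded hermitian_ip_on_def]
  show "z \<in> V \<Longrightarrow> clinear_on V (\<lambda>x. ip x z)" by (rule bspec[OF conjunct1[OF h]])
  show "x \<in> V \<Longrightarrow> y \<in> V \<Longrightarrow> ip y x = cnj (ip x y)"
    by (rule bspec[OF bspec[OF conjunct1[OF conjunct2[OF h]]]])
  show "x \<in> V \<Longrightarrow> x \<noteq> 0 \<Longrightarrow> 0 < Re (ip x x)"
    by (rule mp[OF bspec[OF conjunct2[OF conjunct2[OF h]]]])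
qed

lemma add_left: "x \<in> V \<Longrightarrow> y \<in> V \<Longrightarrow> z \<in> V \<Longrightarrow> ip (x + y) z = ip x z + ip y z"
  using clinear_onD(1)[OF clinear_left] .

lemma scale_left: "x \<in> V \<Longrightarrow> z \<in> V \<Longrightarrow> ip (c *\<^sub>C x) z = c * ip x z"
  using clinear_onD(2)[OF clinear_left, of z x c] by (simp add: scaleC_complex_def)

lemma add_right: "x \<in> V \<Longrightarrow> y \<in> V \<Longrightarrow> z \<in> V \<Longrightarrow> ip z (x + y) = ip z x + ip z y"
  by (metis V add_left complex_cnj_add cvec.subspace_add sym)

lemma scale_right: "x \<in> V \<Longrightarrow> z \<in> V \<Longrightarrow> ip z (c *\<^sub>C x) = cnj c * ip z x"
  by (metis V complex_cnj_mult cvec.subspace_scale scale_left sym)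

lemma diff_left: "x \<in> V \<Longrightarrow> y \<in> V \<Longrightarrow> z \<in> V \<Longrightarrow> ip (x - y) z = ip x z - ip y z"
  using clinear_on_diff[OF V clinear_left] .

lemma zero_left: "z \<in> V \<Longrightarrow> ip 0 z = 0"
  using scale_left[of 0 z 0] cvec.subspace_0[OF V] by simp

lemma ip_real: "x \<in> V \<Longrightarrow> ip x x = of_real (Re (ip x x))"
  using sym[of x x] by (simp add: complex_eq_iff)

lemma nonneg: "x \<in> V \<Longrightarrow> 0 \<le> Re (ip x x)"
  using pos[of x] zero_left[of 0] by (cases "x = 0") (auto simp: less_imp_le)

lemma ip_nonzero: "x \<in> V \<Longrightarrow> x \<noteq> 0 \<Longrightarrow> ip x x \<noteq> 0"
  using pos by force

text \<open>Gram-Schmidt, carried out as an induction over a finite spanning set; the projection of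
  the new vector \<open>b\<close> comes from the same induction hypothesis as that of
  \<open>x\<close>.\<close>

lemma projection:
  assumes U: "cvec.subspace U" "U \<subseteq> V" and x: "x \<in> V"
  obtains y where "y \<in> U" "\<And>z. z \<in> U \<Longrightarrow> ip (x - y) z = 0"
proof -
  have "\<exists>y\<in>cvec.span F. \<forall>z\<in>cvec.span F. ip (x - y) z = 0" if "finite F" "F \<subseteq> V" "x \<in> V" for F x
    using that
  proof (induction arbitrary: x rule: finite_induct)
    case empty
    then show ?case using sym[of x 0] zero_left[of x] cvec.subspace_0[OF V] by auto
  next
    case (insert b F)
    have FV: "cvec.span F \<subseteq> V" using insert V by (simp add: cvec.span_minimal)
    have b: "b \<in> V" using insert by simp
    obtain p where p: "p \<in> cvec.span F" "\<And>z. z \<in> cvec.span F \<Longrightarrow> ip (b - p) z = 0"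
      using insert b by blast
    obtain y where y: "y \<in> cvec.span F" "\<And>z. z \<in> cvec.span F \<Longrightarrow> ip (x - y) z = 0"
      using insert by blast
    define e where "e = b - p"
    have eV: "e \<in> V" unfolding e_def using b p FV V by (meson cvec.subspace_diff subsetD)
    have xy: "x - y \<in> V" using insert.prems y FV V by (meson cvec.subspace_diff subsetD)
    have mono: "cvec.span F \<subseteq> cvec.span (insert b F)" by (intro cvec.span_mono) auto
    have e_span: "e \<in> cvec.span (insert b F)"
      unfolding e_def using p mono by (meson cvec.span_base cvec.span_diff insertI1 subsetD)
    \<comment> \<open>\<open>e\<close> is the part of \<open>b\<close> orthogonal to the span of
      \<open>F\<close>. If \<open>e = 0\<close>, the added multiple of \<open>e\<close> is zero,
      which is right because \<open>b\<close> then already lies in that span.\<close>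
    define y' where "y' = y + (ip (x - y) e / ip e e) *\<^sub>C e"
    have y': "y' \<in> cvec.span (insert b F)"
      unfolding y'_def using y mono e_span by (meson cvec.span_add cvec.span_scale subsetD)
    have "ip (x - y') z = 0" if z: "z \<in> cvec.span (insert b F)" for z
    proof -
      obtain c where "z - c *\<^sub>C b \<in> cvec.span F"
        using cvec.span_breakdown_eq z by blast
      then have "(z - c *\<^sub>C b) + c *\<^sub>C p \<in> cvec.span F"
        using p by (meson cvec.span_add cvec.span_scale)
      moreover define u where "u = (z - c *\<^sub>C b) + c *\<^sub>C p"
      ultimately have u: "u \<in> cvec.span F" by simp
      have z_eq: "z = u + c *\<^sub>C e" by (simp add: u_def e_def cvec.scale_right_diff_distrib)
      have uV: "u \<in> V" using u FV by blast
      have "ip e u = 0" using p u by (simp add: e_def)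
      moreover have "ip (x - y) u = 0" using y u by blast
      moreover have xe: "x - y' = (x - y) - (ip (x - y) e / ip e e) *\<^sub>C e" by (simp add: y'_def)
      moreover have "e \<noteq> 0 \<Longrightarrow> ip e e \<noteq> 0" using ip_nonzero eV by blast
      moreover have "ip (x - y) 0 = 0"
        using sym[of 0 "x - y"] zero_left[OF xy] xy cvec.subspace_0[OF V] by simp
      ultimately show ?thesis
        unfolding z_eq xe using uV eV xy V
        by (cases "e = 0") (simp_all add: diff_left add_right scale_right scale_left
            cvec.subspace_scale cvec.subspace_add)
    qed
    then show ?case using y' by blast
  qed
  moreover obtain B where "finite B" "B \<subseteq> U" "cvec.span B = U"
    using fin_dim_basis[OF fin_dim_subset[OF fin U(2)] U(1)] by metis
  ultimately show ?thesis using that U(2) x by (metis order_trans)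
qed

lemma pythagoras:
  assumes "x \<in> V" "y \<in> V" "ip x y = 0"
  shows "Re (ip (x + y) (x + y)) = Re (ip x x) + Re (ip y y)"
  using assms sym[of x y] V by (simp add: add_left add_right cvec.subspace_add)

lemma cauchy_schwarz:
  assumes x: "x \<in> V" and y: "y \<in> V"
  shows "cmod (ip x y) \<le> ip_norm ip x * ip_norm ip y"
proof (cases "y = 0")
  case True
  then show ?thesis using sym[of y x] zero_left[of x] x y by (simp add: ip_norm_def zero_left)
next
  case False
  define c where "c = ip x y / ip y y"
  have cy: "c *\<^sub>C y \<in> V" and d: "x - c *\<^sub>C y \<in> V"
    using x y V by (simp_all add: cvec.subspace_diff cvec.subspace_scale)
  have yy: "ip y y \<noteq> 0" using ip_nonzero False y by blast
  have "ip (x - c *\<^sub>C y) (c *\<^sub>C y) = 0"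
    using x y cy d yy by (simp add: diff_left scale_right scale_left c_def)
  from pythagoras[OF d cy this]
  have "Re (ip (c *\<^sub>C y) (c *\<^sub>C y)) \<le> Re (ip x x)" using nonneg[OF d] by simp
  moreover have "ip (c *\<^sub>C y) (c *\<^sub>C y) = (cmod c)\<^sup>2 * ip y y"
    unfolding complex_norm_square using y cy by (simp add: scale_left scale_right)
  ultimately have "(cmod c)\<^sup>2 * Re (ip y y) \<le> Re (ip x x)" by simp
  moreover have "cmod (ip y y) = Re (ip y y)" using ip_real[OF y] nonneg[OF y]
    by (metis abs_of_nonneg norm_of_real)
  moreover have yp: "0 < Re (ip y y)" using pos False y by blast
  ultimately have "(cmod (ip x y))\<^sup>2 \<le> Re (ip x x) * Re (ip y y)"
    by (simp add: c_def norm_divide power2_eq_square field_simps)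
  then have "cmod (ip x y) \<le> sqrt (Re (ip x x) * Re (ip y y))"
    by (rule real_le_rsqrt)
  then show ?thesis by (simp add: ip_norm_def real_sqrt_mult)
qed

text \<open>A vector \<open>z\<close> orthogonal to the kernel of \<open>p\<close> represents
  \<open>p\<close> up to a factor, so the Cauchy-Schwarz inequality gives the bound. It makes the
  real supremum in \<open>dual_norm\<close> meaningful.\<close>

lemma functional_bounded:
  assumes p: "p \<in> cdual V"
  obtains C where "\<And>x. x \<in> V \<Longrightarrow> cmod (p x) \<le> C * ip_norm ip x"
proof (cases "\<forall>x\<in>V. p x = 0")
  case True
  show ?thesis by (rule that[of 0]) (use True in simp)
next
  case False
  then obtain x0 where x0: "x0 \<in> V" "p x0 \<noteq> 0" by blast
  note lin = clinear_onD[OF cdualD(1)[OF p]] clinear_on_diff[OF V cdualD(1)[OF p]]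
  define K where "K = ker_on V p"
  have K: "cvec.subspace K" "K \<subseteq> V"
    using V clinear_on_zero[OF V cdualD(1)[OF p]]
    by (auto simp: K_def ker_on_def cvec.subspace_def lin scaleC_complex_def)
  obtain y where y: "y \<in> K" "\<And>z. z \<in> K \<Longrightarrow> ip (x0 - y) z = 0"
    using projection[OF K x0(1)] by blast
  define z where "z = x0 - y"
  have z: "z \<in> V" "p z \<noteq> 0"
    using x0 y(1) V by (auto simp: z_def K_def ker_on_def cvec.subspace_diff lin)
  then have "z \<noteq> 0" using clinear_on_zero[OF V cdualD(1)[OF p]] by auto
  then have zz: "ip z z \<noteq> 0" using z ip_nonzero by blast
  show ?thesis
  proof (rule that)
    fix x assume x: "x \<in> V"
    define w where "w = x - (p x / p z) *\<^sub>C z"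
    have w: "w \<in> K" unfolding w_def K_def ker_on_def
      using x z V by (simp add: cvec.subspace_diff cvec.subspace_scale lin scaleC_complex_def)
    then have "ip w z = 0" using y(2)[OF w] sym[of z w] z K by (auto simp: z_def)
    then have "ip x z = (p x / p z) * ip z z"
      using x z V by (simp add: w_def diff_left scale_left cvec.subspace_scale)
    then have "p x = (p z / ip z z) * ip x z" using zz z by simp
    then have "cmod (p x) = cmod (p z / ip z z) * cmod (ip x z)" by (metis norm_mult)
    also have "\<dots> \<le> cmod (p z / ip z z) * (ip_norm ip x * ip_norm ip z)"
      by (intro mult_left_mono cauchy_schwarz x z) simp
    finally show "cmod (p x) \<le> (cmod (p z / ip z z) * ip_norm ip z) * ip_norm ip x"
      by (simp add: mult_ac)
  qed
qed

section \<open>Dual norm and pseudo-inverse\<close>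

abbreviation "N \<equiv> ip_norm ip"

lemma N_scale: "x \<in> V \<Longrightarrow> N (c *\<^sub>C x) = cmod c * N x"
proof -
  assume x: "x \<in> V"
  have "ip (c *\<^sub>C x) (c *\<^sub>C x) = (cmod c)\<^sup>2 * ip x x"
    unfolding complex_norm_square using x V
    by (simp add: scale_left scale_right cvec.subspace_scale)
  then show ?thesis by (simp add: ip_norm_def real_sqrt_mult)
qed

lemma dual_norm_bdd:
  assumes p: "p \<in> cdual V"
  shows "bdd_above ((\<lambda>x. cmod (p x)) ` {x \<in> V. N x \<le> 1})"
proof -
  obtain C where C: "\<And>x. x \<in> V \<Longrightarrow> cmod (p x) \<le> C * N x" using functional_bounded p by blast
  have "cmod (p x) \<le> \<bar>C\<bar>" if "x \<in> V" "N x \<le> 1" for x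
  proof -
    have N0: "0 \<le> N x" using that nonneg by (simp add: ip_norm_def)
    have "cmod (p x) \<le> \<bar>C\<bar> * N x"
      by (rule order_trans[OF C[OF that(1)]]) (simp add: mult_right_mono N0)
    also have "\<dots> \<le> \<bar>C\<bar> * 1" using that N0 by (intro mult_left_mono) auto
    finally show ?thesis by simp
  qed
  then show ?thesis by (auto intro!: bdd_aboveI)
qed

lemma dual_norm_zero: "dual_norm V N 0 = 0"
proof -
  have "0 \<in> {x \<in> V. N x \<le> 1}"
    using zero_left[of 0] cvec.subspace_0[OF V] by (simp add: ip_norm_def)
  then have "{x \<in> V. N x \<le> 1} \<noteq> {}" by blast
  then show ?thesis unfolding dual_norm_def by (simp add: cSUP_const)
qed

lemma dual_norm_pos:
  assumes p: "p \<in> cdual V" "p \<noteq> 0"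
  shows "0 < dual_norm V N p"
proof -
  obtain x where x: "x \<in> V" "p x \<noteq> 0"
    using p cdual_eqI[of p V 0] cvec.subspace_0[OF cdual_subspace] by auto
  then have "x \<noteq> 0" using clinear_on_zero[OF V cdualD(1)[OF p(1)]] by auto
  then have Nx: "0 < N x" using pos x by (simp add: ip_norm_def)
  define y where "y = complex_of_real (1 / N x) *\<^sub>C x"
  have y: "y \<in> V" "N y \<le> 1" using x V Nx
    by (auto simp: y_def cvec.subspace_scale N_scale norm_divide)
  have "0 < cmod (p y)"
    using clinear_onD(2)[OF cdualD(1)[OF p(1)] x(1)] x Nx by (simp add: y_def scaleC_complex_def)
  also have "\<dots> \<le> dual_norm V N p"
    unfolding dual_norm_def using y by (intro cSUP_upper dual_norm_bdd p) auto
  finally show ?thesis .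
qed

text \<open>For \<open>f\<close> in the range the least residual is zero, and the dual norm vanishes
  only at zero, so the least-squares solutions are the exact ones. Among these, the one orthogonal
  to the kernel of \<open>L\<close> is the unique one of smallest norm.\<close>

lemma pinv_solves:
  assumes L: "clinear_on V L" "L ` V \<subseteq> cdual V" and f: "f \<in> L ` V"
  shows "pinv V N (dual_norm V N) L f \<in> V" "L (pinv V N (dual_norm V N) L f) = f"
proof -
  let ?ls = "least_squares V (dual_norm V N) L f"
  obtain u0 where u0: "u0 \<in> V" "L u0 = f" using f by blast
  have fd: "f \<in> cdual V" using f L by blast
  have dn: "0 \<le> dual_norm V N (L w - f)" "dual_norm V N (L w - f) = 0 \<longleftrightarrow> L w = f" if "w \<in> V" for w
  proof -
    have "L w - f \<in> cdual V" using that L fd cdual_subspace by (metis cvec.subspace_diff image_subset_iff)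
    then show "0 \<le> dual_norm V N (L w - f)" "dual_norm V N (L w - f) = 0 \<longleftrightarrow> L w = f"
      using dual_norm_pos[of "L w - f"] dual_norm_zero by (cases "L w = f"; force)+
  qed
  have ls: "?ls = {u \<in> V. L u = f}"
  proof -
    have "u \<in> ?ls \<longleftrightarrow> u \<in> V \<and> L u = f" for u
      unfolding least_squares_def using dn u0 dual_norm_zero
      by (smt (verit, best) mem_Collect_eq right_minus_eq)
    then show ?thesis by blast
  qed
  have K: "cvec.subspace (ker_on V L)" "ker_on V L \<subseteq> V"
    using V clinear_on_zero[OF V L(1)] clinear_onD[OF L(1)]
    by (auto simp: ker_on_def cvec.subspace_def)
  obtain y where y: "y \<in> ker_on V L" "\<And>z. z \<in> ker_on V L \<Longrightarrow> ip (u0 - y) z = 0"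
    using projection[OF K u0(1)] by blast
  define u where "u = u0 - y"
  have yV: "y \<in> V" using y K by blast
  have u: "u \<in> V" "L u = f"
    using u0 y V clinear_on_diff[OF V L(1) u0(1) yV] yV by (auto simp: u_def ker_on_def cvec.subspace_diff)
  \<comment> \<open>Two solutions differ by a kernel vector, so orthogonality makes \<open>u\<close>
    the strict minimiser that the definite description in \<open>pinv\<close> asks for.\<close>
  have min: "N u \<le> N w \<and> (N w \<le> N u \<longrightarrow> w = u)" if w: "w \<in> V" "L w = f" for w
  proof -
    have d: "w - u \<in> V" using w u V by (simp add: cvec.subspace_diff)
    have "w - u \<in> ker_on V L"
      using w u d clinear_on_diff[OF V L(1) w(1) u(1)] by (simp add: ker_on_def)
    then have "ip u (w - u) = 0" using y by (simp add: u_def)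
    then have eq: "Re (ip w w) = Re (ip u u) + Re (ip (w - u) (w - u))"
      using pythagoras[OF u(1) d] by simp
    show ?thesis
      using eq nonneg[OF d] pos[OF d] by (cases "w = u") (simp_all add: ip_norm_def)
  qed
  have "pinv V N (dual_norm V N) L f = u"
    unfolding pinv_def ls using u min by (intro the_equality) auto
  then show "pinv V N (dual_norm V N) L f \<in> V" "L (pinv V N (dual_norm V N) L f) = f"
    using u by auto
qed

end

subsection \<open>The abstract transmission problem\<close>

lemma adj_apply: "u \<in> V \<Longrightarrow> adj V L p u = p (L u)"
  by (simp add: adj_def)

lemma adj_add: "adj V L (p + q) = adj V L p + adj V L q"
  by (simp add: adj_def fun_eq_iff)

lemma adj_diff: "adj V L (p - q) = adj V L p - adj V L q"
  by (simp add: adj_def fun_eq_iff)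

lemma adj_scale: "adj V L (c *\<^sub>C p) = c *\<^sub>C adj V L p"
  by (simp add: adj_def fun_eq_iff scaleC_fun_def scaleC_complex_def)

text \<open>Meshes and Sobolev spaces are forgotten here. The dimension count rests on
  \<open>B\<close> being onto \<open>W\<close>, on \<open>R\<close> being injective, and on
  conjugation preserving the range of \<open>R\<close>; the last two let the definiteness of
  \<open>T\<close> pass to its compression by \<open>R\<close>.\<close>

locale transmission_spaces =
  fixes V :: "'v::complex_vs set" and W :: "'w::complex_vs set" and X :: "'x::complex_vs set"
    and A :: "'v \<Rightarrow> 'v \<Rightarrow> complex" and B :: "'v \<Rightarrow> 'w" and R :: "'x \<Rightarrow> 'w"
    and T :: "'w \<Rightarrow> 'w \<Rightarrow> complex" and cj :: "'w \<Rightarrow> 'w" and ip :: "'v \<Rightarrow> 'v \<Rightarrow> complex"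
  assumes V: "cvec.subspace V" "fin_dim V"
    and W: "cvec.subspace W"
    and X: "cvec.subspace X" "fin_dim X"
    and A: "clinear_on V A" "A ` V \<subseteq> cdual V"
    and B: "clinear_on V B" "B ` V = W"
    and R: "clinear_on X R" "R ` X \<subseteq> W" "\<And>x. x \<in> X \<Longrightarrow> R x = 0 \<Longrightarrow> x = 0"
    and T: "impedance W cj T"
    and cj: "\<And>x. x \<in> X \<Longrightarrow> cj (R x) \<in> R ` X" "\<And>w. w \<in> W \<Longrightarrow> cj w \<in> W"
    and ip: "hermitian_ip_on V ip"
begin

sublocale hermitian_space V ip
  using V ip by unfold_locales

lemma T_cdual: "u \<in> W \<Longrightarrow> T u \<in> cdual W"
  and T_lin: "clinear_on W T"
  and T_sym: "u \<in> W \<Longrightarrow> v \<in> W \<Longrightarrow> T u v = T v u"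
  and T_pos: "u \<in> W \<Longrightarrow> u \<noteq> 0 \<Longrightarrow> 0 < Re (T u (cj u))"
proof -
  note h = T[unfolded impedance_def]
  show "u \<in> W \<Longrightarrow> T u \<in> cdual W" by (rule bspec[OF conjunct1[OF h]])
  show "clinear_on W T" by (rule conjunct1[OF conjunct2[OF h]])
  show "u \<in> W \<Longrightarrow> v \<in> W \<Longrightarrow> T u v = T v u"
    by (rule bspec[OF bspec[OF conjunct1[OF conjunct2[OF conjunct2[OF h]]]]])
  show "u \<in> W \<Longrightarrow> u \<noteq> 0 \<Longrightarrow> 0 < Re (T u (cj u))"
    by (rule conjunct2[OF mp[OF bspec[OF conjunct2[OF conjunct2[OF conjunct2[OF conjunct2[OF h]]]]]]])
qed

lemma T_inj: "u \<in> W \<Longrightarrow> T u = 0 \<Longrightarrow> u = 0"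
  using T_pos[of u] by force

lemma B_in: "u \<in> V \<Longrightarrow> B u \<in> W" and R_in: "x \<in> X \<Longrightarrow> R x \<in> W"
  using B R by auto

abbreviation "Nop \<equiv> impedance_op V A B T"

lemma Nop_lin: "clinear_on V Nop"
  by (auto simp: clinear_on_def impedance_op_def clinear_onD[OF A(1)] clinear_onD[OF B(1)]
      clinear_onD[OF T_lin] B_in adj_add adj_scale cvec.scale_right_distrib
      cvec.scale_right_diff_distrib mult.commute)

lemma Nop_cdual: "Nop ` V \<subseteq> cdual V"
proof
  fix f assume "f \<in> Nop ` V"
  then obtain u where u: "u \<in> V" "f = Nop u" by blast
  have "adj V B (T (B u)) \<in> cdual V"
    by (rule adj_cdual[OF V(1) B(1) _ T_cdual[OF B_in[OF u(1)]]]) (simp add: B(2))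
  moreover have "A u \<in> cdual V" using A(2) u(1) by blast
  ultimately show "f \<in> cdual V"
    unfolding u(2) impedance_op_def by (intro cvec.subspace_diff cvec.subspace_scale cdual_subspace)
qed

text \<open>The two conclusions are the assumptions of \<open>transmission_problem\<close>, here in
  the invertible case.\<close>

lemma bijective_op:
  assumes "bij_betw Nop V (cdual V)"
  shows "f \<in> cdual W \<Longrightarrow> adj V B f \<in> Nop ` V"
    and "u \<in> V \<Longrightarrow> Nop u = 0 \<Longrightarrow> B u = 0"
proof -
  assume "f \<in> cdual W"
  then have "adj V B f \<in> cdual V" by (rule adj_cdual[OF V(1) B(1) equalityD1[OF B(2)]])
  then show "adj V B f \<in> Nop ` V" using assms by (simp add: bij_betw_def)
next
  assume u: "u \<in> V" "Nop u = 0"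
  have "Nop 0 = 0" by (rule clinear_on_zero[OF V(1) Nop_lin])
  then have "u = 0"
    using inj_onD[OF bij_betw_imp_inj_on[OF assms], of u 0] u cvec.subspace_0[OF V(1)] by simp
  then show "B u = 0" using clinear_on_zero[OF V(1) B(1)] by simp
qed

text \<open>Energy argument: the imaginary part of \<open>Nop w (C w)\<close> is
  \<open>Im (A w (C w))\<close> minus the energy of \<open>B w\<close> in \<open>T\<close>. The
  first term is at most zero, so if the sum vanishes then so does \<open>B w\<close>.\<close>

lemma dissipative_op:
  assumes conj: "\<And>v. v \<in> V \<Longrightarrow> C v \<in> V" "\<And>v. v \<in> V \<Longrightarrow> C (C v) = v"
      "\<And>v. v \<in> V \<Longrightarrow> B (C v) = cj (B v)" "cj 0 = 0"
    and Im: "\<And>v. v \<in> V \<Longrightarrow> Im (A v (C v)) \<le> 0"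
  shows "f \<in> cdual W \<Longrightarrow> adj V B f \<in> Nop ` V"
    and "u \<in> V \<Longrightarrow> Nop u = 0 \<Longrightarrow> B u = 0"
proof -
  have energy: "B w = 0" if w: "w \<in> V" "Nop w (C w) = 0" for w
  proof (rule ccontr)
    assume "B w \<noteq> 0"
    then have "0 < Re (T (B w) (cj (B w)))" using T_pos B_in w by blast
    moreover have "Nop w (C w) = A w (C w) - \<i> * T (B w) (cj (B w))"
      using conj w by (simp add: impedance_op_def adj_apply scaleC_fun_def scaleC_complex_def)
    then have "Im (A w (C w)) = Re (T (B w) (cj (B w)))" using w by simp
    ultimately show False using Im[OF w(1)] by simp
  qed
  show "u \<in> V \<Longrightarrow> Nop u = 0 \<Longrightarrow> B u = 0" using energy by simp
  assume f: "f \<in> cdual W"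
  show "adj V B f \<in> Nop ` V"
  proof (rule in_range_of_annihilates[OF V(1) fin V(1) Nop_lin Nop_cdual])
    show "adj V B f \<in> cdual V" by (rule adj_cdual[OF V(1) B(1) equalityD1[OF B(2)] f])
    \<comment> \<open>A vector \<open>v\<close> killed by the whole range is in particular killed by
      \<open>Nop (C v)\<close>. As \<open>v = C (C v)\<close>, the energy argument applies to
      \<open>C v\<close>.\<close>
    fix v assume v: "v \<in> V" "\<forall>u\<in>V. Nop u v = 0"
    then have "B (C v) = 0" using energy[OF conj(1)] conj(1,2) by simp
    then have "B v = 0" using conj(2,3)[of "C v"] conj(1-4) v by metis
    then show "adj V B f v = 0"
      using v clinear_on_zero[OF W cdualD(1)[OF f]] by (simp add: adj_apply)
  qed
qed

section \<open>The operator inverted in the exchange operator\<close>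

definition G :: "'x \<Rightarrow> 'x \<Rightarrow> complex" where "G = (\<lambda>x. adj X R (T (R x)))"

lemma G_lin: "clinear_on X G"
  by (auto simp: clinear_on_def G_def clinear_onD[OF R(1)] clinear_onD[OF T_lin] R_in adj_add adj_scale)

lemma G_cdual: "x \<in> X \<Longrightarrow> G x \<in> cdual X"
  unfolding G_def by (rule adj_cdual[OF X(1) R(1,2) T_cdual[OF R_in]])

text \<open>Definiteness of \<open>T\<close> pairs \<open>R x\<close> with its conjugate, which is
  again some \<open>R y\<close>; the test therefore stays within what \<open>G x\<close> can
  see.\<close>

lemma G_inj0: assumes "x \<in> X" "G x = 0" shows "x = 0"
proof -
  obtain y where y: "y \<in> X" "cj (R x) = R y" using cj assms by blast
  have "T (R x) (R y) = 0" using assms(2) y(1) unfolding G_def by (metis adj_apply zero_fun_apply)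
  then have "R x = 0" using T_pos[OF R_in[OF assms(1)]] y by force
  then show ?thesis using R(3) assms(1) by blast
qed

lemma G_inj: "inj_on G X"
proof (rule inj_onI)
  fix x y assume xy: "x \<in> X" "y \<in> X" "G x = G y"
  then have "G (x - y) = 0" using clinear_on_diff[OF X(1) G_lin] by simp
  then show "x = y" using G_inj0[of "x - y"] xy X by (simp add: cvec.subspace_diff)
qed

text \<open>By the symmetry of \<open>T\<close>, a vector annihilated by the range of
  \<open>G\<close> lies in its kernel, so injectivity yields surjectivity.\<close>

lemma G_surj: assumes "f \<in> cdual X" shows "f \<in> G ` X"
proof (rule in_range_of_annihilates[OF X X(1) G_lin _ assms])
  show "G ` X \<subseteq> cdual X" using G_cdual by blast
  fix u assume u: "u \<in> X" "\<forall>v\<in>X. G v u = 0"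
  have "G u v = 0" if "v \<in> X" for v
    using u that T_sym[OF R_in[OF u(1)] R_in[OF that]] by (simp add: G_def adj_apply)
  then have "G u = 0"
    by (intro cdual_eqI[OF G_cdual[OF u(1)]]) (auto simp: cvec.subspace_0[OF cdual_subspace])
  then show "f u = 0" using G_inj0 u clinear_on_zero[OF X(1) cdualD(1)[OF assms]] by blast
qed

lemma G_inv:
  assumes "f \<in> cdual X"
  shows "the_inv_into X G f \<in> X" "G (the_inv_into X G f) = f"
  using the_inv_into_into[OF G_inj G_surj[OF assms]] f_the_inv_into_f[OF G_inj G_surj[OF assms]] by auto

abbreviation "E \<equiv> exchange_op X R T"
abbreviation "S \<equiv> scattering_op V N A B T"

lemma E_eq: "E p = 2 *\<^sub>C T (R (the_inv_into X G (adj X R p))) - p"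
  by (simp add: exchange_op_def G_def)

text \<open>Let \<open>y\<close> solve \<open>G y = adj X R (p + \<i> *\<^sub>C T u)\<close>. The
  left-hand side collapses to twice \<open>T (R y) - \<i> *\<^sub>C T u\<close>, so it vanishes
  exactly when \<open>R y = \<i> *\<^sub>C u\<close>. Inserting this into the equation for
  \<open>y\<close> cancels the terms with \<open>u\<close> and leaves \<open>adj X R p = 0\<close>;
  conversely, for \<open>u = R x\<close> the equation has the solution
  \<open>y = \<i> *\<^sub>C x\<close>.\<close>

lemma exchange_iff:
  assumes p: "p \<in> cdual W" and u: "u \<in> W"
  shows "(p - \<i> *\<^sub>C T u) + E (p + \<i> *\<^sub>C T u) = 0 \<longleftrightarrow> u \<in> R ` X \<and> adj X R p = 0"
proof
  let ?q = "p + \<i> *\<^sub>C T u"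
  have q: "?q \<in> cdual W"
    by (intro cvec.subspace_add cvec.subspace_scale cdual_subspace p T_cdual u)
  define y where "y = the_inv_into X G (adj X R ?q)"
  have y: "y \<in> X" "G y = adj X R ?q"
    using G_inv[OF adj_cdual[OF X(1) R(1,2) q]] by (auto simp: y_def)
  have Eq: "E ?q = 2 *\<^sub>C T (R y) - ?q" by (simp add: E_eq y_def)
  note Rlin = clinear_onD[OF R(1)] and Tlin = clinear_onD[OF T_lin]
  {
    assume "(p - \<i> *\<^sub>C T u) + E ?q = 0"
    then have "2 *\<^sub>C T (R y) - (\<i> *\<^sub>C T u + \<i> *\<^sub>C T u) = 0" by (simp add: Eq algebra_simps)
    moreover have "\<i> *\<^sub>C T u + \<i> *\<^sub>C T u = 2 *\<^sub>C (\<i> *\<^sub>C T u)"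
      using scaleC_add_left[of 1 1 "\<i> *\<^sub>C T u"] by (simp add: scaleC_one)
    ultimately have "2 *\<^sub>C (T (R y) - \<i> *\<^sub>C T u) = 0"
      by (simp add: cvec.scale_right_diff_distrib)
    then have "T (R y) - T (\<i> *\<^sub>C u) = 0" using Tlin u by simp
    then have "T (R y - \<i> *\<^sub>C u) = 0"
      using clinear_on_diff[OF W T_lin R_in[OF y(1)]] u W by (simp add: cvec.subspace_scale)
    then have Ry: "R y = \<i> *\<^sub>C u"
      using T_inj[of "R y - \<i> *\<^sub>C u"] R_in[OF y(1)] u W
      by (simp add: cvec.subspace_scale cvec.subspace_diff)
    have "R ((- \<i>) *\<^sub>C y) = (- \<i>) *\<^sub>C \<i> *\<^sub>C u" using Rlin(2)[OF y(1), of "-\<i>"] Ry by simp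
    also have "\<dots> = u" by (simp add: scaleC_scaleC scaleC_one)
    finally have uR: "u = R ((- \<i>) *\<^sub>C y)" by simp
    have "G y = \<i> *\<^sub>C adj X R (T u)"
      by (simp add: G_def Ry Tlin u adj_scale)
    then have "adj X R p = 0" using y(2) by (simp add: adj_add adj_scale)
    then show "u \<in> R ` X \<and> adj X R p = 0" using uR X(1) y(1) by (blast intro: cvec.subspace_scale)
  }
  {
    assume h: "u \<in> R ` X \<and> adj X R p = 0"
    then obtain x where x: "x \<in> X" "u = R x" by blast
    have ix: "\<i> *\<^sub>C x \<in> X" using x X by (simp add: cvec.subspace_scale)
    have "G y = \<i> *\<^sub>C G x" using y(2) h x by (simp add: adj_add adj_scale G_def)
    also have "\<dots> = G (\<i> *\<^sub>C x)" using clinear_onD(2)[OF G_lin x(1)] by simp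
    finally have "y = \<i> *\<^sub>C x" using inj_onD[OF G_inj _ y(1) ix] by blast
    then have "T (R y) = \<i> *\<^sub>C T u" using x Rlin Tlin R_in by simp
    moreover have "2 *\<^sub>C (\<i> *\<^sub>C T u) = \<i> *\<^sub>C T u + \<i> *\<^sub>C T u"
      using scaleC_add_left[of 1 1 "\<i> *\<^sub>C T u"] by (simp add: scaleC_one)
    ultimately show "(p - \<i> *\<^sub>C T u) + E ?q = 0" by (simp add: Eq)
  }
qed

lemma adj_B_inj:
  assumes "p \<in> cdual W" "q \<in> cdual W" "adj V B p = adj V B q"
  shows "p = q"
proof (rule cdual_eqI[OF assms(1,2)])
  fix w assume "w \<in> W"
  then obtain v where "v \<in> V" "w = B v" using B by blast
  then show "p w = q w" using fun_cong[OF assms(3), of v] by (simp add: adj_apply)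
qed

section \<open>Compatible solutions and their Robin traces\<close>

definition K :: "'v set" where
  "K = {u \<in> V. B u \<in> R ` X \<and> (\<forall>v\<in>V. B v \<in> R ` X \<longrightarrow> A u v = 0)}"

lemma zero_R: "0 \<in> R ` X"
  using clinear_on_zero[OF X(1) R(1)] cvec.subspace_0[OF X(1)] by (metis imageI)

lemma R_subspace: "cvec.subspace (R ` X)"
  by (rule subspace_clinear_on_image[OF X(1) R(1)])

lemma K_subspace: "cvec.subspace K"
  unfolding cvec.subspace_def K_def
  using V clinear_onD[OF A(1)] clinear_onD[OF B(1)] clinear_on_zero[OF V(1) A(1)]
    clinear_on_zero[OF V(1) B(1)] R_subspace zero_R
  by (auto simp: cvec.subspace_0 cvec.subspace_add cvec.subspace_scale scaleC_fun_def
      scaleC_complex_def)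

text \<open>A family with zero trace is compatible, so \<open>A u\<close> vanishes on the kernel of
  \<open>B\<close> and factors through \<open>B\<close>, which is onto \<open>W\<close>.\<close>

lemma boundary_functional_exists:
  assumes u: "u \<in> K"
  shows "\<exists>p \<in> cdual W. adj V B p = A u"
proof -
  have uV: "u \<in> V" using u by (simp add: K_def)
  have Au: "A u \<in> cdual V" using A uV by blast
  note Alin = clinear_onD[OF cdualD(1)[OF Au]] clinear_on_diff[OF V(1) cdualD(1)[OF Au]]
  \<comment> \<open>An arbitrary right inverse of \<open>B\<close>; \<open>eq\<close> shows that
    \<open>A u\<close> does not depend on which preimage is taken.\<close>
  define g where "g = inv_into V B"
  have g: "g w \<in> V" "B (g w) = w" if "w \<in> W" for w
    using that B(2) unfolding g_def by (metis inv_into_into, metis f_inv_into_f)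
  have eq: "A u v = A u v'" if "v \<in> V" "v' \<in> V" "B v = B v'" for v v'
  proof -
    have "B (v - v') = 0" using clinear_on_diff[OF V(1) B(1)] that by simp
    then have "A u (v - v') = 0" using u that V zero_R by (simp add: K_def cvec.subspace_diff)
    then show ?thesis using Alin that by simp
  qed
  define p where "p = (\<lambda>w. if w \<in> W then A u (g w) else 0)"
  have "p (x + y) = p x + p y" if "x \<in> W" "y \<in> W" for x y
    using eq[of "g (x + y)" "g x + g y"] g that W V clinear_onD[OF B(1)] Alin
    by (simp add: p_def cvec.subspace_add)
  moreover have "p (c *\<^sub>C x) = c *\<^sub>C p x" if "x \<in> W" for c x
    using eq[of "g (c *\<^sub>C x)" "c *\<^sub>C g x"] g that W V clinear_onD[OF B(1)] Alin
    by (simp add: p_def cvec.subspace_scale)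
  ultimately have "p \<in> cdual W" by (auto simp: cdual_def clinear_on_def p_def)
  moreover have "adj V B p = A u"
  proof (rule cdual_eqI[OF adj_cdual[OF V(1) B(1) _ calculation] Au])
    show "adj V B p x = A u x" if "x \<in> V" for x
      using that eq[of "g (B x)" x] g[OF B_in[OF that]] by (simp add: adj_apply p_def B_in)
  qed (use B in auto)
  ultimately show ?thesis by blast
qed

text \<open>The flux, or Neumann datum, of \<open>u\<close>. On \<open>K\<close> the choice is
  unique by \<open>adj_B_inj\<close>.\<close>

definition P :: "'v \<Rightarrow> 'w \<Rightarrow> complex" where
  "P u = (SOME p. p \<in> cdual W \<and> adj V B p = A u)"

lemma P: assumes "u \<in> K" shows "P u \<in> cdual W" "adj V B (P u) = A u"
proof -
  have "\<exists>p. p \<in> cdual W \<and> adj V B p = A u" using boundary_functional_exists assms by blast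
  then have "P u \<in> cdual W \<and> adj V B (P u) = A u" unfolding P_def by (rule someI_ex)
  then show "P u \<in> cdual W" "adj V B (P u) = A u" by auto
qed

text \<open>A Robin trace of \<open>u\<close>; the scattering operator turns it into the one with
  the opposite sign.\<close>

definition \<Phi> :: "'v \<Rightarrow> 'w \<Rightarrow> complex" where "\<Phi> u = P u - \<i> *\<^sub>C T (B u)"

lemma KV: "u \<in> K \<Longrightarrow> u \<in> V"
  by (simp add: K_def)

lemma \<Phi>_cdual: "u \<in> K \<Longrightarrow> \<Phi> u \<in> cdual W"
  unfolding \<Phi>_def
  by (intro cvec.subspace_diff cvec.subspace_scale cdual_subspace P T_cdual B_in KV)

lemma Nop_\<Phi>: "u \<in> K \<Longrightarrow> Nop u = adj V B (\<Phi> u)"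
  by (simp add: \<Phi>_def impedance_op_def adj_diff adj_scale P)

text \<open>\<open>P\<close> is defined by choice, so linearity is not visible from the definition.
  It is read off after applying the injective adjoint of \<open>B\<close>, which turns
  \<open>\<Phi>\<close> into the linear map \<open>Nop\<close>.\<close>

lemma \<Phi>_lin: "clinear_on K \<Phi>"
proof -
  have "\<Phi> (x + y) = \<Phi> x + \<Phi> y" if "x \<in> K" "y \<in> K" for x y
  proof (rule adj_B_inj)
    have xy: "x + y \<in> K" using that K_subspace by (simp add: cvec.subspace_add)
    show "\<Phi> (x + y) \<in> cdual W" using \<Phi>_cdual xy .
    show "\<Phi> x + \<Phi> y \<in> cdual W" by (intro cvec.subspace_add cdual_subspace \<Phi>_cdual that)
    show "adj V B (\<Phi> (x + y)) = adj V B (\<Phi> x + \<Phi> y)"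
      using Nop_\<Phi> xy that clinear_onD(1)[OF Nop_lin KV[OF that(1)] KV[OF that(2)]] by (simp add: adj_add)
  qed
  moreover have "\<Phi> (c *\<^sub>C x) = c *\<^sub>C \<Phi> x" if "x \<in> K" for c x
  proof (rule adj_B_inj)
    have cx: "c *\<^sub>C x \<in> K" using that K_subspace by (simp add: cvec.subspace_scale)
    show "\<Phi> (c *\<^sub>C x) \<in> cdual W" using \<Phi>_cdual cx .
    show "c *\<^sub>C \<Phi> x \<in> cdual W" by (intro cvec.subspace_scale cdual_subspace \<Phi>_cdual that)
    show "adj V B (\<Phi> (c *\<^sub>C x)) = adj V B (c *\<^sub>C \<Phi> x)"
      using Nop_\<Phi>[OF cx] Nop_\<Phi>[OF that] clinear_onD(2)[OF Nop_lin KV[OF that], of c]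
      by (simp add: adj_scale)
  qed
  ultimately show ?thesis by (simp add: clinear_on_def)
qed

end

section \<open>The scattering equation\<close>

locale transmission_problem = transmission_spaces +
  assumes op_range: "\<And>f. f \<in> cdual W \<Longrightarrow> adj V B f \<in> impedance_op V A B T ` V"
    and op_ker: "\<And>u. u \<in> V \<Longrightarrow> impedance_op V A B T u = 0 \<Longrightarrow> B u = 0"
begin

text \<open>If \<open>\<Phi> u\<close> vanishes, so does \<open>Nop u\<close>, and
  \<open>op_ker\<close> removes the trace of \<open>u\<close>. What remains of
  \<open>\<Phi> u\<close> is the flux \<open>P u\<close>, whose image under the adjoint of
  \<open>B\<close> is \<open>A u\<close>.\<close>

lemma ker_\<Phi>: "ker_on K \<Phi> = ker_on V A \<inter> ker_on V B"
proof (intro antisym subsetI)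
  fix u assume "u \<in> ker_on K \<Phi>"
  then have u: "u \<in> K" "\<Phi> u = 0" by (auto simp: ker_on_def)
  then have "Nop u = 0" using Nop_\<Phi>[OF u(1)] by (simp add: adj_def func_zero)
  then have Bu: "B u = 0" using op_ker KV u by blast
  then have "P u = 0" using u clinear_on_zero[OF W T_lin] by (simp add: \<Phi>_def)
  then have "A u = 0" using P(2)[OF u(1)] by (simp add: adj_def func_zero)
  then show "u \<in> ker_on V A \<inter> ker_on V B" using Bu KV u by (simp add: ker_on_def)
next
  fix u assume "u \<in> ker_on V A \<inter> ker_on V B"
  then have u: "u \<in> V" "A u = 0" "B u = 0" by (auto simp: ker_on_def)
  then have uK: "u \<in> K" using zero_R by (simp add: K_def)
  have "adj V B (P u) = adj V B 0" using P(2)[OF uK] u by (simp add: adj_def func_zero)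
  then have "P u = 0" by (rule adj_B_inj[OF P(1)[OF uK] cvec.subspace_0[OF cdual_subspace]])
  then show "u \<in> ker_on K \<Phi>"
    using uK u clinear_on_zero[OF W T_lin] by (simp add: ker_on_def \<Phi>_def)
qed

lemma scattering:
  assumes f: "f \<in> cdual W"
  obtains u where "u \<in> V" "Nop u = adj V B f" "S f = f + (2 * \<i>) *\<^sub>C T (B u)"
  using that[OF pinv_solves[OF Nop_lin Nop_cdual op_range[OF f]]] by (simp add: scattering_op_def)

lemma add_i_twice: "p + (2 * \<i>) *\<^sub>C t = (p + \<i> *\<^sub>C t) + \<i> *\<^sub>C (t :: 'w \<Rightarrow> complex)"
  by (simp only: mult_2 scaleC_add_left add.assoc)

text \<open>For any solution of \<open>Nop u = adj V B f\<close> the pair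
  \<open>p = f + \<i> *\<^sub>C T (B u)\<close> and \<open>B u\<close> writes \<open>f\<close> as
  one Robin trace and \<open>S f\<close> as the other. \<open>exchange_iff\<close> then translates
  the scattering equation into compatibility of \<open>u\<close> and vanishing of its flux on the
  skeleton.\<close>

lemma image_\<Phi>: "\<Phi> ` K = ker_on (cdual W) (\<lambda>p. p + E (S p))"
proof (intro antisym subsetI)
  fix f assume "f \<in> \<Phi> ` K"
  then obtain u where u: "u \<in> K" "f = \<Phi> u" by blast
  have f: "f \<in> cdual W" using u \<Phi>_cdual by blast
  obtain u' where u': "u' \<in> V" "Nop u' = adj V B f" "S f = f + (2 * \<i>) *\<^sub>C T (B u')"
    using scattering[OF f] .
  \<comment> \<open>The pseudo-inverse may return a solution \<open>u'\<close> other than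
    \<open>u\<close>, but \<open>op_ker\<close> gives both the same trace, and \<open>S f\<close>
    depends on nothing else.\<close>
  have "Nop (u' - u) = 0"
    using u u' Nop_\<Phi> clinear_on_diff[OF V(1) Nop_lin u'(1) KV[OF u(1)]] by simp
  then have "B (u' - u) = 0" using op_ker u' KV[OF u(1)] V by (simp add: cvec.subspace_diff)
  then have "B u' = B u" using clinear_on_diff[OF V(1) B(1) u'(1) KV[OF u(1)]] by simp
  then have Sf: "S f = P u + \<i> *\<^sub>C T (B u)"
    unfolding u'(3) add_i_twice by (simp add: u \<Phi>_def)
  have "adj X R (P u) = 0"
  proof (rule cdual_eqI[OF adj_cdual[OF X(1) R(1,2) P(1)[OF u(1)]] cvec.subspace_0[OF cdual_subspace]])
    fix x assume x: "x \<in> X"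
    then obtain v where v: "v \<in> V" "R x = B v" using R_in B by blast
    then have "B v \<in> R ` X" using x by (metis imageI)
    then have "A u v = 0" using u v by (simp add: K_def)
    moreover have "P u (R x) = A u v" using fun_cong[OF P(2)[OF u(1)], of v] v by (simp add: adj_apply)
    ultimately show "adj X R (P u) x = 0 x" using x by (simp add: adj_apply)
  qed
  then have "f + E (S f) = 0"
    unfolding Sf using exchange_iff[OF P(1)[OF u(1)] B_in[OF KV[OF u(1)]]] u
    by (simp add: \<Phi>_def K_def)
  then show "f \<in> ker_on (cdual W) (\<lambda>p. p + E (S p))" using f by (simp add: ker_on_def)
next
  fix f assume "f \<in> ker_on (cdual W) (\<lambda>p. p + E (S p))"
  then have f: "f \<in> cdual W" "f + E (S f) = 0" by (auto simp: ker_on_def)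
  obtain u where u: "u \<in> V" "Nop u = adj V B f" "S f = f + (2 * \<i>) *\<^sub>C T (B u)"
    using scattering[OF f(1)] .
  \<comment> \<open>The only candidate for \<open>P u\<close>, since \<open>f\<close> is to equal
    \<open>P u - \<i> *\<^sub>C T (B u)\<close>.\<close>
  define p where "p = f + \<i> *\<^sub>C T (B u)"
  have p: "p \<in> cdual W" unfolding p_def
    by (intro cvec.subspace_add cvec.subspace_scale cdual_subspace f T_cdual B_in u)
  have adjp: "adj V B p = A u"
    using u(2) by (simp add: p_def adj_add adj_scale impedance_op_def flip: u(2))
  have "S f = p + \<i> *\<^sub>C T (B u)" unfolding u(3) add_i_twice by (simp add: p_def)
  moreover have fp: "f = p - \<i> *\<^sub>C T (B u)" by (simp add: p_def)
  ultimately have h: "B u \<in> R ` X" "adj X R p = 0"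
    using f(2) exchange_iff[OF p B_in[OF u(1)]] by simp_all
  have "A u v = 0" if v: "v \<in> V" "B v \<in> R ` X" for v
  proof -
    obtain x where x: "x \<in> X" "B v = R x" using v by blast
    have "A u v = p (B v)" using v fun_cong[OF adjp, of v] by (simp add: adj_apply)
    also have "\<dots> = 0" using fun_cong[OF h(2), of x] x by (simp add: adj_apply)
    finally show ?thesis .
  qed
  then have uK: "u \<in> K" using u h by (simp add: K_def)
  have "P u = p" using adj_B_inj[OF P(1)[OF uK] p] P(2)[OF uK] adjp by simp
  then have "f = \<Phi> u" using fp by (simp add: \<Phi>_def)
  then show "f \<in> \<Phi> ` K" using uK by blast
qed

theorem dim_kernel:
  "cvec.dim K = cvec.dim (ker_on V A \<inter> ker_on V B)
     + cvec.dim (ker_on (cdual W) (\<lambda>p. p + E (S p)))"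
proof -
  have "K \<subseteq> V" using KV by (rule subsetI)
  from rank_nullity[OF K_subspace fin_dim_subset[OF fin this] \<Phi>_lin]
  show ?thesis unfolding ker_\<Phi> image_\<Phi> .
qed

end

subsection \<open>Directional derivatives\<close>

text \<open>\<open>pd\<close> returns some value even where no derivative exists; this predicate
  also records existence, which the rules of calculus require.\<close>

definition has_pd :: "'d::finite \<Rightarrow> 'd cfun \<Rightarrow> complex \<Rightarrow> real^'d \<Rightarrow> bool" where
  "has_pd i u D x \<longleftrightarrow> ((\<lambda>t. u (x + t *\<^sub>R axis i 1)) has_vector_derivative D) (at 0)"

lemma has_pd_eq: "has_pd i u D x \<Longrightarrow> pd i u x = D"
  by (simp add: has_pd_def pd_def vector_derivative_at)

lemma eventually_line:
  fixes x v :: "'a::real_normed_vector"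
  assumes "open S" "x \<in> S"
  shows "eventually (\<lambda>t. x + t *\<^sub>R v \<in> S) (nhds (0::real))"
proof -
  have "open ((\<lambda>t::real. x + t *\<^sub>R v) -` S)"
    by (intro open_vimage assms continuous_intros)
  from eventually_nhds_in_open[OF this, of 0] show ?thesis using assms(2) by simp
qed

text \<open>\<open>vector_derivative\<close> depends only on the germ along the line, so this also
  covers points without a derivative.\<close>

lemma pd_cong_open:
  assumes "open S" "x \<in> S" "\<And>y. y \<in> S \<Longrightarrow> u y = v y"
  shows "pd i u x = pd i v x"
  unfolding pd_def
  by (rule vector_derivative_cong_eq)
    (use eventually_mono[OF eventually_line[OF assms(1,2), of "axis i 1"]] assms(3) in auto)

lemma has_pd_cong_open:
  assumes "open S" "x \<in> S" "\<And>y. y \<in> S \<Longrightarrow> u y = v y" "has_pd i u D x"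
  shows "has_pd i v D x"
  unfolding has_pd_def
proof (rule has_vector_derivative_transform_within_open[of "\<lambda>t. u (x + t *\<^sub>R axis i 1)"])
  show "open ((\<lambda>t. x + t *\<^sub>R axis i 1) -` S)"
    by (intro open_vimage assms continuous_intros)
qed (use assms in \<open>auto simp: has_pd_def\<close>)

lemma has_pd_add: "has_pd i u D x \<Longrightarrow> has_pd i v D' x \<Longrightarrow> has_pd i (\<lambda>y. u y + v y) (D + D') x"
  unfolding has_pd_def by (rule has_vector_derivative_add)

lemma has_pd_mult:
  "has_pd i u D x \<Longrightarrow> has_pd i v D' x \<Longrightarrow> has_pd i (\<lambda>y. u y * v y) (u x * D' + D * v x) x"
  unfolding has_pd_def by (drule (1) has_vector_derivative_mult) simp

lemma has_pd_const: "has_pd i (\<lambda>y. c) 0 x"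
  unfolding has_pd_def by (rule has_vector_derivative_const)

lemma has_pd_cmult: "has_pd i u D x \<Longrightarrow> has_pd i (\<lambda>y. c * u y) (c * D) x"
  using has_pd_mult[OF has_pd_const, of i u D x c] by simp

lemma has_pd_cnj: "has_pd i u D x \<Longrightarrow> has_pd i (\<lambda>y. cnj (u y)) (cnj D) x"
  unfolding has_pd_def by (rule has_vector_derivative_cnj)

lemma has_pd_differentiable:
  assumes "u differentiable (at x)"
  obtains D where "has_pd i u D x"
proof -
  obtain u' where u': "(u has_derivative u') (at x)" using assms by (auto simp: differentiable_def)
  have "((\<lambda>t::real. x + t *\<^sub>R axis i 1) has_derivative (\<lambda>t. t *\<^sub>R axis i 1)) (at 0)"
    by (auto intro!: derivative_eq_intros)
  from diff_chain_at[OF this, of u u'] u'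
  have "((\<lambda>t. u (x + t *\<^sub>R axis i 1)) has_derivative (\<lambda>t. u' (t *\<^sub>R axis i 1))) (at 0)"
    by (simp add: o_def)
  then have "has_pd i u (u' (axis i 1)) x"
    using linear_scale[OF has_derivative_linear[OF u']]
    by (simp add: has_pd_def has_vector_derivative_def)
  then show ?thesis using that by blast
qed

text \<open>The fixed null sequence of step sizes presents a derivative as a sequential limit, which
  is what measurability and dominated convergence later act on.\<close>

lemma has_pd_quotient:
  assumes "has_pd i u D x"
  shows "(\<lambda>n. (u (x + inverse (real (Suc n)) *\<^sub>R axis i 1) - u x) / of_real (inverse (real (Suc n))))
           \<longlonglongrightarrow> D"
proof -
  have "((\<lambda>t. u (x + t *\<^sub>R axis i 1)) has_derivative (\<lambda>h. h *\<^sub>R D)) (at 0)"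
    using assms by (simp add: has_pd_def has_vector_derivative_def)
  then have "((\<lambda>t. (u (x + t *\<^sub>R axis i 1) - u x - t *\<^sub>R D) /\<^sub>R \<bar>t\<bar>) \<longlongrightarrow> 0) (at 0)"
    by (simp add: has_derivative_at2 has_derivative_def)
  moreover have "filterlim (\<lambda>n. inverse (real (Suc n))) (at 0) sequentially"
    using LIMSEQ_inverse_real_of_nat by (auto simp: filterlim_at)
  ultimately have lim: "(\<lambda>n. (u (x + inverse (real (Suc n)) *\<^sub>R axis i 1) - u x - inverse (real (Suc n)) *\<^sub>R D)
      /\<^sub>R \<bar>inverse (real (Suc n))\<bar>) \<longlonglongrightarrow> 0"
    by (rule filterlim_compose)
  have eq: "(a - h *\<^sub>R D) /\<^sub>R \<bar>h\<bar> = a / of_real h - D" if "0 < h" for a :: complex and h :: real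
    using that by (simp add: scaleR_conv_of_real field_simps)
  show ?thesis
    using lim by (subst (asm) eq) (auto simp: LIM_zero_iff)
qed

lemma has_pd_bound:
  assumes "has_pd i u D x" "open S" "x \<in> S" "L-lipschitz_on S u"
  shows "cmod D \<le> L"
proof -
  have "eventually (\<lambda>t. x + t *\<^sub>R axis i 1 \<in> S) (nhds 0)" by (rule eventually_line[OF assms(2,3)])
  then have "eventually (\<lambda>n. x + inverse (real (Suc n)) *\<^sub>R axis i 1 \<in> S) sequentially"
    using LIMSEQ_inverse_real_of_nat unfolding filterlim_def le_filter_def eventually_filtermap by blast
  then have "eventually (\<lambda>n. cmod ((u (x + inverse (real (Suc n)) *\<^sub>R axis i 1) - u x)
      / of_real (inverse (real (Suc n)))) \<le> L) sequentially"
  proof eventually_elim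
    case (elim n)
    have *: "cmod (u (x + inverse (real (Suc n)) *\<^sub>R axis i 1) - u x) \<le> L * inverse (real (Suc n))"
      using lipschitz_onD[OF assms(4) elim assms(3)] by (simp add: dist_norm)
    have "cmod (a / of_real h) \<le> L" if "cmod a \<le> L * h" "0 < h" for a h
      using that by (simp add: norm_divide divide_le_eq)
    from this[OF *] show ?case by simp
  qed
  then show ?thesis
    by (intro tendsto_upperbound[OF tendsto_norm[OF has_pd_quotient[OF assms(1)]]]) auto
qed

subsection \<open>Polynomials\<close>

text \<open>Lipschitz functions alone are not closed under products; bounded ones are, so
  polynomials can be built up from the coordinates.\<close>

definition bounded_lipschitz :: "(real^'d::finite) set \<Rightarrow> 'd cfun \<Rightarrow> bool" where
  "bounded_lipschitz S f \<longleftrightarrow> (\<exists>C. C-lipschitz_on S f) \<and> bounded (f ` S)"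

lemma bounded_lipschitz_const: "bounded_lipschitz S (\<lambda>x. c)"
proof -
  have "0-lipschitz_on S (\<lambda>x. c)" by (simp add: lipschitz_on_def)
  moreover have "bounded ((\<lambda>x. c) ` S)" by (rule boundedI[of _ "cmod c"]) auto
  ultimately show ?thesis unfolding bounded_lipschitz_def by blast
qed

lemma bounded_lipschitz_add:
  assumes "bounded_lipschitz S f" "bounded_lipschitz S g"
  shows "bounded_lipschitz S (\<lambda>x. f x + g x)"
  using assms lipschitz_on_add[of _ S f _ g] bounded_plus_comp[of f S g]
  unfolding bounded_lipschitz_def by blast

lemma bounded_lipschitz_mult:
  assumes "bounded_lipschitz S f" "bounded_lipschitz S g"
  shows "bounded_lipschitz S (\<lambda>x. f x * g x)"
proof -
  obtain A B where AB: "A-lipschitz_on S f" "B-lipschitz_on S g"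
    using assms by (auto simp: bounded_lipschitz_def)
  obtain M N where MN: "\<And>x. x \<in> S \<Longrightarrow> cmod (f x) \<le> M" "\<And>x. x \<in> S \<Longrightarrow> cmod (g x) \<le> N" "0 < M" "0 < N"
    using assms by (auto simp: bounded_lipschitz_def bounded_pos)
  have nn: "0 \<le> A" "0 \<le> B" using AB by (auto simp: lipschitz_on_def)
  have "(M * B + A * N)-lipschitz_on S (\<lambda>x. f x * g x)"
  proof (rule lipschitz_onI)
    fix x y assume xy: "x \<in> S" "y \<in> S"
    have "f x * g x - f y * g y = f x * (g x - g y) + (f x - f y) * g y" by (simp add: algebra_simps)
    then have "cmod (f x * g x - f y * g y) \<le> cmod (f x) * cmod (g x - g y) + cmod (f x - f y) * cmod (g y)"
      by (metis norm_mult norm_triangle_ineq)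
    also have "\<dots> \<le> M * (B * dist x y) + (A * dist x y) * N"
      using lipschitz_onD[OF AB(1) xy] lipschitz_onD[OF AB(2) xy] MN xy nn
      by (intro add_mono mult_mono) (auto simp: dist_norm)
    finally show "dist (f x * g x) (f y * g y) \<le> (M * B + A * N) * dist x y"
      by (simp add: dist_norm algebra_simps)
  qed (use MN nn in simp)
  moreover have "bounded ((\<lambda>x. f x * g x) ` S)"
    by (rule boundedI[of _ "M * N"]) (use MN in \<open>auto simp: norm_mult intro!: mult_mono intro: order_trans[OF norm_ge_zero]\<close>)
  ultimately show ?thesis by (auto simp: bounded_lipschitz_def)
qed

lemma bounded_lipschitz_sum:
  "(\<And>a. a \<in> I \<Longrightarrow> bounded_lipschitz S (f a)) \<Longrightarrow> bounded_lipschitz S (\<lambda>x. \<Sum>a\<in>I. f a x)"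
  by (induction I rule: infinite_finite_induct)
    (auto intro: bounded_lipschitz_add simp: bounded_lipschitz_const[of S 0])

lemma bounded_lipschitz_prod:
  "(\<And>a. a \<in> I \<Longrightarrow> bounded_lipschitz S (f a)) \<Longrightarrow> bounded_lipschitz S (\<lambda>x. \<Prod>a\<in>I. f a x)"
  by (induction I rule: infinite_finite_induct)
    (auto intro: bounded_lipschitz_mult simp: bounded_lipschitz_const[of S 1])

lemma bounded_lipschitz_power: "bounded_lipschitz S f \<Longrightarrow> bounded_lipschitz S (\<lambda>x. f x ^ n)"
  by (induction n) (auto intro: bounded_lipschitz_mult simp: bounded_lipschitz_const[of S 1])

lemma bounded_lipschitz_component:
  assumes "bounded S"
  shows "bounded_lipschitz S (\<lambda>x. of_real (x $ i))"
proof -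
  have "1-lipschitz_on S (\<lambda>x. complex_of_real (x $ i))"
    by (rule lipschitz_onI) (auto simp: dist_norm dist_vec_nth_le norm_bound_component_le_cart[OF order_refl]
        simp flip: of_real_diff vector_minus_component)
  moreover obtain M where "\<forall>x\<in>S. norm x \<le> M" using assms by (auto simp: bounded_iff)
  then have "bounded ((\<lambda>x. complex_of_real (x $ i)) ` S)"
    by (intro boundedI[of _ M]) (auto intro!: order_trans[OF component_le_norm_cart])
  ultimately show ?thesis by (auto simp: bounded_lipschitz_def)
qed

lemma poly_fun_bounded_lipschitz:
  assumes "poly_fun k p" "bounded S"
  shows "bounded_lipschitz S p"
proof -
  obtain c where "p = (\<lambda>x. \<Sum>\<alpha> | (\<Sum>i\<in>UNIV. \<alpha> i) \<le> k. c \<alpha> * of_real (\<Prod>i\<in>UNIV. (x $ i) ^ \<alpha> i))"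
    using assms(1) by (auto simp: poly_fun_def)
  then show ?thesis
    by (simp add: bounded_lipschitz_sum bounded_lipschitz_mult bounded_lipschitz_const
        bounded_lipschitz_prod bounded_lipschitz_power bounded_lipschitz_component assms(2))
qed

lemma finite_multi_indices: "finite {\<alpha> :: 'd::finite \<Rightarrow> nat. (\<Sum>i\<in>UNIV. \<alpha> i) \<le> k}"
proof (rule finite_subset)
  show "{\<alpha> :: 'd \<Rightarrow> nat. (\<Sum>i\<in>UNIV. \<alpha> i) \<le> k} \<subseteq> UNIV \<rightarrow>\<^sub>E {..k}"
  proof
    fix \<alpha> :: "'d \<Rightarrow> nat" assume \<alpha>: "\<alpha> \<in> {\<alpha>. (\<Sum>i\<in>UNIV. \<alpha> i) \<le> k}"
    have "\<alpha> i \<le> k" for i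
      using member_le_sum[of i UNIV \<alpha>] \<alpha> by simp
    then show "\<alpha> \<in> UNIV \<rightarrow>\<^sub>E {..k}" by auto
  qed
qed (simp add: finite_PiE)

lemma differentiable_prod:
  fixes f :: "'i \<Rightarrow> 'a::real_normed_vector \<Rightarrow> complex"
  shows "(\<And>a. a \<in> I \<Longrightarrow> f a differentiable (at x)) \<Longrightarrow> (\<lambda>x. \<Prod>a\<in>I. f a x) differentiable (at x)"
  by (induction I rule: infinite_finite_induct) (auto intro!: differentiable_mult)

lemma poly_fun_differentiable:
  assumes "poly_fun k p"
  shows "p differentiable (at x)"
proof -
  obtain c where p: "p = (\<lambda>x. \<Sum>\<alpha> | (\<Sum>i\<in>UNIV. \<alpha> i) \<le> k. c \<alpha> * of_real (\<Prod>i\<in>UNIV. (x $ i) ^ \<alpha> i))"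
    using assms by (auto simp: poly_fun_def)
  have comp: "(\<lambda>x. complex_of_real (x $ i)) differentiable (at x)" for i
    by (intro bounded_linear_imp_differentiable bounded_linear_compose[OF bounded_linear_of_real]
        bounded_linear_vec_nth)
  show ?thesis unfolding p of_real_prod of_real_power
    by (intro differentiable_sum ballI differentiable_mult differentiable_prod
        differentiable_power comp finite_multi_indices differentiable_const)
qed

subsection \<open>Bounded measurable functions\<close>

text \<open>An algebra of functions that contains the wave number, the finite element functions and
  their derivatives, and whose members are integrable over bounded measurable sets. The bound holds
  almost everywhere because the wave number is only essentially bounded and derivatives are
  controlled only off the cell boundaries.\<close>

definition bounded_meas :: "'d::finite cfun \<Rightarrow> bool" where
  "bounded_meas f \<longleftrightarrow> f \<in> borel_measurable lebesgue \<and> (\<exists>C. AE x in lebesgue. cmod (f x) \<le> C)"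

lemma bounded_meas_measurable: "bounded_meas f \<Longrightarrow> f \<in> borel_measurable lebesgue"
  by (simp add: bounded_meas_def)

lemma bounded_meas_const: "bounded_meas (\<lambda>x. c)"
  by (auto simp: bounded_meas_def)

lemma bounded_meas_add:
  assumes "bounded_meas f" "bounded_meas g"
  shows "bounded_meas (\<lambda>x. f x + g x)"
proof -
  obtain A B where "AE x in lebesgue. cmod (f x) \<le> A" "AE x in lebesgue. cmod (g x) \<le> B"
    using assms by (auto simp: bounded_meas_def)
  then have "AE x in lebesgue. cmod (f x + g x) \<le> A + B"
    by eventually_elim (intro norm_triangle_mono)
  then show ?thesis using assms by (auto simp: bounded_meas_def intro: borel_measurable_add)
qed

lemma bounded_meas_mult:
  assumes "bounded_meas f" "bounded_meas g"
  shows "bounded_meas (\<lambda>x. f x * g x)"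
proof -
  obtain A B where "AE x in lebesgue. cmod (f x) \<le> A" "AE x in lebesgue. cmod (g x) \<le> B"
    using assms by (auto simp: bounded_meas_def)
  then have "AE x in lebesgue. cmod (f x * g x) \<le> A * B"
    by eventually_elim (auto simp: norm_mult intro!: mult_mono intro: order_trans[OF norm_ge_zero])
  then show ?thesis using assms by (auto simp: bounded_meas_def intro: borel_measurable_times)
qed

lemma bounded_meas_minus: "bounded_meas f \<Longrightarrow> bounded_meas (\<lambda>x. - f x)"
  using bounded_meas_mult[OF bounded_meas_const[of "-1"]] by simp

lemma bounded_meas_diff: "bounded_meas f \<Longrightarrow> bounded_meas g \<Longrightarrow> bounded_meas (\<lambda>x. f x - g x)"
  using bounded_meas_add[OF _ bounded_meas_minus] by fastforce

lemma bounded_meas_sum: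
  "(\<And>a. a \<in> I \<Longrightarrow> bounded_meas (f a)) \<Longrightarrow> bounded_meas (\<lambda>x. \<Sum>a\<in>I. f a x)"
  by (induction I rule: infinite_finite_induct)
    (auto intro: bounded_meas_add simp: bounded_meas_const[of 0])

lemma bounded_meas_cnj: "bounded_meas f \<Longrightarrow> bounded_meas (\<lambda>x. cnj (f x))"
  unfolding bounded_meas_def
  by (auto intro!: borel_measurable_continuous_on[of cnj] continuous_intros)

lemma bounded_meas_set_integrable:
  assumes "bounded_meas f" "\<omega> \<in> sets lebesgue" "bounded \<omega>"
  shows "set_integrable lebesgue \<omega> f"
proof -
  obtain C where C: "AE x in lebesgue. cmod (f x) \<le> C" using assms(1) by (auto simp: bounded_meas_def)
  have "\<omega> \<in> lmeasurable" using assms bounded_set_imp_lmeasurable by blast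
  then have "emeasure lebesgue \<omega> < \<infinity>"
    using fmeasurableD2 unfolding infinity_ennreal_def less_top by blast
  then show ?thesis
    unfolding set_integrable_def
    by (intro integrableI_bounded_set_indicator[where B=C])
      (use assms C bounded_meas_measurable in auto)
qed

lemma sum_fun_apply: "(\<Sum>a\<in>I. f a) x = (\<Sum>a\<in>I. f a x :: 'b::comm_monoid_add)"
  by (induction I rule: infinite_finite_induct) auto

subsection \<open>Simplicial meshes\<close>

locale mesh =
  fixes \<T> :: "(real^'d::finite) set set" and \<Omega> :: "(real^'d) set" and k :: nat
  assumes mesh: "simplicial_mesh \<T>" and \<Omega>: "\<Omega> = interior (\<Union>\<T>)"
begin

lemma finite_cells: "finite \<T>"
  using mesh by (simp add: simplicial_mesh_def triangulation_def)

lemma cell_simplex: "K \<in> \<T> \<Longrightarrow> int CARD('d) simplex K"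
  using mesh by (simp add: simplicial_mesh_def)

lemma cell_face: "K \<in> \<T> \<Longrightarrow> K' \<in> \<T> \<Longrightarrow> (K \<inter> K') face_of K"
  using mesh by (simp add: simplicial_mesh_def triangulation_def)

lemma compact_cell: "K \<in> \<T> \<Longrightarrow> compact K"
  using cell_simplex compact_simplex by blast

lemma convex_cell: "K \<in> \<T> \<Longrightarrow> convex K"
  using cell_simplex convex_simplex by blast

text \<open>A simplex of full dimension spans the whole space affinely, so its relative interior,
  which is never empty, is its interior.\<close>

lemma interior_cell_ne: "K \<in> \<T> \<Longrightarrow> interior K \<noteq> {}"
  using aff_dim_simplex[OF cell_simplex] interior_rel_interior_gen[of K]
    rel_interior_eq_empty[OF convex_cell] by fastforce

lemma closure_interior_cell: "K \<in> \<T> \<Longrightarrow> closure (interior K) = K"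
  using convex_closure_interior[OF convex_cell interior_cell_ne] compact_cell[THEN compact_imp_closed]
  by simp

lemma closed_union: "\<S> \<subseteq> \<T> \<Longrightarrow> closed (\<Union>\<S>)"
  using finite_cells compact_cell by (auto intro!: closed_Union finite_subset[of \<S> \<T>] compact_imp_closed)

lemma compact_union: "compact (\<Union>\<T>)"
  using finite_cells compact_cell by (auto intro!: compact_Union)

lemma closure_interior_union: assumes "\<S> \<subseteq> \<T>" shows "closure (interior (\<Union>\<S>)) = \<Union>\<S>"
proof
  show "closure (interior (\<Union>\<S>)) \<subseteq> \<Union>\<S>"
    using closed_union[OF assms] by (meson closure_minimal interior_subset)
  show "\<Union>\<S> \<subseteq> closure (interior (\<Union>\<S>))"
  proof
    fix x assume "x \<in> \<Union>\<S>"
    then obtain K where K: "K \<in> \<S>" "x \<in> K" by blast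
    have "interior K \<subseteq> interior (\<Union>\<S>)" using K by (intro interior_mono) auto
    then show "x \<in> closure (interior (\<Union>\<S>))"
      using closure_mono closure_interior_cell K assms by blast
  qed
qed

lemma closure_\<Omega>: "closure \<Omega> = \<Union>\<T>"
  unfolding \<Omega> by (rule closure_interior_union) simp

lemma open_\<Omega>: "open \<Omega>" and \<Omega>_subset: "\<Omega> \<subseteq> \<Union>\<T>"
  unfolding \<Omega> by (auto intro: interior_subset[THEN subsetD])

lemma bounded_\<Omega>: "bounded \<Omega>"
  using \<Omega>_subset compact_union compact_imp_bounded bounded_subset by blast

text \<open>The null set to be avoided: every other point lies in the interior of a cell or outside
  the mesh, so finite element functions are smooth near it.\<close>

definition interfaces :: "(real^'d) set" where "interfaces = (\<Union>K\<in>\<T>. frontier K)"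

lemma AE_interfaces: "AE x in lebesgue. x \<notin> interfaces"
proof -
  have "negligible interfaces"
    unfolding interfaces_def
    by (intro negligible_Union finite_imageI finite_cells) (auto intro: negligible_convex_frontier convex_cell)
  then show ?thesis using AE_not_in negligible_iff_null_sets by blast
qed

lemma in_interior_cell:
  assumes "K \<in> \<T>" "x \<in> K" "x \<notin> interfaces" shows "x \<in> interior K"
  using assms compact_cell[of K] by (auto simp: interfaces_def frontier_def compact_imp_closed)

subsection \<open>Finite element functions\<close>

abbreviation "fem \<equiv> lagrange_fem \<T> k"

lemma fem_continuous: "u \<in> fem \<Longrightarrow> continuous_on (\<Union>\<T>) u"
  and fem_outside: "u \<in> fem \<Longrightarrow> x \<notin> \<Union>\<T> \<Longrightarrow> u x = 0"
  by (auto simp: lagrange_fem_def)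

lemma fem_cell:
  assumes "u \<in> fem" "K \<in> \<T>"
  obtains p where "poly_fun k p" "\<forall>x\<in>K. u x = p x"
  using assms by (auto simp: lagrange_fem_def)

lemma poly_fun_lincomb:
  assumes "poly_fun k p" "poly_fun k q"
  shows "poly_fun k (\<lambda>x. a * p x + b * q x)"
proof -
  obtain c d where "\<And>x. p x = (\<Sum>\<alpha> | (\<Sum>i\<in>UNIV. \<alpha> i) \<le> k. c \<alpha> * of_real (\<Prod>i\<in>UNIV. (x $ i) ^ \<alpha> i))"
    "\<And>x. q x = (\<Sum>\<alpha> | (\<Sum>i\<in>UNIV. \<alpha> i) \<le> k. d \<alpha> * of_real (\<Prod>i\<in>UNIV. (x $ i) ^ \<alpha> i))"
    using assms by (auto simp: poly_fun_def)
  then have "a * p x + b * q x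
      = (\<Sum>\<alpha> | (\<Sum>i\<in>UNIV. \<alpha> i) \<le> k. (a * c \<alpha> + b * d \<alpha>) * of_real (\<Prod>i\<in>UNIV. (x $ i) ^ \<alpha> i))" for x
    by (simp add: sum_distrib_left sum.distrib[symmetric] algebra_simps)
  then show ?thesis
    unfolding poly_fun_def by (intro exI[of _ "\<lambda>\<alpha>. a * c \<alpha> + b * d \<alpha>"]) blast
qed

lemma poly_fun_cnj:
  assumes "poly_fun k p"
  shows "poly_fun k (\<lambda>x. cnj (p x))"
proof -
  obtain c where "\<And>x. p x = (\<Sum>\<alpha> | (\<Sum>i\<in>UNIV. \<alpha> i) \<le> k. c \<alpha> * of_real (\<Prod>i\<in>UNIV. (x $ i) ^ \<alpha> i))"
    using assms by (auto simp: poly_fun_def)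
  then have "cnj (p x) = (\<Sum>\<alpha> | (\<Sum>i\<in>UNIV. \<alpha> i) \<le> k. cnj (c \<alpha>) * of_real (\<Prod>i\<in>UNIV. (x $ i) ^ \<alpha> i))" for x
    by simp
  then show ?thesis
    unfolding poly_fun_def by (intro exI[of _ "\<lambda>\<alpha>. cnj (c \<alpha>)"]) blast
qed

lemma fem_lincomb:
  assumes "u \<in> fem" "v \<in> fem"
  shows "(\<lambda>x. a * u x + b * v x) \<in> fem"
  unfolding lagrange_fem_def
proof (intro CollectI conjI ballI)
  show "continuous_on (\<Union>\<T>) (\<lambda>x. a * u x + b * v x)"
    by (intro continuous_intros fem_continuous assms)
  fix K assume K: "K \<in> \<T>"
  obtain p where "poly_fun k p" "\<forall>x\<in>K. u x = p x" by (rule fem_cell[OF assms(1) K])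
  moreover obtain q where "poly_fun k q" "\<forall>x\<in>K. v x = q x" by (rule fem_cell[OF assms(2) K])
  ultimately show "\<exists>p. poly_fun k p \<and> (\<forall>x\<in>K. a * u x + b * v x = p x)"
    by (intro exI[of _ "\<lambda>x. a * p x + b * q x"]) (simp add: poly_fun_lincomb)
qed (simp add: fem_outside[OF assms(1)] fem_outside[OF assms(2)])

lemma fem_zero: "0 \<in> fem"
proof -
  have "poly_fun k (\<lambda>x. 0)" unfolding poly_fun_def by (rule exI[of _ "\<lambda>\<alpha>. 0"]) simp
  then show ?thesis by (auto simp: lagrange_fem_def func_zero)
qed

lemma fem_subspace: "cvec.subspace fem"
proof (rule cvec.subspaceI)
  show "x + y \<in> fem" if "x \<in> fem" "y \<in> fem" for x y
    using fem_lincomb[OF that, of 1 1] by (simp add: func_plus)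
  show "c *\<^sub>C x \<in> fem" if "x \<in> fem" for c x
    using fem_lincomb[OF that that, of c 0] by (simp add: scaleC_fun_def scaleC_complex_def)
qed (rule fem_zero)

lemma fem_cnj: "u \<in> fem \<Longrightarrow> fun_cnj u \<in> fem"
  unfolding lagrange_fem_def fun_cnj_def
  using poly_fun_cnj by (fastforce intro!: continuous_on_cnj)

text \<open>Choosing one cell through each point makes the indicator functions of the cells disjoint.\<close>

lemma fem_fin_dim: "fin_dim fem"
proof -
  define cell where "cell x = (SOME K. K \<in> \<T> \<and> x \<in> K)" for x
  have cell: "cell x \<in> \<T>" "x \<in> cell x" if "x \<in> \<Union>\<T>" for x
    using someI_ex[of "\<lambda>K. K \<in> \<T> \<and> x \<in> K"] that by (auto simp: cell_def)
  define I where "I = {\<alpha> :: 'd \<Rightarrow> nat. (\<Sum>i\<in>UNIV. \<alpha> i) \<le> k}"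
  define b where "b K \<alpha> = (\<lambda>x. if x \<in> \<Union>\<T> \<and> cell x = K then complex_of_real (\<Prod>i\<in>UNIV. (x $ i) ^ \<alpha> i) else 0)"
    for K \<alpha>
  let ?F = "(\<lambda>(K, \<alpha>). b K \<alpha>) ` (\<T> \<times> I)"
  have "finite ?F" unfolding I_def
    by (intro finite_imageI finite_cartesian_product finite_cells finite_multi_indices)
  moreover have "u \<in> cvec.span ?F" if u: "u \<in> fem" for u
  proof -
    have "\<forall>K\<in>\<T>. \<exists>c. \<forall>x\<in>K. u x = (\<Sum>\<alpha>\<in>I. c \<alpha> * of_real (\<Prod>i\<in>UNIV. (x $ i) ^ \<alpha> i))"
      using u unfolding lagrange_fem_def poly_fun_def I_def by fastforce
    then obtain c where c: "\<And>K x. K \<in> \<T> \<Longrightarrow> x \<in> K \<Longrightarrow>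
        u x = (\<Sum>\<alpha>\<in>I. c K \<alpha> * of_real (\<Prod>i\<in>UNIV. (x $ i) ^ \<alpha> i))" by metis
    have "u = (\<Sum>K\<in>\<T>. \<Sum>\<alpha>\<in>I. c K \<alpha> *\<^sub>C b K \<alpha>)"
    proof
      fix x
      have app: "(\<Sum>K\<in>\<T>. \<Sum>\<alpha>\<in>I. c K \<alpha> *\<^sub>C b K \<alpha>) x = (\<Sum>K\<in>\<T>. \<Sum>\<alpha>\<in>I. c K \<alpha> * b K \<alpha> x)"
        by (simp add: sum_fun_apply scaleC_fun_def scaleC_complex_def)
      show "u x = (\<Sum>K\<in>\<T>. \<Sum>\<alpha>\<in>I. c K \<alpha> *\<^sub>C b K \<alpha>) x"
      proof (cases "x \<in> \<Union>\<T>")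
        case True
        have "(\<Sum>\<alpha>\<in>I. c K \<alpha> * b K \<alpha> x) = (if K = cell x then u x else 0)" if "K \<in> \<T>" for K
          using True that cell[OF True] c[of "cell x" x] by (auto simp: b_def)
        then show ?thesis using app cell[OF True] finite_cells by simp
      next
        case False
        then show ?thesis using app fem_outside[OF u] by (simp add: b_def)
      qed
    qed
    also have "\<dots> \<in> cvec.span ?F"
      by (intro cvec.span_sum cvec.span_scale cvec.span_base) auto
    finally show ?thesis .
  qed
  ultimately show ?thesis unfolding fin_dim_def by blast
qed

lemma fem_lipschitz:
  assumes u: "u \<in> fem"
  obtains L where "0 \<le> L" "\<forall>K\<in>\<T>. L-lipschitz_on K u"
proof -
  have "\<exists>C. C-lipschitz_on K u" if K: "K \<in> \<T>" for K
  proof -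
    obtain p where p: "poly_fun k p" "\<forall>x\<in>K. u x = p x" by (rule fem_cell[OF u K])
    then obtain C where "C-lipschitz_on K p"
      using poly_fun_bounded_lipschitz[of k p K] compact_cell[OF K] compact_imp_bounded
      by (auto simp: bounded_lipschitz_def)
    then have "C-lipschitz_on K u" using p(2) by (simp add: lipschitz_on_def)
    then show ?thesis by blast
  qed
  then obtain C where C: "\<And>K. K \<in> \<T> \<Longrightarrow> (C K)-lipschitz_on K u" by metis
  have C0: "0 \<le> C K" if "K \<in> \<T>" for K using C[OF that] by (simp add: lipschitz_on_def)
  \<comment> \<open>The sum serves as a common upper bound for the constants of the cells; it makes
    sense even for an empty mesh.\<close>
  have "(\<Sum>K\<in>\<T>. C K)-lipschitz_on K u" if K: "K \<in> \<T>" for K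
  proof (rule lipschitz_on_le[OF C[OF K]])
    show "C K \<le> (\<Sum>K\<in>\<T>. C K)" using K C0 finite_cells by (auto intro: member_le_sum[of K \<T> C])
  qed
  moreover have "0 \<le> (\<Sum>K\<in>\<T>. C K)" using C0 by (simp add: sum_nonneg)
  ultimately show ?thesis using that[of "\<Sum>K\<in>\<T>. C K"] by simp
qed

lemma fem_bounded:
  assumes u: "u \<in> fem"
  obtains M where "0 \<le> M" "\<And>x. cmod (u x) \<le> M"
proof -
  have "bounded (u ` \<Union>\<T>)"
    using compact_continuous_image[OF fem_continuous[OF u] compact_union] compact_imp_bounded by blast
  then obtain M where M: "\<And>x. x \<in> \<Union>\<T> \<Longrightarrow> cmod (u x) \<le> M" "0 < M" by (auto simp: bounded_pos)
  have "cmod (u x) \<le> M" for x using M fem_outside[OF u, of x] by (cases "x \<in> \<Union>\<T>") auto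
  then show ?thesis using that M(2) by (meson less_imp_le)
qed

lemma restr_fem_measurable:
  assumes "u \<in> fem" "closed \<Theta>" "\<Theta> \<subseteq> \<Union>\<T>"
  shows "restr \<Theta> u \<in> borel_measurable borel"
proof -
  have "(\<lambda>x. indicator \<Theta> x *\<^sub>R u x) \<in> borel_measurable borel"
    by (intro borel_measurable_continuous_on_indicator borel_closed assms
        continuous_on_subset[OF fem_continuous[OF assms(1)] assms(3)])
  moreover have "(\<lambda>x. indicator \<Theta> x *\<^sub>R u x) = restr \<Theta> u" by (auto simp: restr_def)
  ultimately show ?thesis by simp
qed

lemma fem_measurable: assumes "u \<in> fem" shows "u \<in> borel_measurable borel"
proof -
  have "restr (\<Union>\<T>) u = u" using fem_outside[OF assms] by (auto simp: restr_def)
  then show ?thesis using restr_fem_measurable[OF assms closed_union[OF order_refl]] by simp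
qed

lemma fem_bounded_meas: assumes "u \<in> fem" shows "bounded_meas u"
proof -
  obtain M where "\<And>x. cmod (u x) \<le> M" using fem_bounded[OF assms] by blast
  then show ?thesis using measurable_completion[of u lborel borel] fem_measurable[OF assms]
    by (auto simp: bounded_meas_def)
qed

text \<open>Off the interfaces, \<open>u\<close> agrees near \<open>x\<close> with a polynomial, or
  with zero on the open complement of the mesh. The bound comes from the Lipschitz constant of the
  cell.\<close>

lemma fem_has_pd:
  assumes u: "u \<in> fem" and x: "x \<notin> interfaces" and L: "\<forall>K\<in>\<T>. L-lipschitz_on K u" "0 \<le> L"
  shows "has_pd i u (pd i u x) x" "cmod (pd i u x) \<le> L"
proof -
  have "\<exists>D. has_pd i u D x \<and> cmod D \<le> L"
  proof (cases "x \<in> \<Union>\<T>")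
    case True
    then obtain K where K: "K \<in> \<T>" "x \<in> interior K" using in_interior_cell x by blast
    obtain p where p: "poly_fun k p" "\<forall>x\<in>K. u x = p x" by (rule fem_cell[OF u K(1)])
    obtain D where D: "has_pd i p D x" by (rule has_pd_differentiable[OF poly_fun_differentiable[OF p(1)]])
    have "has_pd i u D x"
      by (rule has_pd_cong_open[OF open_interior K(2) _ D]) (use p(2) interior_subset[of K] in auto)
    moreover have "cmod D \<le> L"
      using has_pd_bound[OF calculation open_interior K(2)] lipschitz_on_subset[OF bspec[OF L(1) K(1)] interior_subset]
      by blast
    ultimately show ?thesis by blast
  next
    case False
    have "has_pd i u 0 x"
      using False fem_outside[OF u] closed_union[OF order_refl]
      by (intro has_pd_cong_open[OF _ _ _ has_pd_const[of i 0], of "- \<Union>\<T>"]) auto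
    then show ?thesis using L(2) by force
  qed
  then show "has_pd i u (pd i u x) x" "cmod (pd i u x) \<le> L" using has_pd_eq by metis+
qed

lemma fem_AE_has_pd:
  assumes "u \<in> fem"
  shows "AE x in lebesgue. has_pd i u (pd i u x) x"
proof -
  obtain L where "0 \<le> L" "\<forall>K\<in>\<T>. L-lipschitz_on K u" by (rule fem_lipschitz[OF assms])
  then show ?thesis using AE_interfaces fem_has_pd[OF assms] by (auto elim!: eventually_mono)
qed

lemma fem_pd_bounded_meas:
  assumes u: "u \<in> fem"
  shows "bounded_meas (pd i u)"
proof -
  obtain L where L: "0 \<le> L" "\<forall>K\<in>\<T>. L-lipschitz_on K u" by (rule fem_lipschitz[OF u])
  have bd: "AE x in lebesgue. cmod (pd i u x) \<le> L"
    using AE_interfaces fem_has_pd[OF u _ L(2,1)] by (auto elim!: eventually_mono)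
  \<comment> \<open>Borel measurable difference quotients. Their limit is measurable and equals
    \<open>pd i u\<close> almost everywhere, and Lebesgue measurability is unaffected by null
    sets.\<close>
  define q where "q n x = (u (x + inverse (real (Suc n)) *\<^sub>R axis i 1) - u x) / of_real (inverse (real (Suc n)))"
    for n x
  note [measurable] = fem_measurable[OF u]
  have "q n \<in> borel_measurable borel" for n unfolding q_def by measurable
  then have "(\<lambda>x. lim (\<lambda>n. q n x)) \<in> borel_measurable lborel" by measurable
  then have "(\<lambda>x. lim (\<lambda>n. q n x)) \<in> borel_measurable lebesgue" by (rule measurable_completion)
  moreover have "AE x in lebesgue. lim (\<lambda>n. q n x) = pd i u x"
    using fem_AE_has_pd[OF u, of i]
  proof eventually_elim
    case (elim x)
    then show ?case unfolding q_def by (intro limI has_pd_quotient)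
  qed
  ultimately have "pd i u \<in> borel_measurable lebesgue" by (rule borel_measurable_AE)
  then show ?thesis using bd by (auto simp: bounded_meas_def)
qed

end

subsection \<open>Weak gradients of finite element functions\<close>

context mesh
begin

lemma test_function_regularity:
  assumes "\<phi> \<in> test_functions \<Omega>"
  obtains K M where "compact K" "K \<subseteq> \<Omega>" "\<forall>x. x \<notin> K \<longrightarrow> \<phi> x = 0 \<and> pd i \<phi> x = 0"
    "0 \<le> M" "\<forall>x. cmod (\<phi> x) \<le> M \<and> cmod (pd i \<phi> x) \<le> M" "\<forall>x. has_pd i \<phi> (pd i \<phi> x) x"
    "bounded_meas \<phi>" "bounded_meas (pd i \<phi>)" "\<phi> \<in> borel_measurable borel"
proof -
  obtain K where K: "compact K" "K \<subseteq> \<Omega>" "\<And>x. x \<notin> K \<Longrightarrow> \<phi> x = 0" and Ck: "\<And>n. Ck n \<phi>"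
    using assms by (auto simp: test_functions_def)
  have cont: "continuous_on UNIV \<phi>" using Ck[of 0] by simp
  have diff: "\<phi> differentiable (at x)" and contd: "continuous_on UNIV (pd i \<phi>)" for x
    using Ck[of "Suc 0"] by simp_all
  have pdK: "pd i \<phi> x = 0" if "x \<notin> K" for x
  proof -
    have "open (- K)" using K(1) by (simp add: compact_imp_closed open_Compl)
    then have "has_pd i \<phi> 0 x"
      using that K(3) by (intro has_pd_cong_open[OF _ _ _ has_pd_const[of i 0], of "- K"]) auto
    then show ?thesis by (rule has_pd_eq)
  qed
  have bd: "\<exists>M\<ge>0. \<forall>x. cmod (f x) \<le> M" if "continuous_on UNIV f" "\<And>x. x \<notin> K \<Longrightarrow> f x = 0"
    for f :: "'d cfun"
  proof -
    have "bounded (f ` K)"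
      using compact_continuous_image[OF continuous_on_subset[OF that(1) subset_UNIV] K(1)]
      by (rule compact_imp_bounded)
    then obtain M where M: "\<forall>x\<in>K. cmod (f x) \<le> M" "0 < M" by (auto simp: bounded_pos)
    have "cmod (f x) \<le> M" for x using M that(2)[of x] by (cases "x \<in> K") auto
    then show ?thesis using M(2) by (meson less_imp_le)
  qed
  obtain M1 where M1: "0 \<le> M1" "\<forall>x. cmod (\<phi> x) \<le> M1" using bd[OF cont K(3)] by blast
  obtain M2 where M2: "0 \<le> M2" "\<forall>x. cmod (pd i \<phi> x) \<le> M2" using bd[OF contd pdK] by blast
  have meas: "f \<in> borel_measurable lebesgue" if "continuous_on UNIV f" for f :: "'d cfun"
    using measurable_completion[of f lborel borel] borel_measurable_continuous_onI[OF that] by simp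
  have has: "\<forall>x. has_pd i \<phi> (pd i \<phi> x) x"
  proof
    fix x
    obtain D where "has_pd i \<phi> D x" by (rule has_pd_differentiable[OF diff])
    then show "has_pd i \<phi> (pd i \<phi> x) x" using has_pd_eq by metis
  qed
  show ?thesis
  proof (rule that[of K "max M1 M2"])
    show "bounded_meas \<phi>" "bounded_meas (pd i \<phi>)"
      using M1 M2 meas cont contd by (auto simp: bounded_meas_def)
    show "\<forall>x. cmod (\<phi> x) \<le> max M1 M2 \<and> cmod (pd i \<phi> x) \<le> max M1 M2"
      using M1(2) M2(2) by (auto intro: le_max_iff_disj[THEN iffD2])
  qed (use K pdK has M1(1) borel_measurable_continuous_onI[OF cont] in auto)
qed

lemma has_pd_line_bound:
  assumes d: "\<forall>x. has_pd i \<phi> (pd i \<phi> x) x" and M: "\<forall>x. cmod (pd i \<phi> x) \<le> M" and h: "0 \<le> h"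
  shows "cmod (\<phi> (x + h *\<^sub>R axis i 1) - \<phi> x) \<le> M * h"
proof -
  define f where "f t = \<phi> (x + t *\<^sub>R axis i 1)" for t
  have "(f has_vector_derivative pd i \<phi> (x + t *\<^sub>R axis i 1)) (at t)" for t
  proof -
    \<comment> \<open>\<open>has_pd\<close> speaks of parameter zero at a moving base point; the
      chain rule with a shift turns it into differentiability of \<open>f\<close> at
      \<open>t\<close>.\<close>
    have 1: "((\<lambda>s. s - t) has_vector_derivative 1) (at t)"
      by (auto intro!: derivative_eq_intros)
    have 2: "((\<lambda>s. \<phi> ((x + t *\<^sub>R axis i 1) + s *\<^sub>R axis i 1)) has_vector_derivative
        pd i \<phi> (x + t *\<^sub>R axis i 1)) (at (t - t))"
      using d by (simp add: has_pd_def)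
    have "(\<lambda>s. \<phi> ((x + t *\<^sub>R axis i 1) + s *\<^sub>R axis i 1)) \<circ> (\<lambda>s. s - t) = f"
      by (auto simp: f_def fun_eq_iff algebra_simps)
    then show ?thesis using vector_diff_chain_at[OF 1 2] by simp
  qed
  then have "(f has_derivative (\<lambda>s. s *\<^sub>R pd i \<phi> (x + t *\<^sub>R axis i 1))) (at t within UNIV)" for t
    by (simp add: has_vector_derivative_def)
  moreover have "onorm (\<lambda>s. s *\<^sub>R pd i \<phi> (x + t *\<^sub>R axis i 1)) \<le> M" for t
  proof (rule onorm_le)
    show "norm (s *\<^sub>R pd i \<phi> (x + t *\<^sub>R axis i 1)) \<le> M * norm s" for s
      using mult_left_mono[OF spec[OF M] abs_ge_zero[of s]] by (simp add: mult.commute)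
  qed
  ultimately have "norm (f h - f 0) \<le> M * norm (h - 0)"
    by (intro differentiable_bound[where S=UNIV]) auto
  then show ?thesis using h by (simp add: f_def)
qed

text \<open>The cells cut the segment into finitely many closed pieces on which \<open>u\<close> has
  Lipschitz constant \<open>L\<close>; on an interval such pieces join with the same constant. The
  mesh need not be convex, so only segments inside it are considered.\<close>

lemma fem_line_bound:
  assumes u: "u \<in> fem" and L: "0 \<le> L" "\<forall>K\<in>\<T>. L-lipschitz_on K u"
    and h: "0 \<le> h" and seg: "\<And>t. t \<in> {0..h} \<Longrightarrow> x + t *\<^sub>R axis i 1 \<in> \<Union>\<T>"
  shows "cmod (u (x + h *\<^sub>R axis i 1) - u x) \<le> L * h"
proof -
  define \<gamma> where "\<gamma> t = x + t *\<^sub>R axis i (1::real)" for t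
  have dist: "dist (\<gamma> s) (\<gamma> t) = dist s t" for s t
    by (simp add: \<gamma>_def dist_norm scaleR_diff_left[symmetric])
  have "L-lipschitz_on {0..h} (\<lambda>t. u (\<gamma> t))"
  proof (rule lipschitz_on_closed_Union[where I=\<T> and U="\<lambda>K. \<gamma> -` K"])
    show "L-lipschitz_on (\<gamma> -` K) (\<lambda>t. u (\<gamma> t))" if "K \<in> \<T>" for K
    proof (rule lipschitz_onI[OF _ L(1)])
      show "dist (u (\<gamma> s)) (u (\<gamma> t)) \<le> L * dist s t" if "s \<in> \<gamma> -` K" "t \<in> \<gamma> -` K" for s t
        using lipschitz_onD[OF bspec[OF L(2) \<open>K \<in> \<T>\<close>], of "\<gamma> s" "\<gamma> t"] that dist[of s t] by simp
    qed
    show "closed (\<gamma> -` K)" if "K \<in> \<T>" for K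
      unfolding \<gamma>_def using compact_cell[OF that]
      by (intro closed_vimage compact_imp_closed continuous_intros)
    show "{0..h} \<subseteq> (\<Union>K\<in>\<T>. \<gamma> -` K)" using seg by (auto simp: \<gamma>_def)
  qed (use finite_cells L in auto)
  from lipschitz_onD[OF this, of h 0] h show ?thesis by (simp add: \<gamma>_def dist_norm)
qed

lemma bounded_meas_integrable_support:
  assumes "bounded_meas f" "compact K" "\<And>x. x \<notin> K \<Longrightarrow> f x = 0"
  shows "integrable lebesgue f"
proof -
  have "set_integrable lebesgue K f"
    using assms compact_imp_bounded by (intro bounded_meas_set_integrable) (auto simp: lmeasurable_compact fmeasurableD)
  moreover have "(\<lambda>x. indicator K x *\<^sub>R f x) = f" using assms(3) by (auto simp: indicator_def)
  ultimately show ?thesis by (simp add: set_integrable_def)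
qed

lemma integral_translate:
  fixes w :: "'d cfun"
  assumes w: "w \<in> borel_measurable borel" "integrable lborel w"
  shows "integrable lborel (\<lambda>x. w (x + c))" "(LINT x|lborel. w (x + c)) = (LINT x|lborel. w x)"
proof -
  have [measurable]: "(+) c \<in> lborel \<rightarrow>\<^sub>M borel" by measurable
  have eq: "(\<lambda>x. w (c + x)) = (\<lambda>x. w (x + c))" by (simp add: add.commute)
  show "integrable lborel (\<lambda>x. w (x + c))"
    using integrable_distr[of "(+) c" lborel borel w] w by (simp add: lborel_distr_plus eq)
  show "(LINT x|lborel. w (x + c)) = (LINT x|lborel. w x)"
    using integral_distr[of "(+) c" lborel borel w] w by (simp add: lborel_distr_plus eq)
qed

text \<open>The difference quotients of \<open>u \<phi>\<close>, extended by zero, have integral zero by translation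
  invariance and are dominated, since \<open>u\<close> is Lipschitz along short segments meeting the support
  of \<open>\<phi>\<close>.\<close>

lemma fem_integration_by_parts:
  assumes u: "u \<in> fem" and \<phi>: "\<phi> \<in> test_functions \<Omega>"
  shows "(LINT x:\<Omega>|lebesgue. u x * pd i \<phi> x) = - (LINT x:\<Omega>|lebesgue. pd i u x * \<phi> x)"
proof -
  obtain K M where K: "compact K" "K \<subseteq> \<Omega>" "\<forall>x. x \<notin> K \<longrightarrow> \<phi> x = 0 \<and> pd i \<phi> x = 0"
    and M: "0 \<le> M" "\<forall>x. cmod (\<phi> x) \<le> M \<and> cmod (pd i \<phi> x) \<le> M"
    and has: "\<forall>x. has_pd i \<phi> (pd i \<phi> x) x" and bm: "bounded_meas \<phi>" "bounded_meas (pd i \<phi>)"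
    and [measurable]: "\<phi> \<in> borel_measurable borel"
    by (rule test_function_regularity[OF \<phi>, of i])
  obtain L where L: "0 \<le> L" "\<forall>K\<in>\<T>. L-lipschitz_on K u" by (rule fem_lipschitz[OF u])
  obtain Mu where Mu: "0 \<le> Mu" "\<And>x. cmod (u x) \<le> Mu" using fem_bounded[OF u] by metis
  \<comment> \<open>A segment of length at most \<open>\<delta>\<close> with an endpoint in
    \<open>K\<close> stays inside \<open>\<Omega>\<close>, where the Lipschitz bound for
    \<open>u\<close> is available.\<close>
  obtain \<delta> where \<delta>: "0 < \<delta>" "(\<Union>x\<in>K. cball x \<delta>) \<subseteq> \<Omega>"
    by (rule compact_subset_open_imp_cball_epsilon_subset[OF K(1) open_\<Omega> K(2)])
  note [measurable] = fem_measurable[OF u]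
  define e where "e = axis i (1::real)"
  define w where "w x = u x * \<phi> x" for x
  define h where "h n = inverse (real (Suc n))" for n
  \<comment> \<open>The product rule for differences: the bound of \<open>u\<close> times the slope
    of \<open>\<phi>\<close>, plus the slope of \<open>u\<close> times the bound of
    \<open>\<phi>\<close>. \<open>M\<close> bounds both \<open>\<phi>\<close> and its
    derivative.\<close>
  define C where "C = Mu * M + L * M"
  have C0: "0 \<le> C" using Mu M L by (simp add: C_def)
  have [measurable]: "w \<in> borel_measurable borel" unfolding w_def by measurable
  have wK: "w x = 0" if "x \<notin> K" for x using K(3) that by (simp add: w_def)
  have step: "cmod (w (x + t *\<^sub>R e) - w x) \<le> C * t" if t: "0 < t" "t \<le> \<delta>" for x t
  proof (cases "x \<in> K \<or> x + t *\<^sub>R e \<in> K")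
    case True
    have "x + s *\<^sub>R e \<in> \<Union>\<T>" if s: "s \<in> {0..t}" for s
    proof -
      have "dist x (x + s *\<^sub>R e) \<le> \<delta>" "dist (x + t *\<^sub>R e) (x + s *\<^sub>R e) \<le> \<delta>"
        using s t by (auto simp: dist_norm e_def scaleR_diff_left[symmetric])
      then obtain y where "y \<in> K" "x + s *\<^sub>R e \<in> cball y \<delta>" using True unfolding mem_cball by blast
      then have "x + s *\<^sub>R e \<in> \<Omega>" using \<delta>(2) by blast
      then show ?thesis using \<Omega>_subset by blast
    qed
    then have "cmod (u (x + t *\<^sub>R e) - u x) \<le> L * t"
      using fem_line_bound[OF u L, of t x i] t by (simp add: e_def)
    moreover have "cmod (\<phi> (x + t *\<^sub>R e) - \<phi> x) \<le> M * t"
      using has_pd_line_bound[OF has, of M t x] M t by (simp add: e_def)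
    moreover have "w (x + t *\<^sub>R e) - w x
        = u (x + t *\<^sub>R e) * (\<phi> (x + t *\<^sub>R e) - \<phi> x) + (u (x + t *\<^sub>R e) - u x) * \<phi> x"
      by (simp add: w_def algebra_simps)
    then have "cmod (w (x + t *\<^sub>R e) - w x)
        \<le> cmod (u (x + t *\<^sub>R e)) * cmod (\<phi> (x + t *\<^sub>R e) - \<phi> x) + cmod (u (x + t *\<^sub>R e) - u x) * cmod (\<phi> x)"
      by (metis norm_mult norm_triangle_ineq)
    moreover have "cmod (u (x + t *\<^sub>R e)) * cmod (\<phi> (x + t *\<^sub>R e) - \<phi> x) \<le> Mu * (M * t)"
      by (intro mult_mono Mu calculation) auto
    moreover have "cmod (u (x + t *\<^sub>R e) - u x) * cmod (\<phi> x) \<le> (L * t) * M"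
      using M L t by (intro mult_mono calculation(1)) auto
    ultimately show ?thesis by (simp add: C_def algebra_simps)
  next
    case False
    then show ?thesis using wK t C0 by simp
  qed
  define q where "q n x = (w (x + h n *\<^sub>R e) - w x) / of_real (h n)" for n x
  have hpos: "0 < h n" "h n \<le> 1" for n by (auto simp: h_def inverse_le_1_iff)
  have "h \<longlonglongrightarrow> 0" unfolding h_def by (rule LIMSEQ_inverse_real_of_nat)
  then have "eventually (\<lambda>n. h n < \<delta>) sequentially" using \<delta>(1) by (rule order_tendstoD)
  then obtain n0 where n0: "\<And>n. n \<ge> n0 \<Longrightarrow> h n < \<delta>" by (auto simp: eventually_sequentially)
  obtain \<rho> where \<rho>: "\<And>x. x \<in> K \<Longrightarrow> norm x \<le> \<rho>"
    using compact_imp_bounded[OF K(1)] by (auto simp: bounded_iff)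
  \<comment> \<open>\<open>K\<close> enlarged by one: the step sizes are at most 1, so all
    difference quotients vanish outside this ball.\<close>
  define D where "D = cball (0 :: real^'d) (\<rho> + 1)"
  have bound: "cmod (q n x) \<le> C * indicator D x" if "n \<ge> n0" for n x
  proof (cases "x \<in> D")
    case True
    have "cmod (w (x + h n *\<^sub>R e) - w x) \<le> C * h n" using step hpos n0[OF that] by (simp add: less_imp_le)
    then show ?thesis using True hpos[of n] by (simp add: q_def norm_divide divide_le_eq)
  next
    case False
    have "x \<notin> K" using \<rho>[of x] False by (auto simp: D_def)
    moreover have "x + h n *\<^sub>R e \<notin> K"
    proof
      assume "x + h n *\<^sub>R e \<in> K"
      then have "norm (x + h n *\<^sub>R e) \<le> \<rho>" by (rule \<rho>)
      moreover have "norm (h n *\<^sub>R e) \<le> 1" using hpos[of n] by (simp add: e_def)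
      ultimately have "norm x \<le> \<rho> + 1" using norm_triangle_ineq4[of "x + h n *\<^sub>R e" "h n *\<^sub>R e"] by simp
      then show False using False by (simp add: D_def)
    qed
    ultimately show ?thesis using wK C0 by (simp add: q_def)
  qed
  have w_int: "integrable lborel w"
  proof -
    have "bounded_meas w" unfolding w_def by (intro bounded_meas_mult fem_bounded_meas u bm)
    then have "integrable lebesgue w" by (rule bounded_meas_integrable_support[OF _ K(1) wK])
    then show ?thesis by (simp add: integrable_completion)
  qed
  have q_meas[measurable]: "q n \<in> borel_measurable lborel" for n unfolding q_def by measurable
  have q_int: "(LINT x|lebesgue. q n x) = 0" for n
  proof -
    have "(LINT x|lebesgue. q n x) = (LINT x|lborel. q n x)" by (rule integral_completion) measurable
    also have "\<dots> = (LINT x|lborel. w (x + h n *\<^sub>R e) - w x) / of_real (h n)"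
      unfolding q_def by simp
    also have "\<dots> = 0" using integral_translate[of w "h n *\<^sub>R e"] w_int by simp
    finally show ?thesis .
  qed
  define f where "f x = u x * pd i \<phi> x + pd i u x * \<phi> x" for x
  have bf: "bounded_meas f" unfolding f_def
    by (intro bounded_meas_add bounded_meas_mult fem_bounded_meas fem_pd_bounded_meas u bm)
  \<comment> \<open>The shift by \<open>n0\<close> keeps only steps shorter than
    \<open>\<delta>\<close>, for which the dominating function is valid.\<close>
  have "(\<lambda>n. LINT x|lebesgue. q (n + n0) x) \<longlonglongrightarrow> (LINT x|lebesgue. f x)"
  proof (rule integral_dominated_convergence[where w="\<lambda>x. C * indicator D x"])
    show "f \<in> borel_measurable lebesgue" using bf by (rule bounded_meas_measurable)
    show "q (n + n0) \<in> borel_measurable lebesgue" for n by (rule measurable_completion[OF q_meas])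
    have D: "D \<in> lmeasurable" unfolding D_def by (intro lmeasurable_compact compact_cball)
    then have "emeasure lebesgue D < \<infinity>"
      using fmeasurableD2 unfolding infinity_ennreal_def less_top by blast
    then show "integrable lebesgue (\<lambda>x. C * indicator D x)"
      by (intro integrable_mult_right integrable_real_indicator fmeasurableD[OF D])
    show "AE x in lebesgue. (\<lambda>n. q (n + n0) x) \<longlonglongrightarrow> f x"
      using fem_AE_has_pd[OF u, of i]
    proof eventually_elim
      case (elim x)
      have "has_pd i w (f x) x" unfolding w_def f_def using has_pd_mult[OF elim] has by blast
      then have "(\<lambda>n. q n x) \<longlonglongrightarrow> f x" unfolding q_def h_def e_def by (rule has_pd_quotient)
      then show ?case by (rule LIMSEQ_ignore_initial_segment)
    qed
    show "AE x in lebesgue. norm (q (n + n0) x) \<le> C * indicator D x" for n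
      using bound by simp
  qed
  then have "(LINT x|lebesgue. f x) = 0" by (simp add: q_int LIMSEQ_const_iff)
  moreover have int: "integrable lebesgue (\<lambda>x. u x * pd i \<phi> x)" "integrable lebesgue (\<lambda>x. pd i u x * \<phi> x)"
    using K(3) by (auto intro!: bounded_meas_integrable_support[OF _ K(1)] bounded_meas_mult
        fem_bounded_meas[OF u] fem_pd_bounded_meas[OF u] bm)
  ultimately have "(LINT x|lebesgue. u x * pd i \<phi> x) + (LINT x|lebesgue. pd i u x * \<phi> x) = 0"
    by (simp add: f_def)
  moreover have "(\<lambda>x. indicator \<Omega> x *\<^sub>R (u x * pd i \<phi> x)) = (\<lambda>x. u x * pd i \<phi> x)"
    "(\<lambda>x. indicator \<Omega> x *\<^sub>R (pd i u x * \<phi> x)) = (\<lambda>x. pd i u x * \<phi> x)"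
    using K(2,3) by (auto simp: indicator_def fun_eq_iff subset_iff)
  ultimately show ?thesis by (simp add: set_lebesgue_integral_def eq_neg_iff_add_eq_0)
qed

lemma bounded_meas_square_integrable:
  assumes "bounded_meas f"
  shows "square_integrable \<Omega> f"
proof -
  have \<Omega>_meas: "\<Omega> \<in> sets lebesgue" using open_\<Omega> by simp
  have "bounded_meas (\<lambda>x. f x * cnj (f x))" by (intro bounded_meas_mult bounded_meas_cnj assms)
  then have "set_integrable lebesgue \<Omega> (\<lambda>x. f x * cnj (f x))"
    by (rule bounded_meas_set_integrable[OF _ \<Omega>_meas bounded_\<Omega>])
  then have "integrable lebesgue (\<lambda>x. Re (indicator \<Omega> x *\<^sub>R (f x * cnj (f x))))"
    unfolding set_integrable_def by (rule integrable_Re)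
  then have "set_integrable lebesgue \<Omega> (\<lambda>x. (cmod (f x))\<^sup>2)"
    unfolding set_integrable_def cmod_power2 by (simp add: power2_eq_square)
  moreover have "set_borel_measurable lebesgue \<Omega> f"
    unfolding set_borel_measurable_def using \<Omega>_meas bounded_meas_measurable[OF assms]
    by (intro borel_measurable_scaleR borel_measurable_indicator)
  ultimately show ?thesis by (simp add: square_integrable_def)
qed

lemma fem_weak_gradient: "u \<in> fem \<Longrightarrow> weak_gradient \<Omega> u (\<lambda>i. pd i u)"
  unfolding weak_gradient_def
  using fem_integration_by_parts bounded_meas_square_integrable fem_pd_bounded_meas by blast

lemma fem_H1: "u \<in> fem \<Longrightarrow> u \<in> H1 \<Omega>"
  unfolding H1_def using fem_weak_gradient bounded_meas_square_integrable fem_bounded_meas by blast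

end

subsection \<open>The space \<open>H\<^sup>1\<close>\<close>

text \<open>Lets an estimate that holds for each weak gradient pass to the infimum in
  \<open>H1_norm\<close>.\<close>

lemma affine_Inf_bound:
  fixes S :: "real set"
  assumes "S \<noteq> {}" "0 \<le> c" "\<And>s. s \<in> S \<Longrightarrow> y \<le> c * s + d"
  shows "y \<le> c * Inf S + d"
proof (cases "c = 0")
  case True
  then show ?thesis using assms by auto
next
  case False
  have "(y - d) / c \<le> Inf S"
  proof (rule cInf_greatest[OF assms(1)])
    show "(y - d) / c \<le> s" if "s \<in> S" for s
      using assms(2) assms(3)[OF that] False by (simp add: divide_le_eq mult.commute)
  qed
  then show ?thesis using assms(2) False by (simp add: divide_le_eq mult.commute)
qed

text \<open>The square of a sum is at most twice the sum of the squares. The factor 2 survives in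
  \<open>H1_norm_lincomb\<close>; this is harmless, as that bound is applied only to errors tending
  to zero and to zero coefficients.\<close>

lemma norm_lincomb_square:
  "(cmod (a * x + b * y))\<^sup>2 \<le> 2 * (cmod a)\<^sup>2 * (cmod x)\<^sup>2 + 2 * (cmod b)\<^sup>2 * (cmod y)\<^sup>2"
proof -
  have "cmod (a * x + b * y) \<le> cmod a * cmod x + cmod b * cmod y"
    by (metis norm_mult norm_triangle_ineq)
  then have "(cmod (a * x + b * y))\<^sup>2 \<le> (cmod a * cmod x + cmod b * cmod y)\<^sup>2"
    by (rule power_mono) simp
  also have "\<dots> \<le> 2 * (cmod a * cmod x)\<^sup>2 + 2 * (cmod b * cmod y)\<^sup>2"
    using sum_squares_bound[of "cmod a * cmod x" "cmod b * cmod y"] by (simp add: power2_sum)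
  finally show ?thesis by (simp add: power_mult_distrib)
qed

lemma square_integrable_lincomb:
  assumes "square_integrable \<Omega> u" "square_integrable \<Omega> v"
  shows "square_integrable \<Omega> (\<lambda>x. a * u x + b * v x)"
proof -
  have [measurable]: "(\<lambda>x. indicator \<Omega> x *\<^sub>R u x) \<in> borel_measurable lebesgue"
    "(\<lambda>x. indicator \<Omega> x *\<^sub>R v x) \<in> borel_measurable lebesgue"
    using assms by (auto simp: square_integrable_def set_borel_measurable_def)
  have "(\<lambda>x. a * (indicator \<Omega> x *\<^sub>R u x) + b * (indicator \<Omega> x *\<^sub>R v x)) \<in> borel_measurable lebesgue"
    by measurable
  also have "(\<lambda>x. a * (indicator \<Omega> x *\<^sub>R u x) + b * (indicator \<Omega> x *\<^sub>R v x))
      = (\<lambda>x. indicator \<Omega> x *\<^sub>R (a * u x + b * v x))"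
    by (auto simp: indicator_def)
  finally have meas: "(\<lambda>x. indicator \<Omega> x *\<^sub>R (a * u x + b * v x)) \<in> borel_measurable lebesgue" .
  have "(\<lambda>x. (cmod (indicator \<Omega> x *\<^sub>R (a * u x + b * v x)))\<^sup>2) \<in> borel_measurable lebesgue"
    using meas by measurable
  also have "(\<lambda>x. (cmod (indicator \<Omega> x *\<^sub>R (a * u x + b * v x)))\<^sup>2)
      = (\<lambda>x. indicator \<Omega> x *\<^sub>R (cmod (a * u x + b * v x))\<^sup>2)"
    by (auto simp: indicator_def)
  finally have sm: "set_borel_measurable lebesgue \<Omega> (\<lambda>x. (cmod (a * u x + b * v x))\<^sup>2)"
    by (simp add: set_borel_measurable_def)
  have si: "set_integrable lebesgue \<Omega>
      (\<lambda>x. 2 * (cmod a)\<^sup>2 * (cmod (u x))\<^sup>2 + 2 * (cmod b)\<^sup>2 * (cmod (v x))\<^sup>2)"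
    using assms by (intro set_integral_add set_integrable_mult_right) (auto simp: square_integrable_def)
  have "AE x in lebesgue. x \<in> \<Omega> \<longrightarrow> norm ((cmod (a * u x + b * v x))\<^sup>2)
      \<le> norm (2 * (cmod a)\<^sup>2 * (cmod (u x))\<^sup>2 + 2 * (cmod b)\<^sup>2 * (cmod (v x))\<^sup>2)"
    using norm_lincomb_square by (auto intro!: AE_I2 order_trans[OF norm_lincomb_square])
  with si sm have "set_integrable lebesgue \<Omega> (\<lambda>x. (cmod (a * u x + b * v x))\<^sup>2)"
    by (rule set_integrable_bound)
  then show ?thesis using meas by (simp add: square_integrable_def set_borel_measurable_def)
qed

lemma square_integrable_mult:
  assumes "square_integrable \<Omega> u" "square_integrable \<Omega> v"
  shows "set_integrable lebesgue \<Omega> (\<lambda>x. u x * v x)"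
proof (rule set_integrable_bound)
  have [measurable]: "(\<lambda>x. indicator \<Omega> x *\<^sub>R u x) \<in> borel_measurable lebesgue"
    "(\<lambda>x. indicator \<Omega> x *\<^sub>R v x) \<in> borel_measurable lebesgue"
    using assms by (auto simp: square_integrable_def set_borel_measurable_def)
  have "(\<lambda>x. (indicator \<Omega> x *\<^sub>R u x) * (indicator \<Omega> x *\<^sub>R v x)) \<in> borel_measurable lebesgue"
    by measurable
  also have "(\<lambda>x. (indicator \<Omega> x *\<^sub>R u x) * (indicator \<Omega> x *\<^sub>R v x))
      = (\<lambda>x. indicator \<Omega> x *\<^sub>R (u x * v x))"
    by (auto simp: indicator_def)
  finally show "set_borel_measurable lebesgue \<Omega> (\<lambda>x. u x * v x)" by (simp add: set_borel_measurable_def)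
  show "set_integrable lebesgue \<Omega> (\<lambda>x. (cmod (u x))\<^sup>2 + (cmod (v x))\<^sup>2)"
    using assms by (intro set_integral_add) (auto simp: square_integrable_def)
  have "cmod (u x * v x) \<le> (cmod (u x))\<^sup>2 + (cmod (v x))\<^sup>2" for x
    using sum_squares_bound[of "cmod (u x)" "cmod (v x)"]
      mult_nonneg_nonneg[OF norm_ge_zero[of "u x"] norm_ge_zero[of "v x"]]
    unfolding norm_mult by linarith
  then show "AE x in lebesgue. x \<in> \<Omega> \<longrightarrow> norm (u x * v x) \<le> norm ((cmod (u x))\<^sup>2 + (cmod (v x))\<^sup>2)"
    by simp
qed

definition H1_energy :: "(real^'d) set \<Rightarrow> ('d::finite) cfun \<Rightarrow> ('d \<Rightarrow> 'd cfun) \<Rightarrow> real" where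
  "H1_energy \<Omega> u g = (LINT x:\<Omega>|lebesgue. (cmod (u x))\<^sup>2 + (\<Sum>i\<in>UNIV. (cmod (g i x))\<^sup>2))"

lemma H1_norm_energy: "H1_norm \<Omega> u = Inf {sqrt (H1_energy \<Omega> u g) | g. weak_gradient \<Omega> u g}"
  by (simp add: H1_norm_def H1_energy_def)

lemma H1_energy_nonneg: "0 \<le> H1_energy \<Omega> u g"
  unfolding H1_energy_def set_lebesgue_integral_def
  by (intro Bochner_Integration.integral_nonneg) (auto intro!: mult_nonneg_nonneg add_nonneg_nonneg sum_nonneg)

lemma H1_energy_integrable:
  assumes "square_integrable \<Omega> u" "weak_gradient \<Omega> u g"
  shows "set_integrable lebesgue \<Omega> (\<lambda>x. (cmod (u x))\<^sup>2 + (\<Sum>i\<in>UNIV. (cmod (g i x))\<^sup>2))"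
proof -
  have "set_integrable lebesgue \<Omega> (\<lambda>x. \<Sum>i\<in>UNIV. (cmod (g i x))\<^sup>2)"
    unfolding set_integrable_def scaleR_sum_right
  proof (rule Bochner_Integration.integrable_sum)
    show "integrable lebesgue (\<lambda>x. indicator \<Omega> x *\<^sub>R (cmod (g i x))\<^sup>2)" for i
      using assms(2) unfolding weak_gradient_def square_integrable_def set_integrable_def by blast
  qed
  then show ?thesis using assms by (intro set_integral_add) (auto simp: square_integrable_def)
qed

lemma H1_energy_lincomb:
  assumes "square_integrable \<Omega> u" "square_integrable \<Omega> v" "weak_gradient \<Omega> u g" "weak_gradient \<Omega> v h"
    "weak_gradient \<Omega> (\<lambda>x. a * u x + b * v x) (\<lambda>i x. a * g i x + b * h i x)"
  shows "sqrt (H1_energy \<Omega> (\<lambda>x. a * u x + b * v x) (\<lambda>i x. a * g i x + b * h i x))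
    \<le> 2 * cmod a * sqrt (H1_energy \<Omega> u g) + 2 * cmod b * sqrt (H1_energy \<Omega> v h)"
proof -
  note intg = H1_energy_integrable[OF assms(1,3)] H1_energy_integrable[OF assms(2,4)]
  let ?A = "2 * (cmod a)\<^sup>2" and ?B = "2 * (cmod b)\<^sup>2"
  have "H1_energy \<Omega> (\<lambda>x. a * u x + b * v x) (\<lambda>i x. a * g i x + b * h i x)
      \<le> (LINT x:\<Omega>|lebesgue. ?A * ((cmod (u x))\<^sup>2 + (\<Sum>i\<in>UNIV. (cmod (g i x))\<^sup>2))
          + ?B * ((cmod (v x))\<^sup>2 + (\<Sum>i\<in>UNIV. (cmod (h i x))\<^sup>2)))"
    unfolding H1_energy_def
  proof (rule set_integral_mono)
    show "set_integrable lebesgue \<Omega> (\<lambda>x. (cmod (a * u x + b * v x))\<^sup>2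
        + (\<Sum>i\<in>UNIV. (cmod (a * g i x + b * h i x))\<^sup>2))"
      by (rule H1_energy_integrable[OF square_integrable_lincomb assms(5)]) fact+
    show "set_integrable lebesgue \<Omega> (\<lambda>x. ?A * ((cmod (u x))\<^sup>2 + (\<Sum>i\<in>UNIV. (cmod (g i x))\<^sup>2))
          + ?B * ((cmod (v x))\<^sup>2 + (\<Sum>i\<in>UNIV. (cmod (h i x))\<^sup>2)))"
      by (intro set_integral_add set_integrable_mult_right intg)
    fix x
    have "(\<Sum>i\<in>UNIV. (cmod (a * g i x + b * h i x))\<^sup>2)
        \<le> (\<Sum>i\<in>UNIV. ?A * (cmod (g i x))\<^sup>2 + ?B * (cmod (h i x))\<^sup>2)"
      by (intro sum_mono norm_lincomb_square)
    then show "(cmod (a * u x + b * v x))\<^sup>2 + (\<Sum>i\<in>UNIV. (cmod (a * g i x + b * h i x))\<^sup>2)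
        \<le> ?A * ((cmod (u x))\<^sup>2 + (\<Sum>i\<in>UNIV. (cmod (g i x))\<^sup>2))
          + ?B * ((cmod (v x))\<^sup>2 + (\<Sum>i\<in>UNIV. (cmod (h i x))\<^sup>2))"
      using norm_lincomb_square[of a "u x" b "v x"]
      by (simp add: sum.distrib sum_distrib_left[symmetric] distrib_left)
  qed
  also have "\<dots> = ?A * H1_energy \<Omega> u g + ?B * H1_energy \<Omega> v h"
    unfolding H1_energy_def using intg
    by (subst set_integral_add(2)) (simp_all only: set_integral_mult_right set_integrable_mult_right)
  also have "\<dots> \<le> (2 * cmod a * sqrt (H1_energy \<Omega> u g) + 2 * cmod b * sqrt (H1_energy \<Omega> v h))\<^sup>2"
    using H1_energy_nonneg[of \<Omega> u g] H1_energy_nonneg[of \<Omega> v h]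
    by (simp add: power2_sum power_mult_distrib mult_nonneg_nonneg add_mono mult_right_mono)
  finally show ?thesis
    using H1_energy_nonneg[of \<Omega> u g] H1_energy_nonneg[of \<Omega> v h]
    by (intro real_le_lsqrt) auto
qed

lemma H1_norm_le: "weak_gradient \<Omega> u g \<Longrightarrow> H1_norm \<Omega> u \<le> sqrt (H1_energy \<Omega> u g)"
  unfolding H1_norm_energy
  by (rule cInf_lower) (auto intro!: bdd_belowI[of _ 0] simp: H1_energy_nonneg)

lemma H1_norm_nonneg: "u \<in> H1 \<Omega> \<Longrightarrow> 0 \<le> H1_norm \<Omega> u"
  unfolding H1_norm_energy
  by (rule cInf_greatest) (auto simp: H1_def H1_energy_nonneg)

context mesh
begin

lemma weak_gradient_lincomb:
  assumes u: "square_integrable \<Omega> u" "weak_gradient \<Omega> u g"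
    and v: "square_integrable \<Omega> v" "weak_gradient \<Omega> v h"
  shows "weak_gradient \<Omega> (\<lambda>x. a * u x + b * v x) (\<lambda>i x. a * g i x + b * h i x)"
  unfolding weak_gradient_def
proof (intro conjI allI ballI)
  show "square_integrable \<Omega> (\<lambda>x. a * g i x + b * h i x)" for i
    using u v by (intro square_integrable_lincomb) (auto simp: weak_gradient_def)
  fix \<phi> i assume \<phi>: "\<phi> \<in> test_functions \<Omega>"
  have sq: "square_integrable \<Omega> \<phi>" "square_integrable \<Omega> (pd i \<phi>)"
    by (rule test_function_regularity[OF \<phi>, of i]; blast intro: bounded_meas_square_integrable)+
  have gh: "square_integrable \<Omega> (g i)" "square_integrable \<Omega> (h i)"
    using u v by (auto simp: weak_gradient_def)
  have lin: "(LINT x:\<Omega>|lebesgue. (a * p x + b * q x) * s x)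
      = a * (LINT x:\<Omega>|lebesgue. p x * s x) + b * (LINT x:\<Omega>|lebesgue. q x * s x)"
    if "square_integrable \<Omega> p" "square_integrable \<Omega> q" "square_integrable \<Omega> s" for p q s
  proof -
    have "(\<lambda>x. (a * p x + b * q x) * s x) = (\<lambda>x. a * (p x * s x) + b * (q x * s x))"
      by (simp add: algebra_simps)
    then show ?thesis
      using square_integrable_mult[OF that(1,3)] square_integrable_mult[OF that(2,3)]
      by (simp only: set_integral_add(2)[OF set_integrable_mult_right set_integrable_mult_right]
          set_integral_mult_right)
  qed
  have "(LINT x:\<Omega>|lebesgue. u x * pd i \<phi> x) = - (LINT x:\<Omega>|lebesgue. g i x * \<phi> x)"
    "(LINT x:\<Omega>|lebesgue. v x * pd i \<phi> x) = - (LINT x:\<Omega>|lebesgue. h i x * \<phi> x)"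
    using u v \<phi> by (auto simp: weak_gradient_def)
  then show "(LINT x:\<Omega>|lebesgue. (a * u x + b * v x) * pd i \<phi> x)
      = - (LINT x:\<Omega>|lebesgue. (a * g i x + b * h i x) * \<phi> x)"
    using lin[OF u(1) v(1) sq(2)] lin[OF gh sq(1)] by simp
qed

lemma H1_lincomb:
  assumes "u \<in> H1 \<Omega>" "v \<in> H1 \<Omega>"
  shows "(\<lambda>x. a * u x + b * v x) \<in> H1 \<Omega>"
  using assms weak_gradient_lincomb square_integrable_lincomb unfolding H1_def by blast

lemma H1_norm_lincomb:
  assumes "u \<in> H1 \<Omega>" "v \<in> H1 \<Omega>"
  shows "H1_norm \<Omega> (\<lambda>x. a * u x + b * v x) \<le> 2 * cmod a * H1_norm \<Omega> u + 2 * cmod b * H1_norm \<Omega> v"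
proof -
  let ?w = "\<lambda>x. a * u x + b * v x"
  have sq: "square_integrable \<Omega> u" "square_integrable \<Omega> v" using assms by (auto simp: H1_def)
  have 1: "H1_norm \<Omega> ?w \<le> 2 * cmod a * sqrt (H1_energy \<Omega> u g) + 2 * cmod b * sqrt (H1_energy \<Omega> v h)"
    if gh: "weak_gradient \<Omega> u g" "weak_gradient \<Omega> v h" for g h
  proof -
    have w: "weak_gradient \<Omega> ?w (\<lambda>i x. a * g i x + b * h i x)"
      by (rule weak_gradient_lincomb[OF sq(1) gh(1) sq(2) gh(2)])
    show ?thesis
      by (rule order_trans[OF H1_norm_le[OF w] H1_energy_lincomb[OF sq gh w]])
  qed
  \<comment> \<open>The infima over the two weak gradients are taken one at a time.\<close>
  have 2: "H1_norm \<Omega> ?w \<le> 2 * cmod a * H1_norm \<Omega> u + 2 * cmod b * sqrt (H1_energy \<Omega> v h)"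
    if "weak_gradient \<Omega> v h" for h
    unfolding H1_norm_energy[of \<Omega> u]
    by (rule affine_Inf_bound) (use assms 1[OF _ that] in \<open>auto simp: H1_def\<close>)
  have "H1_norm \<Omega> ?w \<le> 2 * cmod b * H1_norm \<Omega> v + 2 * cmod a * H1_norm \<Omega> u"
    unfolding H1_norm_energy[of \<Omega> v]
    by (rule affine_Inf_bound) (use assms 2 in \<open>auto simp: H1_def add.commute\<close>)
  then show ?thesis by simp
qed

lemma zero_H1: "0 \<in> H1 \<Omega>"
  by (rule fem_H1[OF fem_zero])

lemma H1_norm_zero: "H1_norm \<Omega> 0 = 0"
proof -
  \<comment> \<open>Zero written as a combination with zero coefficients, so that the bound itself
    is zero.\<close>
  have "H1_norm \<Omega> (\<lambda>x. 0 * 0 x + 0 * 0 x) \<le> 2 * cmod 0 * H1_norm \<Omega> 0 + 2 * cmod 0 * H1_norm \<Omega> 0"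
    by (rule H1_norm_lincomb[OF zero_H1 zero_H1])
  then show ?thesis using H1_norm_nonneg[OF zero_H1] by (simp add: func_zero)
qed

end

subsection \<open>Traces\<close>

text \<open>\<open>measure_of\<close> fixes the sigma-algebra whatever set function it is given, so
  Borel functions can be integrated directly.\<close>

lemma sets_surface_measure: "sets surface_measure = sets borel"
  unfolding surface_measure_def
  using sets.sigma_sets_eq[of "borel :: (real^'a) measure"] by (simp add: sets_measure_of)

context mesh
begin

abbreviation surface_error :: "'d cfun \<Rightarrow> 'd cfun \<Rightarrow> ennreal" where
  "surface_error \<phi> f \<equiv> \<integral>\<^sup>+ x \<in> frontier \<Omega>. ennreal ((cmod (\<phi> x - f x))\<^sup>2) \<partial>surface_measure"

lemma surface_error_lincomb:
  assumes "continuous_on (closure \<Omega>) \<phi>" "continuous_on (closure \<Omega>) \<psi>"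
    and fg[measurable]: "f \<in> borel_measurable borel" "g \<in> borel_measurable borel"
  shows "surface_error (\<lambda>x. a * \<phi> x + b * \<psi> x) (\<lambda>x. a * f x + b * g x)
    \<le> ennreal (2 * (cmod a)\<^sup>2) * surface_error \<phi> f + ennreal (2 * (cmod b)\<^sup>2) * surface_error \<psi> g"
proof -
  have cl: "frontier \<Omega> \<subseteq> closure \<Omega>" by (simp add: frontier_def)
  have meas: "(\<lambda>x. ennreal ((cmod (\<phi> x - f x))\<^sup>2) * indicator (frontier \<Omega>) x) \<in> borel_measurable surface_measure"
    if c: "continuous_on (closure \<Omega>) \<phi>" and [measurable]: "f \<in> borel_measurable borel" for \<phi> f :: "'d cfun"
  proof -
    have [measurable]: "frontier \<Omega> \<in> sets borel" by simp
    \<comment> \<open>\<open>\<phi>\<close> is continuous only up to the boundary and arbitrary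
      elsewhere; cutting it off to the closed boundary makes it Borel.\<close>
    have [measurable]: "(\<lambda>x. indicator (frontier \<Omega>) x *\<^sub>R \<phi> x) \<in> borel_measurable borel"
      by (rule borel_measurable_continuous_on_indicator) (use continuous_on_subset[OF c cl] in simp_all)
    have "(\<lambda>x. ennreal ((cmod (indicator (frontier \<Omega>) x *\<^sub>R \<phi> x - f x))\<^sup>2) * indicator (frontier \<Omega>) x)
        \<in> borel_measurable borel" by measurable
    also have "(\<lambda>x. ennreal ((cmod (indicator (frontier \<Omega>) x *\<^sub>R \<phi> x - f x))\<^sup>2) * indicator (frontier \<Omega>) x)
        = (\<lambda>x. ennreal ((cmod (\<phi> x - f x))\<^sup>2) * indicator (frontier \<Omega>) x)"
      by (auto simp: indicator_def)
    finally show ?thesis using measurable_cong_sets[OF sets_surface_measure refl] by blast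
  qed
  have "surface_error (\<lambda>x. a * \<phi> x + b * \<psi> x) (\<lambda>x. a * f x + b * g x)
    \<le> (\<integral>\<^sup>+x. ennreal (2 * (cmod a)\<^sup>2) * (ennreal ((cmod (\<phi> x - f x))\<^sup>2) * indicator (frontier \<Omega>) x)
        + ennreal (2 * (cmod b)\<^sup>2) * (ennreal ((cmod (\<psi> x - g x))\<^sup>2) * indicator (frontier \<Omega>) x) \<partial>surface_measure)"
  proof (rule nn_integral_mono)
    fix x
    have eq: "a * \<phi> x + b * \<psi> x - (a * f x + b * g x) = a * (\<phi> x - f x) + b * (\<psi> x - g x)"
      by (simp add: algebra_simps)
    have "ennreal ((cmod (a * \<phi> x + b * \<psi> x - (a * f x + b * g x)))\<^sup>2)
        \<le> ennreal (2 * (cmod a)\<^sup>2 * (cmod (\<phi> x - f x))\<^sup>2 + 2 * (cmod b)\<^sup>2 * (cmod (\<psi> x - g x))\<^sup>2)"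
      unfolding eq by (intro ennreal_leI norm_lincomb_square)
    also have "\<dots> = ennreal (2 * (cmod a)\<^sup>2) * ennreal ((cmod (\<phi> x - f x))\<^sup>2)
        + ennreal (2 * (cmod b)\<^sup>2) * ennreal ((cmod (\<psi> x - g x))\<^sup>2)"
      by (simp add: ennreal_mult)
    finally show "ennreal ((cmod (a * \<phi> x + b * \<psi> x - (a * f x + b * g x)))\<^sup>2) * indicator (frontier \<Omega>) x
        \<le> ennreal (2 * (cmod a)\<^sup>2) * (ennreal ((cmod (\<phi> x - f x))\<^sup>2) * indicator (frontier \<Omega>) x)
        + ennreal (2 * (cmod b)\<^sup>2) * (ennreal ((cmod (\<psi> x - g x))\<^sup>2) * indicator (frontier \<Omega>) x)"
      by (simp add: indicator_def)
  qed
  also have "\<dots> = ennreal (2 * (cmod a)\<^sup>2) * surface_error \<phi> f + ennreal (2 * (cmod b)\<^sup>2) * surface_error \<psi> g"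
    using meas[OF assms(1,3)] meas[OF assms(2,4)]
    by (simp add: nn_integral_add nn_integral_cmult borel_measurable_times_ennreal)
  finally show ?thesis .
qed

text \<open>The same combination of the approximating sequences works, both errors being squeezed
  between zero and the combined bounds.\<close>

lemma is_trace_lincomb:
  assumes "is_trace \<Omega> u f" "is_trace \<Omega> v g"
  shows "is_trace \<Omega> (\<lambda>x. a * u x + b * v x) (\<lambda>x. a * f x + b * g x)"
proof -
  obtain \<phi> \<psi> :: "nat \<Rightarrow> 'd cfun" where
    \<phi>: "\<And>n. \<phi> n \<in> H1 \<Omega>" "\<And>n. continuous_on (closure \<Omega>) (\<phi> n)"
      "(\<lambda>n. H1_norm \<Omega> (\<phi> n - u)) \<longlonglongrightarrow> 0" "(\<lambda>n. surface_error (\<phi> n) f) \<longlonglongrightarrow> 0" and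
    \<psi>: "\<And>n. \<psi> n \<in> H1 \<Omega>" "\<And>n. continuous_on (closure \<Omega>) (\<psi> n)"
      "(\<lambda>n. H1_norm \<Omega> (\<psi> n - v)) \<longlonglongrightarrow> 0" "(\<lambda>n. surface_error (\<psi> n) g) \<longlonglongrightarrow> 0"
    using assms unfolding is_trace_def by blast
  have uv: "u \<in> H1 \<Omega>" "v \<in> H1 \<Omega>" and [measurable]: "f \<in> borel_measurable borel" "g \<in> borel_measurable borel"
    and out: "\<And>x. x \<notin> frontier \<Omega> \<Longrightarrow> f x = 0" "\<And>x. x \<notin> frontier \<Omega> \<Longrightarrow> g x = 0"
    using assms by (auto simp: is_trace_def)
  define F where "F n = (\<lambda>x. a * \<phi> n x + b * \<psi> n x)" for n
  have diff: "w - z \<in> H1 \<Omega>" if "w \<in> H1 \<Omega>" "z \<in> H1 \<Omega>" for w z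
    using H1_lincomb[OF that, of 1 "-1"] by (simp add: fun_diff_def)
  have FH1: "F n \<in> H1 \<Omega>" for n unfolding F_def by (intro H1_lincomb \<phi> \<psi>)
  have 1: "(\<lambda>n. H1_norm \<Omega> (F n - (\<lambda>x. a * u x + b * v x))) \<longlonglongrightarrow> 0"
  proof (rule tendsto_sandwich[OF _ _ tendsto_const])
    show "\<forall>\<^sub>F n in sequentially. 0 \<le> H1_norm \<Omega> (F n - (\<lambda>x. a * u x + b * v x))"
      by (intro always_eventually allI H1_norm_nonneg diff FH1 H1_lincomb uv)
    have "F n - (\<lambda>x. a * u x + b * v x) = (\<lambda>x. a * (\<phi> n - u) x + b * (\<psi> n - v) x)" for n
      by (simp add: F_def fun_eq_iff algebra_simps)
    then show "\<forall>\<^sub>F n in sequentially. H1_norm \<Omega> (F n - (\<lambda>x. a * u x + b * v x))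
        \<le> 2 * cmod a * H1_norm \<Omega> (\<phi> n - u) + 2 * cmod b * H1_norm \<Omega> (\<psi> n - v)"
      using H1_norm_lincomb[OF diff[OF \<phi>(1) uv(1)] diff[OF \<psi>(1) uv(2)]] by simp
    have "(\<lambda>n. 2 * cmod a * H1_norm \<Omega> (\<phi> n - u) + 2 * cmod b * H1_norm \<Omega> (\<psi> n - v))
        \<longlonglongrightarrow> 2 * cmod a * 0 + 2 * cmod b * 0"
      by (intro tendsto_add tendsto_mult_left \<phi>(3) \<psi>(3))
    then show "(\<lambda>n. 2 * cmod a * H1_norm \<Omega> (\<phi> n - u) + 2 * cmod b * H1_norm \<Omega> (\<psi> n - v)) \<longlonglongrightarrow> 0"
      by simp
  qed
  have 2: "(\<lambda>n. surface_error (F n) (\<lambda>x. a * f x + b * g x)) \<longlonglongrightarrow> 0"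
  proof (rule tendsto_sandwich[OF _ _ tendsto_const])
    show "\<forall>\<^sub>F n in sequentially. surface_error (F n) (\<lambda>x. a * f x + b * g x)
        \<le> ennreal (2 * (cmod a)\<^sup>2) * surface_error (\<phi> n) f + ennreal (2 * (cmod b)\<^sup>2) * surface_error (\<psi> n) g"
      unfolding F_def by (intro always_eventually allI surface_error_lincomb \<phi> \<psi>) auto
    have "(\<lambda>n. ennreal (2 * (cmod a)\<^sup>2) * surface_error (\<phi> n) f + ennreal (2 * (cmod b)\<^sup>2) * surface_error (\<psi> n) g)
        \<longlonglongrightarrow> ennreal (2 * (cmod a)\<^sup>2) * 0 + ennreal (2 * (cmod b)\<^sup>2) * 0"
      by (intro tendsto_add ennreal_tendsto_cmult \<phi>(4) \<psi>(4)) auto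
    then show "(\<lambda>n. ennreal (2 * (cmod a)\<^sup>2) * surface_error (\<phi> n) f + ennreal (2 * (cmod b)\<^sup>2) * surface_error (\<psi> n) g)
        \<longlonglongrightarrow> 0" by simp
  qed auto
  have 3: "continuous_on (closure \<Omega>) (F n)" for n
    unfolding F_def by (intro continuous_intros \<phi> \<psi>)
  show ?thesis
    unfolding is_trace_def
  proof (intro conjI allI impI exI[of _ F])
    show "(\<lambda>x. a * f x + b * g x) \<in> borel_measurable borel" by measurable
  qed (use H1_lincomb[OF uv] out FH1 1 2 3 in auto)
qed

text \<open>The constant sequence approximates. \<open>f\<close> may differ from \<open>u\<close> on
  a surface null set of the boundary; with \<open>u = 0\<close> this shows that null functions are
  traces of zero.\<close>

lemma is_trace_continuous:
  assumes "u \<in> H1 \<Omega>" "continuous_on (closure \<Omega>) u" "f \<in> borel_measurable borel"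
    "\<And>x. x \<notin> frontier \<Omega> \<Longrightarrow> f x = 0" "AE x in surface_measure. x \<in> frontier \<Omega> \<longrightarrow> f x = u x"
  shows "is_trace \<Omega> u f"
proof -
  have "surface_error u f = (\<integral>\<^sup>+ x. 0 \<partial>(surface_measure :: (real^'d) measure))"
  proof (rule nn_integral_cong_AE)
    show "AE x in surface_measure. ennreal ((cmod (u x - f x))\<^sup>2) * indicator (frontier \<Omega>) x = 0"
      using assms(5) by eventually_elim (auto simp: indicator_def)
  qed
  then have "surface_error u f = 0" by simp
  moreover have "H1_norm \<Omega> (u - u) = 0" using H1_norm_zero by simp
  ultimately show ?thesis
    unfolding is_trace_def using assms(1-4) by (intro conjI exI[of _ "\<lambda>n. u"]) auto
qed

lemma fem_trace:
  assumes "u \<in> fem"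
  shows "restr (frontier \<Omega>) u \<in> H12 \<Omega>"
proof -
  have "frontier \<Omega> \<subseteq> \<Union>\<T>" using closure_\<Omega> by (simp add: frontier_def)
  then have "restr (frontier \<Omega>) u \<in> borel_measurable borel"
    by (intro restr_fem_measurable assms frontier_closed)
  then have "is_trace \<Omega> u (restr (frontier \<Omega>) u)"
    using fem_H1[OF assms] fem_continuous[OF assms] closure_\<Omega>
    by (intro is_trace_continuous) (auto simp: restr_def)
  then show ?thesis by (auto simp: H12_def)
qed

lemma H12_lincomb: "f \<in> H12 \<Omega> \<Longrightarrow> g \<in> H12 \<Omega> \<Longrightarrow> (\<lambda>x. a * f x + b * g x) \<in> H12 \<Omega>"
  unfolding H12_def using is_trace_lincomb by blast

lemma H12_subspace: "cvec.subspace (H12 \<Omega>)"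
proof (rule cvec.subspaceI)
  have "restr (frontier \<Omega>) 0 \<in> H12 \<Omega>" by (rule fem_trace[OF fem_zero])
  then show "0 \<in> H12 \<Omega>" by (simp add: restr_def func_zero)
  show "x + y \<in> H12 \<Omega>" if "x \<in> H12 \<Omega>" "y \<in> H12 \<Omega>" for x y
    using H12_lincomb[OF that, of 1 1] by (simp add: func_plus)
  show "c *\<^sub>C x \<in> H12 \<Omega>" if "x \<in> H12 \<Omega>" for c x
    using H12_lincomb[OF that that, of c 0] by (simp add: scaleC_fun_def scaleC_complex_def)
qed

text \<open>The difference of \<open>f\<close> and \<open>g\<close> is a trace of zero, so its norm
  vanishes and the bound on \<open>q\<close> forces the value zero. This turns linearity of the
  boundary operator up to null sets into exact linearity of its form.\<close>

lemma Hm12_AE_eq: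
  assumes q: "q \<in> Hm12 \<Omega>" and f: "f \<in> H12 \<Omega>" and g: "g \<in> H12 \<Omega>"
    and ae: "AE x in surface_measure. f x = g x"
  shows "q f = q g"
proof -
  have d: "f - g \<in> H12 \<Omega>" using f g H12_subspace by (simp add: cvec.subspace_diff)
  then have meas: "f - g \<in> borel_measurable borel" "\<And>x. x \<notin> frontier \<Omega> \<Longrightarrow> (f - g) x = 0"
    by (auto simp: H12_def is_trace_def)
  have "is_trace \<Omega> 0 (f - g)"
  proof (rule is_trace_continuous[OF zero_H1 _ meas])
    show "continuous_on (closure \<Omega>) (0 :: 'd cfun)" by (simp add: func_zero)
    show "AE x in surface_measure. x \<in> frontier \<Omega> \<longrightarrow> (f - g) x = 0 x"
      using ae by eventually_elim simp
  qed
  then have "0 \<in> {H1_norm \<Omega> u | u. is_trace \<Omega> u (f - g)}" using H1_norm_zero by force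
  then have "H12_norm \<Omega> (f - g) = 0"
    unfolding H12_norm_def
    by (rule cInf_eq_minimum) (auto simp: is_trace_def intro: H1_norm_nonneg)
  moreover obtain C where "cmod (q (f - g)) \<le> C * H12_norm \<Omega> (f - g)"
    using q d by (auto simp: Hm12_def)
  ultimately have "q (f - g) = 0" by simp
  moreover have "clinear_on (H12 \<Omega>) q" using q by (simp add: Hm12_def cdual_def)
  ultimately show ?thesis using clinear_on_diff[OF H12_subspace] f g by fastforce
qed

end

subsection \<open>Finite-dimensional product spaces\<close>

lemma clinearI:
  "(\<And>x y. f (x + y) = f x + f y) \<Longrightarrow> (\<And>c x. f (c *\<^sub>C x) = c *\<^sub>C f x) \<Longrightarrow> clinear f"
  by (auto simp: Vector_Spaces.linear_iff cvec.vector_space_axioms)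

lemma fin_dim_Times:
  assumes "fin_dim A" "fin_dim B"
  shows "fin_dim (A \<times> B)"
proof -
  obtain F G where FG: "finite F" "A \<subseteq> cvec.span F" "finite G" "B \<subseteq> cvec.span G"
    using assms by (auto simp: fin_dim_def)
  have l: "clinear (\<lambda>x. (x, 0 :: 'b))" and r: "clinear (\<lambda>y. (0 :: 'a, y))"
    by (auto intro!: clinearI simp: scaleC_prod_def)
  let ?H = "(\<lambda>x. (x, 0)) ` F \<union> (\<lambda>y. (0, y)) ` G"
  have "(a, b) \<in> cvec.span ?H" if "a \<in> A" "b \<in> B" for a b
  proof -
    have "(a, 0) \<in> cvec.span ?H"
      using cvec_pair.linear_spans_image[OF l FG(2)] that cvec.span_mono[of "(\<lambda>x. (x, 0)) ` F" ?H] by blast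
    moreover have "(0, b) \<in> cvec.span ?H"
      using cvec_pair.linear_spans_image[OF r FG(4)] that cvec.span_mono[of "(\<lambda>y. (0, y)) ` G" ?H] by blast
    ultimately have "(a, 0) + (0, b) \<in> cvec.span ?H" by (rule cvec.span_add)
    then show ?thesis by simp
  qed
  then show ?thesis unfolding fin_dim_def by (intro exI[of _ ?H]) (use FG in auto)
qed

lemma subspace_Times: "cvec.subspace A \<Longrightarrow> cvec.subspace B \<Longrightarrow> cvec.subspace (A \<times> B)"
  by (auto simp: cvec.subspace_def scaleC_prod_def zero_prod_def)

definition families :: "nat \<Rightarrow> (nat \<Rightarrow> 'a::complex_vs set) \<Rightarrow> (nat \<Rightarrow> 'a) set" where
  "families J U = {u. (\<forall>j\<in>{1..J}. u j \<in> U j) \<and> (\<forall>j. j \<notin> {1..J} \<longrightarrow> u j = 0)}"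

lemma subspace_families: "(\<And>j. cvec.subspace (U j)) \<Longrightarrow> cvec.subspace (families J U)"
  by (auto simp: families_def cvec.subspace_def scaleC_fun_def)

lemma fin_dim_families:
  assumes "\<And>j. fin_dim (U j)"
  shows "fin_dim (families J U)"
proof -
  obtain F where F: "\<And>j. finite (F j)" "\<And>j. U j \<subseteq> cvec.span (F j)"
    using assms unfolding fin_dim_def by metis
  define single :: "nat \<Rightarrow> 'a \<Rightarrow> nat \<Rightarrow> 'a" where "single j x = (\<lambda>i. if i = j then x else 0)" for j x
  have lin: "clinear (single j)" for j
    by (auto intro!: clinearI simp: single_def scaleC_fun_def fun_eq_iff)
  let ?H = "\<Union>j\<in>{1..J}. single j ` F j"
  have "u \<in> cvec.span ?H" if u: "u \<in> families J U" for u
  proof -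
    have "single j (u j) \<in> cvec.span ?H" if "j \<in> {1..J}" for j
    proof -
      have "u j \<in> U j" using u that by (simp add: families_def)
      then have "single j (u j) \<in> cvec.span (single j ` F j)"
        using cvec_pair.linear_spans_image[OF lin F(2)] by blast
      then show ?thesis using cvec.span_mono[of "single j ` F j" ?H] that by blast
    qed
    then have "(\<Sum>j\<in>{1..J}. single j (u j)) \<in> cvec.span ?H" by (rule cvec.span_sum)
    moreover have "(\<Sum>j\<in>{1..J}. single j (u j)) = u"
      using u by (auto simp: sum_fun_apply single_def families_def fun_eq_iff)
    ultimately show ?thesis by simp
  qed
  then show ?thesis unfolding fin_dim_def by (intro exI[of _ ?H]) (use F in auto)
qed

subsection \<open>Restrictions and conjugates\<close>

lemma clinear_restr: "clinear (restr \<Theta>)"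
  by (auto intro!: clinearI simp: restr_def scaleC_fun_def scaleC_complex_def fun_eq_iff)

lemma restr_restr: "\<Theta>' \<subseteq> \<Theta> \<Longrightarrow> restr \<Theta>' (restr \<Theta> u) = restr \<Theta>' u"
  by (auto simp: restr_def fun_eq_iff)

lemma restr_cnj: "restr \<Theta> (fun_cnj u) = fun_cnj (restr \<Theta> u)"
  by (auto simp: restr_def fun_cnj_def)

lemma fun_cnj_involutive: "fun_cnj (fun_cnj u) = u"
  by (simp add: fun_cnj_def)

lemma fun_cnj_zero: "fun_cnj 0 = 0"
  by (simp add: fun_cnj_def func_zero)

lemma distr_cnj_involutive: "distr_cnj (distr_cnj q) = q"
  by (simp add: distr_cnj_def fun_cnj_involutive)

lemma restr_Vh: "u \<in> Vh \<T> k \<Theta> \<Longrightarrow> \<Theta>' \<subseteq> \<Theta> \<Longrightarrow> restr \<Theta>' u \<in> Vh \<T> k \<Theta>'"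
  unfolding Vh_def by (auto simp: restr_restr)

context mesh
begin

lemma Vh_subspace: "cvec.subspace (Vh \<T> k \<Theta>)"
  unfolding Vh_def by (rule cvec_pair.linear_subspace_image[OF clinear_restr fem_subspace])

lemma Vh_fin_dim: "fin_dim (Vh \<T> k \<Theta>)"
  unfolding Vh_def by (rule fin_dim_image[OF fem_fin_dim clinear_restr])

lemma Vh_cnj: "u \<in> Vh \<T> k \<Theta> \<Longrightarrow> fun_cnj u \<in> Vh \<T> k \<Theta>"
  unfolding Vh_def using fem_cnj by (auto simp: restr_cnj[symmetric])

lemma Vh_frontier_H12: "Vh \<T> k (frontier \<Omega>) \<subseteq> H12 \<Omega>"
  unfolding Vh_def using fem_trace by blast

end

subsection \<open>The volume form\<close>

abbreviation volume_integrand :: "'d::finite cfun \<Rightarrow> 'd cfun \<Rightarrow> 'd cfun \<Rightarrow> 'd cfun" where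
  "volume_integrand \<kappa> u v \<equiv> (\<lambda>x. (\<Sum>i\<in>UNIV. pd i u x * pd i v x) - (\<kappa> x)\<^sup>2 * u x * v x)"

text \<open>Discrete functions are cut off to closed sets and may jump at the frontier. On the open
  set their values and derivatives are those of a global finite element function, with which every
  form can be computed.\<close>

lemma volume_form_cong:
  assumes "open \<omega>" "\<And>x. x \<in> \<omega> \<Longrightarrow> u x = u' x" "\<And>x. x \<in> \<omega> \<Longrightarrow> v x = v' x"
  shows "volume_form \<kappa> \<omega> u v = volume_form \<kappa> \<omega> u' v'"
proof -
  have "(\<lambda>x. indicator \<omega> x *\<^sub>R volume_integrand \<kappa> u v x) = (\<lambda>x. indicator \<omega> x *\<^sub>R volume_integrand \<kappa> u' v' x)"
  proof
    fix x
    show "indicator \<omega> x *\<^sub>R volume_integrand \<kappa> u v x = indicator \<omega> x *\<^sub>R volume_integrand \<kappa> u' v' x"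
      using assms pd_cong_open[OF assms(1) _ assms(2), of x] pd_cong_open[OF assms(1) _ assms(3), of x]
      by (cases "x \<in> \<omega>") auto
  qed
  then show ?thesis by (simp add: volume_form_def set_lebesgue_integral_def)
qed

lemma volume_form_commute: "volume_form \<kappa> \<omega> u v = volume_form \<kappa> \<omega> v u"
  by (simp add: volume_form_def mult.commute mult.left_commute)

locale helmholtz_mesh = mesh \<T> \<Omega> k for \<T> :: "(real^'d::finite) set set" and \<Omega> k +
  fixes \<kappa> :: "'d cfun"
  assumes \<kappa>_meas: "\<kappa> \<in> borel_measurable lebesgue"
    and \<kappa>_bdd: "\<exists>C. AE x in lebesgue. cmod (\<kappa> x) \<le> C"
    and \<kappa>_Im: "\<And>x. x \<in> \<Omega> \<Longrightarrow> 0 \<le> Im ((\<kappa> x)\<^sup>2)"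
begin

lemma integrand_bounded_meas:
  assumes "u \<in> fem" "v \<in> fem"
  shows "bounded_meas (volume_integrand \<kappa> u v)"
proof -
  have \<kappa>: "bounded_meas \<kappa>" using \<kappa>_meas \<kappa>_bdd by (simp add: bounded_meas_def)
  show ?thesis
    unfolding power2_eq_square
    by (intro bounded_meas_diff bounded_meas_sum bounded_meas_mult \<kappa> fem_bounded_meas[OF assms(1)]
        fem_bounded_meas[OF assms(2)] fem_pd_bounded_meas[OF assms(1)] fem_pd_bounded_meas[OF assms(2)])
qed

lemma integrand_integrable:
  assumes "u \<in> fem" "v \<in> fem" "open \<omega>" "\<omega> \<subseteq> \<Omega>"
  shows "set_integrable lebesgue \<omega> (volume_integrand \<kappa> u v)"
  by (rule bounded_meas_set_integrable[OF integrand_bounded_meas[OF assms(1,2)]])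
    (use assms bounded_\<Omega> bounded_subset in auto)

text \<open>Derivatives add up only where they exist, so the integrands are compared almost
  everywhere; splitting the integral then uses the integrability of both parts.\<close>

lemma volume_form_fem_lincomb:
  assumes "u \<in> fem" "u' \<in> fem" "v \<in> fem" "open \<omega>" "\<omega> \<subseteq> \<Omega>"
  shows "volume_form \<kappa> \<omega> (\<lambda>x. a * u x + b * u' x) v = a * volume_form \<kappa> \<omega> u v + b * volume_form \<kappa> \<omega> u' v"
proof -
  let ?w = "\<lambda>x. a * u x + b * u' x"
  have pd: "AE x in lebesgue. pd i ?w x = a * pd i u x + b * pd i u' x" for i
    using fem_AE_has_pd[OF assms(1), of i] fem_AE_has_pd[OF assms(2), of i]
    by eventually_elim (intro has_pd_eq has_pd_add has_pd_cmult)
  have "AE x in lebesgue. \<forall>i\<in>UNIV. pd i ?w x = a * pd i u x + b * pd i u' x"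
    by (rule AE_finite_allI) (use pd in auto)
  then have ae: "AE x in lebesgue. x \<in> \<omega> \<longrightarrow> volume_integrand \<kappa> ?w v x
      = a * volume_integrand \<kappa> u v x + b * volume_integrand \<kappa> u' v x"
    by eventually_elim (simp add: algebra_simps sum.distrib sum_distrib_left)
  have w: "?w \<in> fem" by (rule fem_lincomb[OF assms(1,2)])
  note bm = integrand_bounded_meas[OF assms(1,3)] integrand_bounded_meas[OF assms(2,3)]
  note int = integrand_integrable[OF assms(1,3-5)] integrand_integrable[OF assms(2-5)]
  have "volume_form \<kappa> \<omega> ?w v
      = (LINT x:\<omega>|lebesgue. a * volume_integrand \<kappa> u v x + b * volume_integrand \<kappa> u' v x)"
    unfolding volume_form_def
    by (rule set_lebesgue_integral_cong_AE[OF _ _ _ ae])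
      (use assms(4) bounded_meas_measurable[OF integrand_bounded_meas[OF w assms(3)]]
        bounded_meas_measurable[OF bounded_meas_add[OF bounded_meas_mult[OF bounded_meas_const[of a] bm(1)]
            bounded_meas_mult[OF bounded_meas_const[of b] bm(2)]]] in auto)
  also have "\<dots> = a * volume_form \<kappa> \<omega> u v + b * volume_form \<kappa> \<omega> u' v"
    unfolding volume_form_def
    by (subst set_integral_add(2)[OF set_integrable_mult_right[OF int(1)] set_integrable_mult_right[OF int(2)]])
      (simp only: set_integral_mult_right)
  finally show ?thesis .
qed

lemma volume_form_lincomb:
  assumes "u \<in> Vh \<T> k \<Theta>" "u' \<in> Vh \<T> k \<Theta>" "v \<in> Vh \<T> k \<Theta>" "open \<omega>" "\<omega> \<subseteq> \<Omega>" "\<omega> \<subseteq> \<Theta>"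
  shows "volume_form \<kappa> \<omega> (a *\<^sub>C u + b *\<^sub>C u') v = a * volume_form \<kappa> \<omega> u v + b * volume_form \<kappa> \<omega> u' v"
proof -
  obtain U U' W where U: "U \<in> fem" "u = restr \<Theta> U" and U': "U' \<in> fem" "u' = restr \<Theta> U'"
    and W: "W \<in> fem" "v = restr \<Theta> W"
    using assms(1-3) by (auto simp: Vh_def)
  have "volume_form \<kappa> \<omega> (a *\<^sub>C u + b *\<^sub>C u') v = volume_form \<kappa> \<omega> (\<lambda>x. a * U x + b * U' x) W"
    "volume_form \<kappa> \<omega> u v = volume_form \<kappa> \<omega> U W" "volume_form \<kappa> \<omega> u' v = volume_form \<kappa> \<omega> U' W"
    using assms(6) U U' W
    by (auto intro!: volume_form_cong[OF assms(4)] simp: restr_def scaleC_fun_def scaleC_complex_def)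
  then show ?thesis using volume_form_fem_lincomb[OF U(1) U'(1) W(1) assms(4,5)] by simp
qed

text \<open>Tested with the conjugate, the gradient term is real, and what remains of the imaginary
  part of the integrand is minus \<open>Im ((\<kappa> x)\<^sup>2)\<close> times the squared modulus
  of the function.\<close>

lemma Im_volume_form_cnj:
  assumes "u \<in> Vh \<T> k \<Theta>" "open \<omega>" "\<omega> \<subseteq> \<Omega>" "\<omega> \<subseteq> \<Theta>"
  shows "Im (volume_form \<kappa> \<omega> u (fun_cnj u)) \<le> 0"
proof -
  obtain U where U: "U \<in> fem" "u = restr \<Theta> U" using assms(1) by (auto simp: Vh_def)
  have pd: "AE x in lebesgue. pd i (fun_cnj U) x = cnj (pd i U x)" for i
    using fem_AE_has_pd[OF U(1), of i] unfolding fun_cnj_def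
    by eventually_elim (intro has_pd_eq has_pd_cnj)
  have "AE x in lebesgue. \<forall>i\<in>UNIV. pd i (fun_cnj U) x = cnj (pd i U x)"
    by (rule AE_finite_allI) (use pd in auto)
  then have ae: "AE x in lebesgue. Im (indicator \<omega> x *\<^sub>R volume_integrand \<kappa> U (fun_cnj U) x) \<le> 0"
  proof eventually_elim
    case (elim x)
    have "Im ((\<kappa> x)\<^sup>2 * U x * fun_cnj U x) = Im ((\<kappa> x)\<^sup>2) * (cmod (U x))\<^sup>2"
      by (simp add: fun_cnj_def mult.assoc complex_mult_cnj cmod_power2 flip: of_real_power of_real_add)
    moreover have "Im (\<Sum>i\<in>UNIV. pd i U x * pd i (fun_cnj U) x) = 0"
      using elim by (simp add: complex_mult_cnj)
    ultimately show ?case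
      using \<kappa>_Im[of x] assms(3) by (cases "x \<in> \<omega>") auto
  qed
  have int: "integrable lebesgue (\<lambda>x. indicator \<omega> x *\<^sub>R volume_integrand \<kappa> U (fun_cnj U) x)"
    using integrand_integrable[OF U(1) fem_cnj[OF U(1)] assms(2,3)] by (simp add: set_integrable_def)
  have "volume_form \<kappa> \<omega> u (fun_cnj u) = volume_form \<kappa> \<omega> U (fun_cnj U)"
    using assms(4) U by (intro volume_form_cong assms) (auto simp: restr_def fun_cnj_def)
  then have "Im (volume_form \<kappa> \<omega> u (fun_cnj u))
      = Im (LINT x|lebesgue. indicator \<omega> x *\<^sub>R volume_integrand \<kappa> U (fun_cnj U) x)"
    by (simp add: volume_form_def set_lebesgue_integral_def)
  also have "\<dots> = (LINT x|lebesgue. Im (indicator \<omega> x *\<^sub>R volume_integrand \<kappa> U (fun_cnj U) x))"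
    using integral_bounded_linear[OF bounded_linear_Im int] by simp
  also have "\<dots> \<le> (LINT x|(lebesgue :: (real^'d) measure). 0)"
    using integrable_bounded_linear[OF bounded_linear_Im int] ae
    by (intro integral_mono_AE) simp_all
  finally show ?thesis by simp
qed

end

subsection \<open>The boundary form\<close>

lemma bpair_alt: "bpair y z = fst y (fst z) + snd z (snd y)"
  by (cases y; cases z) simp

context mesh
begin

lemma bpair_bnd_eq:
  assumes "bnd_eq y z" "snd y \<in> H12 \<Omega>" "snd z \<in> H12 \<Omega>" "snd b \<in> Hm12 \<Omega>"
  shows "bpair y b = bpair z b"
  using assms Hm12_AE_eq[OF assms(4,2,3)] by (simp add: bpair_alt bnd_eq_def)

lemma Hm12_lin: "q \<in> Hm12 \<Omega> \<Longrightarrow> clinear_on (H12 \<Omega>) q"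
  by (simp add: Hm12_def cdual_def)

text \<open>\<open>\<A>\<close> is linear up to \<open>bnd_eq\<close>, and \<open>bpair\<close> does
  not see that difference once the tested functional is bounded.\<close>

lemma bpair_left_linear:
  assumes \<A>: "bounded_boundary_op \<Omega> \<A>" and x: "x \<in> H12 \<Omega> \<times> Hm12 \<Omega>" and y: "y \<in> H12 \<Omega> \<times> Hm12 \<Omega>"
    and b: "snd b \<in> Hm12 \<Omega>"
  shows "x + y \<in> H12 \<Omega> \<times> Hm12 \<Omega> \<Longrightarrow> bpair (\<A> (x + y)) b = bpair (\<A> x) b + bpair (\<A> y) b"
    and "c *\<^sub>C x \<in> H12 \<Omega> \<times> Hm12 \<Omega> \<Longrightarrow> bpair (\<A> (c *\<^sub>C x)) b = c * bpair (\<A> x) b"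
proof -
  have maps: "snd (\<A> z) \<in> H12 \<Omega>" if "z \<in> H12 \<Omega> \<times> Hm12 \<Omega>" for z
    using \<A> that unfolding bounded_boundary_op_def by (metis mem_Times_iff)
  have eqs: "bnd_eq (\<A> (x + y)) (\<A> x + \<A> y)" "bnd_eq (\<A> (c *\<^sub>C x)) (c *\<^sub>C \<A> x)"
    using \<A> x y unfolding bounded_boundary_op_def by blast+
  note q = clinear_onD[OF Hm12_lin[OF b]]
  show "bpair (\<A> (x + y)) b = bpair (\<A> x) b + bpair (\<A> y) b" if "x + y \<in> H12 \<Omega> \<times> Hm12 \<Omega>"
  proof -
    have "snd (\<A> x + \<A> y) \<in> H12 \<Omega>" using maps[OF x] maps[OF y] H12_subspace by (simp add: cvec.subspace_add)
    from bpair_bnd_eq[OF eqs(1) maps[OF that] this b]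
    have "bpair (\<A> (x + y)) b = bpair (\<A> x + \<A> y) b" .
    then show ?thesis using q(1)[OF maps[OF x] maps[OF y]] by (simp add: bpair_alt)
  qed
  show "bpair (\<A> (c *\<^sub>C x)) b = c * bpair (\<A> x) b" if "c *\<^sub>C x \<in> H12 \<Omega> \<times> Hm12 \<Omega>"
  proof -
    have "snd (c *\<^sub>C \<A> x) \<in> H12 \<Omega>" using maps[OF x] H12_subspace by (simp add: scaleC_prod_def cvec.subspace_scale)
    from bpair_bnd_eq[OF eqs(2) maps[OF that] this b]
    have "bpair (\<A> (c *\<^sub>C x)) b = bpair (c *\<^sub>C \<A> x) b" .
    then show ?thesis using q(2)[OF maps[OF x], of c]
      by (simp add: bpair_alt scaleC_prod_def scaleC_fun_def scaleC_complex_def distrib_left)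
  qed
qed

lemma bpair_right_linear:
  assumes \<A>: "bounded_boundary_op \<Omega> \<A>" and x: "x \<in> H12 \<Omega> \<times> Hm12 \<Omega>"
    and b: "fst b \<in> H12 \<Omega>" "fst b' \<in> H12 \<Omega>"
  shows "bpair (\<A> x) (b + b') = bpair (\<A> x) b + bpair (\<A> x) b'"
    and "bpair (\<A> x) (c *\<^sub>C b) = c * bpair (\<A> x) b"
proof -
  have "fst (\<A> x) \<in> Hm12 \<Omega>" using \<A> x unfolding bounded_boundary_op_def by (metis mem_Times_iff)
  note q = clinear_onD[OF Hm12_lin[OF this]]
  show "bpair (\<A> x) (b + b') = bpair (\<A> x) b + bpair (\<A> x) b'"
    "bpair (\<A> x) (c *\<^sub>C b) = c * bpair (\<A> x) b"
    using q(1)[OF b] q(2)[OF b(1), of c]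
    by (simp_all add: bpair_alt scaleC_prod_def scaleC_fun_def scaleC_complex_def distrib_left)
qed

end

subsection \<open>Domain decomposition\<close>

lemma frontier_subset_closure: "frontier S \<subseteq> closure S"
  by (auto simp: frontier_def)

locale domain_decomposition = helmholtz_mesh \<T> \<Omega> k \<kappa>
  for \<T> :: "(real^'d::finite) set set" and \<Omega> k \<kappa> +
  fixes \<A> :: "'d cfun \<times> 'd cdistr \<Rightarrow> 'd cdistr \<times> 'd cfun" and Q :: "'d cdistr set"
    and J :: nat and \<omega> :: "nat \<Rightarrow> (real^'d) set"
  assumes boundary_op: "bounded_boundary_op \<Omega> \<A>"
    and Q: "Q \<subseteq> Hm12 \<Omega>" "cvec.subspace Q" "\<exists>F. finite F \<and> Q = cvec.span F"
    and polyhedral: "\<And>j. j \<in> {1..J} \<Longrightarrow> polyhedral_union \<T> (\<omega> j)"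
    and disjoint: "disjoint_family_on \<omega> {1..J}"
    and cover: "closure \<Omega> = (\<Union>j\<in>{1..J}. closure (\<omega> j))"
begin

abbreviation "V \<equiv> VV_vol \<T> k \<Omega> Q J \<omega>"
abbreviation "W \<equiv> VV_tr \<T> k \<Omega> J \<omega>"
abbreviation "X \<equiv> Vh \<T> k (skeleton \<Omega> J \<omega>)"
abbreviation "A \<equiv> A_multi \<T> k \<Omega> Q J \<omega> \<kappa> \<A>"
abbreviation "B \<equiv> trace_B J \<omega>"
abbreviation "R \<equiv> restriction_R \<Omega> J \<omega>"
abbreviation "\<Gamma> \<equiv> frontier \<Omega>"

subsubsection \<open>Geometry of the partition\<close>

lemma subdomain_cells:
  assumes "j \<in> {1..J}"
  obtains \<S> where "\<S> \<subseteq> \<T>" "\<omega> j = interior (\<Union>\<S>)" "closure (\<omega> j) = \<Union>\<S>"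
  using polyhedral[OF assms] closure_interior_union unfolding polyhedral_union_def by metis

lemma open_subdomain: "j \<in> {1..J} \<Longrightarrow> open (\<omega> j)"
  using subdomain_cells by (metis open_interior)

lemma subdomain_subset: "j \<in> {1..J} \<Longrightarrow> \<omega> j \<subseteq> \<Omega>"
  using subdomain_cells unfolding \<Omega> by (metis Union_mono interior_mono)

lemma closure_subdomain_subset: "j \<in> {1..J} \<Longrightarrow> closure (\<omega> j) \<subseteq> \<Union>\<T>"
  using cover closure_\<Omega> by blast

lemma cells_cover: "\<Union>\<T> = (\<Union>j\<in>{1..J}. closure (\<omega> j))"
  using cover closure_\<Omega> by simp

text \<open>An interior point of \<open>K\<close> lies in some cell \<open>K'\<close> of a
  subdomain. The intersection of \<open>K\<close> and \<open>K'\<close> is a face of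
  \<open>K\<close> that meets its interior, hence all of \<open>K\<close>.\<close>

lemma cell_in_subdomain:
  assumes K: "K \<in> \<T>"
  obtains j where "j \<in> {1..J}" "K \<subseteq> closure (\<omega> j)"
proof -
  obtain x where x: "x \<in> interior K" using interior_cell_ne[OF K] by blast
  then have "x \<in> \<Union>\<T>" using interior_subset K by blast
  then obtain j where j: "j \<in> {1..J}" "x \<in> closure (\<omega> j)" using cells_cover by blast
  obtain \<S> where \<S>: "\<S> \<subseteq> \<T>" "closure (\<omega> j) = \<Union>\<S>" by (rule subdomain_cells[OF j(1)])
  then obtain K' where K': "K' \<in> \<S>" "x \<in> K'" using j by blast
  have "(K \<inter> K') face_of K" using cell_face K K' \<S> by blast
  moreover have "(K \<inter> K') \<inter> interior K \<noteq> {}" using x K' interior_subset by blast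
  ultimately have "K \<inter> K' = K" using face_of_disjoint_interior by blast
  then show ?thesis using that j(1) K' \<S> by blast
qed

text \<open>An open set disjoint from another set misses its closure too. Thus functions on
  different subdomains have to match only on frontiers, where the traces control them.\<close>

lemma closures_meet:
  assumes "i \<in> {1..J}" "j \<in> {1..J}" "i \<noteq> j" "x \<in> closure (\<omega> i)" "x \<in> closure (\<omega> j)"
  shows "x \<in> frontier (\<omega> i)"
proof -
  have "\<omega> i \<inter> \<omega> j = {}" using disjoint assms by (auto simp: disjoint_family_on_def)
  then have "\<omega> i \<inter> closure (\<omega> j) = {}"
    using open_Int_closure_eq_empty[OF open_subdomain[OF assms(1)]] by blast
  then show ?thesis
    using assms open_subdomain[OF assms(1)] by (auto simp: frontier_def interior_open)
qed

lemma boundary_meets_frontier: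
  assumes "x \<in> \<Gamma>" "j \<in> {1..J}" "x \<in> closure (\<omega> j)"
  shows "x \<in> frontier (\<omega> j)"
proof -
  have "x \<notin> \<Omega>" using assms(1) open_\<Omega> by (simp add: frontier_def interior_open)
  then show ?thesis using assms subdomain_subset[OF assms(2)] open_subdomain[OF assms(2)]
    by (auto simp: frontier_def interior_open)
qed

text \<open>Off the interfaces a point of \<open>\<Omega>\<close> is interior to a cell of a
  subdomain, hence lies in that open subdomain and, by disjointness, in no other.\<close>

lemma AE_indicator_\<Omega>:
  "AE x in lebesgue. indicator \<Omega> x = (\<Sum>j\<in>{1..J}. indicator (\<omega> j) x :: real)"
  using AE_interfaces
proof eventually_elim
  case (elim x)
  show ?case
  proof (cases "x \<in> \<Omega>")
    case True
    then have "x \<in> closure \<Omega>" using closure_subset by blast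
    then obtain j where j: "j \<in> {1..J}" "x \<in> closure (\<omega> j)" using cover by blast
    obtain \<S> where \<S>: "\<S> \<subseteq> \<T>" "\<omega> j = interior (\<Union>\<S>)" "closure (\<omega> j) = \<Union>\<S>"
      by (rule subdomain_cells[OF j(1)])
    then obtain K where K: "K \<in> \<S>" "x \<in> K" using j by blast
    then have "x \<in> interior K" using in_interior_cell elim \<S> by blast
    then have xj: "x \<in> \<omega> j" unfolding \<S>(2) using K interior_mono[of K "\<Union>\<S>"] by blast
    have "indicator (\<omega> i) x = (if i = j then 1 else 0 :: real)" if "i \<in> {1..J}" for i
      using disjoint_family_onD[OF disjoint that j(1)] xj by (auto simp: indicator_def)
    then show ?thesis using True j(1) by simp
  next
    case False
    then have "indicator (\<omega> i) x = (0 :: real)" if "i \<in> {1..J}" for i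
      using subdomain_subset[OF that] by (auto simp: indicator_def)
    then show ?thesis using False by simp
  qed
qed

lemma volume_form_decompose:
  assumes "u \<in> fem" "v \<in> fem"
  shows "volume_form \<kappa> \<Omega> u v = (\<Sum>j\<in>{1..J}. volume_form \<kappa> (\<omega> j) u v)"
proof -
  let ?f = "volume_integrand \<kappa> u v"
  have int: "integrable lebesgue (\<lambda>x. indicator (\<omega> j) x *\<^sub>R ?f x)" if "j \<in> {1..J}" for j
    using integrand_integrable[OF assms open_subdomain[OF that] subdomain_subset[OF that]]
    by (simp add: set_integrable_def)
  have int\<Omega>: "integrable lebesgue (\<lambda>x. indicator \<Omega> x *\<^sub>R ?f x)"
    using integrand_integrable[OF assms open_\<Omega>] by (simp add: set_integrable_def)
  have intS: "integrable lebesgue (\<lambda>x. \<Sum>j\<in>{1..J}. indicator (\<omega> j) x *\<^sub>R ?f x)"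
    by (rule Bochner_Integration.integrable_sum) (rule int)
  have "volume_form \<kappa> \<Omega> u v = (LINT x|lebesgue. indicator \<Omega> x *\<^sub>R ?f x)"
    by (simp add: volume_form_def set_lebesgue_integral_def)
  also have "\<dots> = (LINT x|lebesgue. (\<Sum>j\<in>{1..J}. indicator (\<omega> j) x *\<^sub>R ?f x))"
  proof (rule integral_cong_AE)
    show "AE x in lebesgue. indicator \<Omega> x *\<^sub>R ?f x = (\<Sum>j\<in>{1..J}. indicator (\<omega> j) x *\<^sub>R ?f x)"
      using AE_indicator_\<Omega> by eventually_elim (simp only: scaleR_left.sum)
  qed (use int\<Omega> intS in \<open>auto dest: borel_measurable_integrable\<close>)
  also have "\<dots> = (\<Sum>j\<in>{1..J}. (LINT x|lebesgue. indicator (\<omega> j) x *\<^sub>R ?f x))"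
    by (rule Bochner_Integration.integral_sum) (rule int)
  finally show ?thesis by (simp add: volume_form_def set_lebesgue_integral_def)
qed

subsubsection \<open>The multi-domain spaces and operators\<close>

lemma V_eq: "V = (Vh \<T> k \<Gamma> \<times> Q) \<times> families J (\<lambda>j. Vh \<T> k (closure (\<omega> j)))"
  by (simp add: VV_vol_def Vh_b_def families_def)

lemma W_eq: "W = Vh \<T> k \<Gamma> \<times> families J (\<lambda>j. Vh \<T> k (frontier (\<omega> j)))"
  by (simp add: VV_tr_def families_def)

lemma Q_fin_dim: "fin_dim Q"
  using Q(3) by (auto simp: fin_dim_def)

lemma V_subspace: "cvec.subspace V"
  unfolding V_eq by (intro subspace_Times subspace_families Vh_subspace Q)

lemma V_fin_dim: "fin_dim V"
  unfolding V_eq by (intro fin_dim_Times fin_dim_families Vh_fin_dim Q_fin_dim)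

lemma W_subspace: "cvec.subspace W"
  unfolding W_eq by (intro subspace_Times subspace_families Vh_subspace)

lemma B_apply: "B U = (fst (fst U), \<lambda>j. if j \<in> {1..J} then restr (frontier (\<omega> j)) (snd U j) else 0)"
  by (cases U rule: prod.exhaust[case_product prod.exhaust]) (auto simp: trace_B_def split: prod.splits)

lemma clinear_B: "clinear B"
  by (rule clinearI) (auto simp: B_apply scaleC_prod_def scaleC_fun_def scaleC_complex_def
      restr_def fun_eq_iff)

lemma clinear_R: "clinear R"
  by (rule clinearI) (auto simp: restriction_R_def scaleC_prod_def scaleC_fun_def scaleC_complex_def
      restr_def fun_eq_iff)

lemma B_image: "B ` V = W"
proof (intro antisym subsetI)
  fix w assume "w \<in> B ` V"
  then obtain U where U: "U \<in> V" "w = B U" by blast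
  then show "w \<in> W"
    by (auto simp: V_eq W_eq families_def B_apply intro!: restr_Vh[OF _ frontier_subset_closure])
next
  fix w assume w: "w \<in> W"
  then have "\<forall>j\<in>{1..J}. snd w j \<in> Vh \<T> k (frontier (\<omega> j))"
    by (auto simp: W_eq families_def)
  then have "\<forall>j\<in>{1..J}. \<exists>f\<in>fem. snd w j = restr (frontier (\<omega> j)) f"
    unfolding Vh_def by blast
  then obtain f where f: "\<And>j. j \<in> {1..J} \<Longrightarrow> f j \<in> fem" "\<And>j. j \<in> {1..J} \<Longrightarrow> snd w j = restr (frontier (\<omega> j)) (f j)"
    by metis
  \<comment> \<open>The components are independent, so each is lifted separately; the boundary
    functional is invisible to \<open>B\<close> and set to zero.\<close>
  define U where "U = ((fst w, 0 :: 'd cdistr), \<lambda>j. if j \<in> {1..J} then restr (closure (\<omega> j)) (f j) else 0)"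
  have "U \<in> V" using w f cvec.subspace_0[OF Q(2)] by (auto simp: U_def V_eq W_eq families_def Vh_def)
  moreover have "B U = w"
    using w f by (auto simp: U_def B_apply W_eq families_def restr_restr[OF frontier_subset_closure]
        fun_eq_iff prod_eq_iff)
  ultimately show "w \<in> B ` V" by blast
qed

lemma frontier_skeleton: "\<Gamma> \<subseteq> skeleton \<Omega> J \<omega>" "j \<in> {1..J} \<Longrightarrow> frontier (\<omega> j) \<subseteq> skeleton \<Omega> J \<omega>"
  by (auto simp: skeleton_def)

lemma R_image: "R ` X \<subseteq> W"
proof
  fix w assume "w \<in> R ` X"
  then obtain x where x: "x \<in> X" "w = R x" by blast
  have "restr (frontier (\<omega> j)) x \<in> Vh \<T> k (frontier (\<omega> j))" if "j \<in> {1..J}" for j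
    by (rule restr_Vh[OF x(1) frontier_skeleton(2)[OF that]])
  then show "w \<in> W"
    using restr_Vh[OF x(1) frontier_skeleton(1)] by (simp add: x(2) restriction_R_def W_eq families_def)
qed

lemma R_inj:
  assumes x: "x \<in> X" "R x = 0"
  shows "x = 0"
proof
  fix y
  have j0: "restr (frontier (\<omega> j)) x = 0" if "j \<in> {1..J}" for j
  proof -
    have "snd (R x) j = 0" using x(2) by simp
    then show ?thesis using that by (simp add: restriction_R_def)
  qed
  have \<Gamma>0: "restr \<Gamma> x = 0" using x(2) by (simp add: restriction_R_def zero_prod_def)
  show "x y = 0 y"
  proof (cases "y \<in> skeleton \<Omega> J \<omega>")
    case True
    then consider "y \<in> \<Gamma>" | j where "j \<in> {1..J}" "y \<in> frontier (\<omega> j)"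
      by (auto simp: skeleton_def)
    then show ?thesis
    proof cases
      case 1
      then show ?thesis using fun_cong[OF \<Gamma>0, of y] by (simp add: restr_def)
    next
      case 2
      then show ?thesis using fun_cong[OF j0[OF 2(1)], of y] by (simp add: restr_def)
    qed
  next
    case False
    then show ?thesis using x(1) by (auto simp: Vh_def restr_def)
  qed
qed

lemma mtr_cnj_R: "mtr_cnj (R x) = R (fun_cnj x)"
  by (auto simp: mtr_cnj_def restriction_R_def restr_cnj fun_cnj_zero)

lemma mtr_cnj_W: "w \<in> W \<Longrightarrow> mtr_cnj w \<in> W"
  by (auto simp: mtr_cnj_def W_eq families_def Vh_cnj fun_cnj_zero)

text \<open>The conjugation of the energy argument. It also conjugates the boundary functional, so
  its action on \<open>V\<close> rests on the stability of \<open>Q\<close>.\<close>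

definition vol_cnj :: "'d mvol \<Rightarrow> 'd mvol" where
  "vol_cnj = (\<lambda>((v, q), u). ((fun_cnj v, distr_cnj q), \<lambda>j. fun_cnj (u j)))"

lemma vol_cnj_involutive: "vol_cnj (vol_cnj U) = U"
  by (auto simp: vol_cnj_def fun_cnj_involutive distr_cnj_involutive split: prod.splits)

lemma vol_cnj_V: "\<forall>q\<in>Q. distr_cnj q \<in> Q \<Longrightarrow> U \<in> V \<Longrightarrow> vol_cnj U \<in> V"
  by (auto simp: vol_cnj_def V_eq families_def Vh_cnj fun_cnj_zero)

lemma B_vol_cnj: "B (vol_cnj U) = mtr_cnj (B U)"
  by (auto simp: vol_cnj_def mtr_cnj_def B_apply restr_cnj fun_cnj_zero split: prod.splits)

lemma mtr_cnj_zero: "mtr_cnj 0 = 0"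
  by (simp add: mtr_cnj_def zero_prod_def fun_cnj_zero func_zero[where 'a=nat])

lemma A_apply: "U' \<in> V \<Longrightarrow> A U U' = bpair (\<A> (fst U)) (fst U')
    + (\<Sum>j\<in>{1..J}. volume_form \<kappa> (\<omega> j) (snd U j) (snd U' j))"
  by (cases U; cases U') (simp add: A_multi_def)

lemma A_outside: "U' \<notin> V \<Longrightarrow> A U U' = 0"
  by (cases U; cases U') (simp add: A_multi_def)

lemma boundary_part: "U \<in> V \<Longrightarrow> fst U \<in> H12 \<Omega> \<times> Hm12 \<Omega>"
  using Vh_frontier_H12 Q(1) by (auto simp: V_eq)

lemma volume_part: "U \<in> V \<Longrightarrow> j \<in> {1..J} \<Longrightarrow> snd U j \<in> Vh \<T> k (closure (\<omega> j))"
  by (auto simp: V_eq families_def)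

lemma volume_form_left:
  assumes "U \<in> V" "U' \<in> V" "Z \<in> V" "j \<in> {1..J}"
  shows "volume_form \<kappa> (\<omega> j) (snd U j + snd U' j) (snd Z j)
      = volume_form \<kappa> (\<omega> j) (snd U j) (snd Z j) + volume_form \<kappa> (\<omega> j) (snd U' j) (snd Z j)"
    "volume_form \<kappa> (\<omega> j) (c *\<^sub>C snd U j) (snd Z j) = c * volume_form \<kappa> (\<omega> j) (snd U j) (snd Z j)"
proof -
  note lin = volume_form_lincomb[OF volume_part[OF assms(1,4)] volume_part[OF assms(2,4)]
      volume_part[OF assms(3,4)] open_subdomain[OF assms(4)] subdomain_subset[OF assms(4)] closure_subset]
  show "volume_form \<kappa> (\<omega> j) (snd U j + snd U' j) (snd Z j)
      = volume_form \<kappa> (\<omega> j) (snd U j) (snd Z j) + volume_form \<kappa> (\<omega> j) (snd U' j) (snd Z j)"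
    using lin[of 1 1] by (simp add: scaleC_one)
  show "volume_form \<kappa> (\<omega> j) (c *\<^sub>C snd U j) (snd Z j) = c * volume_form \<kappa> (\<omega> j) (snd U j) (snd Z j)"
    using lin[of c 0] by simp
qed

lemma A_add_left:
  assumes "U \<in> V" "U' \<in> V" "Z \<in> V"
  shows "A (U + U') Z = A U Z + A U' Z"
proof -
  have S: "U + U' \<in> V" using assms V_subspace by (simp add: cvec.subspace_add)
  have "bpair (\<A> (fst U + fst U')) (fst Z) = bpair (\<A> (fst U)) (fst Z) + bpair (\<A> (fst U')) (fst Z)"
    using bpair_left_linear(1)[OF boundary_op boundary_part[OF assms(1)] boundary_part[OF assms(2)]]
      boundary_part[OF assms(3)] boundary_part[OF S] by auto
  then show ?thesis
    using assms(3) volume_form_left(1)[OF assms] by (simp add: A_apply sum.distrib)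
qed

lemma A_scale_left:
  assumes "U \<in> V" "Z \<in> V"
  shows "A (c *\<^sub>C U) Z = c * A U Z"
proof -
  have S: "c *\<^sub>C U \<in> V" using assms V_subspace by (simp add: cvec.subspace_scale)
  have "bpair (\<A> (c *\<^sub>C fst U)) (fst Z) = c * bpair (\<A> (fst U)) (fst Z)"
    using bpair_left_linear(2)[OF boundary_op boundary_part[OF assms(1)] boundary_part[OF assms(1)]]
      boundary_part[OF assms(2)] boundary_part[OF S] by (auto simp: scaleC_prod_def)
  then show ?thesis
    using assms(2) volume_form_left(2)[OF assms(1,1,2)]
    by (simp add: A_apply scaleC_prod_def scaleC_fun_def[where 'a=nat] sum_distrib_left distrib_left)
qed

lemma A_lin: "clinear_on V A"
proof -
  have "A (x + y) = A x + A y" if "x \<in> V" "y \<in> V" for x y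
  proof
    show "A (x + y) Z = (A x + A y) Z" for Z
      using A_add_left[OF that, of Z] A_outside[of Z] by (cases "Z \<in> V") auto
  qed
  moreover have "A (c *\<^sub>C x) = c *\<^sub>C A x" if "x \<in> V" for c x
  proof
    show "A (c *\<^sub>C x) Z = (c *\<^sub>C A x) Z" for Z
      using A_scale_left[OF that, of Z] A_outside[of Z]
      by (cases "Z \<in> V") (auto simp: scaleC_fun_def scaleC_complex_def)
  qed
  ultimately show ?thesis by (simp add: clinear_on_def)
qed

lemma A_cdual: "A ` V \<subseteq> cdual V"
proof
  fix p assume "p \<in> A ` V"
  then obtain U where U: "U \<in> V" "p = A U" by blast
  have "A U (x + y) = A U x + A U y" if xy: "x \<in> V" "y \<in> V" for x y
  proof -
    have S: "x + y \<in> V" using xy V_subspace by (simp add: cvec.subspace_add)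
    have "bpair (\<A> (fst U)) (fst x + fst y) = bpair (\<A> (fst U)) (fst x) + bpair (\<A> (fst U)) (fst y)"
      using boundary_part[OF xy(1)] boundary_part[OF xy(2)]
      by (intro bpair_right_linear(1)[OF boundary_op boundary_part[OF U(1)]]) auto
    then show ?thesis
      using S xy volume_form_left(1)[OF xy U(1)]
      by (simp add: A_apply sum.distrib volume_form_commute[of \<kappa> _ "snd U _"])
  qed
  moreover have "A U (c *\<^sub>C x) = c * A U x" if x: "x \<in> V" for c x
  proof -
    have S: "c *\<^sub>C x \<in> V" using x V_subspace by (simp add: cvec.subspace_scale)
    have "bpair (\<A> (fst U)) (c *\<^sub>C fst x) = c * bpair (\<A> (fst U)) (fst x)"
      using boundary_part[OF x]
      by (intro bpair_right_linear(2)[OF boundary_op boundary_part[OF U(1)], where b'="fst x"]) auto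
    then show ?thesis
      using S x volume_form_left(2)[OF x x U(1)]
      by (simp add: A_apply scaleC_prod_def scaleC_fun_def[where 'a=nat] sum_distrib_left distrib_left
          volume_form_commute[of \<kappa> _ "snd U _"])
  qed
  ultimately show "p \<in> cdual V"
    using A_outside by (auto simp: U cdual_def clinear_on_def scaleC_complex_def)
qed

lemma Im_A_vol_cnj:
  assumes Qc: "\<forall>q\<in>Q. distr_cnj q \<in> Q"
    and Im: "\<forall>v\<in>H12 \<Omega>. \<forall>q\<in>Hm12 \<Omega>. Im (bpair (\<A> (v, q)) (fun_cnj v, distr_cnj q)) \<le> 0"
    and U: "U \<in> V"
  shows "Im (A U (vol_cnj U)) \<le> 0"
proof -
  have "fst (vol_cnj U) = (fun_cnj (fst (fst U)), distr_cnj (snd (fst U)))"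
    "snd (vol_cnj U) = (\<lambda>j. fun_cnj (snd U j))"
    by (auto simp: vol_cnj_def split: prod.splits)
  then have eq: "A U (vol_cnj U) = bpair (\<A> (fst (fst U), snd (fst U))) (fun_cnj (fst (fst U)), distr_cnj (snd (fst U)))
      + (\<Sum>j\<in>{1..J}. volume_form \<kappa> (\<omega> j) (snd U j) (fun_cnj (snd U j)))"
    by (simp add: A_apply vol_cnj_V[OF Qc U])
  have "Im (bpair (\<A> (fst (fst U), snd (fst U))) (fun_cnj (fst (fst U)), distr_cnj (snd (fst U)))) \<le> 0"
    using bspec[OF bspec[OF Im, of "fst (fst U)"], of "snd (fst U)"] boundary_part[OF U]
    by (simp add: mem_Times_iff)
  moreover have "(\<Sum>j\<in>{1..J}. Im (volume_form \<kappa> (\<omega> j) (snd U j) (fun_cnj (snd U j)))) \<le> 0"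
    by (intro sum_nonpos Im_volume_form_cnj[OF volume_part[OF U]] open_subdomain subdomain_subset closure_subset)
  ultimately show ?thesis unfolding eq by (simp add: Im_sum)
qed

subsubsection \<open>Global functions as compatible families\<close>

text \<open>The map that identifies global discrete functions with compatible families.\<close>

definition split_dom :: "'d cfun \<times> 'd cdistr \<Rightarrow> 'd mvol" where
  "split_dom = (\<lambda>(u, p). ((restr \<Gamma> u, p), \<lambda>j. if j \<in> {1..J} then restr (closure (\<omega> j)) u else 0))"

lemma clinear_split_dom: "clinear split_dom"
  by (rule clinearI) (auto simp: split_dom_def scaleC_prod_def scaleC_fun_def scaleC_complex_def
      restr_def fun_eq_iff split: prod.splits)

lemma \<Gamma>_closure: "\<Gamma> \<subseteq> closure \<Omega>" "j \<in> {1..J} \<Longrightarrow> closure (\<omega> j) \<subseteq> closure \<Omega>"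
  using frontier_subset_closure cover by auto

lemma split_dom_V: "x \<in> Vh_OG \<T> k \<Omega> Q \<Longrightarrow> split_dom x \<in> V"
proof -
  assume "x \<in> Vh_OG \<T> k \<Omega> Q"
  then obtain u p where x: "x = (u, p)" "u \<in> Vh \<T> k (closure \<Omega>)" "p \<in> Q"
    by (auto simp: Vh_OG_def)
  have "restr (closure (\<omega> j)) u \<in> Vh \<T> k (closure (\<omega> j))" if "j \<in> {1..J}" for j
    by (rule restr_Vh[OF x(2) \<Gamma>_closure(2)[OF that]])
  then show ?thesis
    using restr_Vh[OF x(2) \<Gamma>_closure(1)] x(3) by (simp add: x(1) split_dom_def V_eq families_def)
qed

lemma split_dom_compatible:
  assumes "x \<in> Vh_OG \<T> k \<Omega> Q"
  shows "B (split_dom x) \<in> R ` X"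
proof -
  obtain f p where f: "f \<in> fem" "x = (restr (closure \<Omega>) f, p)"
    using assms by (auto simp: Vh_OG_def Vh_def)
  have j: "restr (frontier (\<omega> j)) (restr (closure (\<omega> j)) (restr (closure \<Omega>) f)) = restr (frontier (\<omega> j)) f"
    if "j \<in> {1..J}" for j
    using \<Gamma>_closure(2)[OF that] frontier_subset_closure[of "\<omega> j"] by (auto simp: restr_def fun_eq_iff)
  have "B (split_dom x) = R (restr (skeleton \<Omega> J \<omega>) f)"
    using \<Gamma>_closure(1) frontier_skeleton
    by (auto simp: f split_dom_def B_apply restriction_R_def restr_restr j fun_eq_iff)
  then show ?thesis using f by (auto simp: Vh_def)
qed

text \<open>The pieces agree with a single \<open>w\<close> on all frontiers, and different
  subdomain closures meet only there, so the pieces define one function. It is continuous because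
  the closures are finitely many closed sets, and piecewise polynomial because each cell lies in one
  of them.\<close>

lemma glue:
  assumes U: "U \<in> V" and BU: "B U \<in> R ` X"
  obtains x where "x \<in> Vh_OG \<T> k \<Omega> Q" "split_dom x = U"
proof -
  obtain w where w: "w \<in> fem" "B U = R (restr (skeleton \<Omega> J \<omega>) w)"
    using BU by (auto simp: Vh_def)
  have "\<forall>j\<in>{1..J}. \<exists>f\<in>fem. snd U j = restr (closure (\<omega> j)) f"
    using volume_part[OF U] unfolding Vh_def by blast
  then obtain f where f: "\<And>j. j \<in> {1..J} \<Longrightarrow> f j \<in> fem"
    "\<And>j. j \<in> {1..J} \<Longrightarrow> snd U j = restr (closure (\<omega> j)) (f j)"
    by metis
  have fw: "f j x = w x" if "j \<in> {1..J}" "x \<in> frontier (\<omega> j)" for j x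
  proof -
    have "snd (B U) j x = snd (R (restr (skeleton \<Omega> J \<omega>) w)) j x" using w(2) by simp
    moreover have "x \<in> closure (\<omega> j)" "x \<in> skeleton \<Omega> J \<omega>"
      using that(2) frontier_subset_closure frontier_skeleton(2)[OF that(1)] by blast+
    ultimately show ?thesis
      using that f(2)[OF that(1)] by (simp add: B_apply restriction_R_def restr_def)
  qed
  have consistent: "f i x = f j x"
    if "i \<in> {1..J}" "j \<in> {1..J}" "x \<in> closure (\<omega> i)" "x \<in> closure (\<omega> j)" for i j x
    using closures_meet[of i j x] closures_meet[of j i x] fw[of i x] fw[of j x] that by metis
  \<comment> \<open>Any subdomain containing the point will do, by
    \<open>consistent\<close>.\<close>
  define g where "g x = (if x \<in> \<Union>\<T> then f (SOME j. j \<in> {1..J} \<and> x \<in> closure (\<omega> j)) x else 0)" for x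
  have g: "g x = f j x" if "j \<in> {1..J}" "x \<in> closure (\<omega> j)" for j x
  proof -
    let ?i = "SOME j. j \<in> {1..J} \<and> x \<in> closure (\<omega> j)"
    have "?i \<in> {1..J} \<and> x \<in> closure (\<omega> ?i)" by (rule someI[of _ j]) (use that in simp)
    then have "f ?i x = f j x" using consistent that by blast
    then show ?thesis using closure_subdomain_subset[OF that(1)] that(2) by (auto simp: g_def)
  qed
  have "g \<in> fem"
    unfolding lagrange_fem_def
  proof (intro CollectI conjI ballI allI impI)
    have "continuous_on (\<Union>j\<in>{1..J}. closure (\<omega> j)) g"
    proof (rule continuous_on_closed_Union)
      fix j assume j: "j \<in> {1..J}"
      have "continuous_on (closure (\<omega> j)) (f j)"
        by (rule continuous_on_subset[OF fem_continuous[OF f(1)[OF j]] closure_subdomain_subset[OF j]])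
      then show "continuous_on (closure (\<omega> j)) g"
        by (rule continuous_on_eq) (simp add: g[OF j])
    qed auto
    then show "continuous_on (\<Union>\<T>) g" by (simp only: cells_cover)
    show "g x = 0" if "x \<notin> \<Union>\<T>" for x using that by (simp add: g_def)
    fix K assume K: "K \<in> \<T>"
    obtain j where j: "j \<in> {1..J}" "K \<subseteq> closure (\<omega> j)" by (rule cell_in_subdomain[OF K])
    obtain p where "poly_fun k p" "\<forall>x\<in>K. f j x = p x" by (rule fem_cell[OF f(1)[OF j(1)] K])
    then show "\<exists>p. poly_fun k p \<and> (\<forall>x\<in>K. g x = p x)" using g[OF j(1)] j(2) by (metis subsetD)
  qed
  define x where "x = (restr (closure \<Omega>) g, snd (fst U))"
  have x: "x \<in> Vh_OG \<T> k \<Omega> Q"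
    using \<open>g \<in> fem\<close> U by (auto simp: x_def Vh_OG_def Vh_def V_eq)
  have dom: "restr (closure (\<omega> j)) (restr (closure \<Omega>) g) = snd U j" if "j \<in> {1..J}" for j
    using f(2)[OF that] g[OF that] \<Gamma>_closure(2)[OF that] by (auto simp: restr_def fun_eq_iff)
  \<comment> \<open>The boundary component of \<open>U\<close> is the restriction of
    \<open>w\<close>. A point of \<open>\<Gamma>\<close> lies on the frontier of every subdomain
    whose closure contains it, so \<open>g\<close> equals \<open>w\<close> there.\<close>
  have bnd: "restr \<Gamma> (restr (closure \<Omega>) g) = fst (fst U)"
  proof -
    have "fst (fst U) = restr \<Gamma> w"
      using arg_cong[OF w(2), of fst] frontier_skeleton(1) by (simp add: B_apply restriction_R_def restr_restr)
    moreover have "g y = w y" if y: "y \<in> \<Gamma>" for y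
    proof -
      have "y \<in> closure \<Omega>" using y \<Gamma>_closure by blast
      then obtain j where "j \<in> {1..J}" "y \<in> closure (\<omega> j)" using cover by blast
      then show ?thesis using g fw boundary_meets_frontier[OF y] by metis
    qed
    ultimately show ?thesis using \<Gamma>_closure(1) by (auto simp: restr_def fun_eq_iff)
  qed
  have "snd U j = 0" if "j \<notin> {1..J}" for j using U that by (auto simp: V_eq families_def)
  then have "split_dom x = U"
    using dom bnd by (auto simp: split_dom_def x_def prod_eq_iff fun_eq_iff)
  then show ?thesis using that x by blast
qed

lemma split_dom_image: "split_dom ` Vh_OG \<T> k \<Omega> Q = {U \<in> V. B U \<in> R ` X}"
  using split_dom_V split_dom_compatible glue by (auto simp: image_iff) metis

lemma split_dom_inj:
  assumes "x \<in> Vh_OG \<T> k \<Omega> Q" "split_dom x = 0"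
  shows "x = 0"
proof -
  have "fst x y = 0" for y
  proof (cases "y \<in> closure \<Omega>")
    case True
    then obtain j where j: "j \<in> {1..J}" "y \<in> closure (\<omega> j)" using cover by blast
    have "snd (split_dom x) j y = 0" using assms(2) by simp
    then show ?thesis using j by (simp add: split_dom_def restr_def split: prod.splits)
  next
    case False
    then show ?thesis using assms(1) by (auto simp: Vh_OG_def Vh_def restr_def)
  qed
  moreover have "snd x = 0"
    using arg_cong[OF assms(2), of "\<lambda>z. snd (fst z)"] by (simp add: split_dom_def split: prod.splits)
  ultimately show ?thesis by (simp add: prod_eq_iff fun_eq_iff)
qed

lemma A_split_dom:
  assumes x: "x \<in> Vh_OG \<T> k \<Omega> Q" and y: "y \<in> Vh_OG \<T> k \<Omega> Q"
  shows "A_OG \<T> k \<Omega> Q \<kappa> \<A> x y = A (split_dom x) (split_dom y)"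
proof -
  obtain u p v q where xy: "x = (u, p)" "y = (v, q)" by (cases x, cases y)
  obtain f g where f: "f \<in> fem" "u = restr (closure \<Omega>) f" and g: "g \<in> fem" "v = restr (closure \<Omega>) g"
    using x y by (auto simp: xy Vh_OG_def Vh_def)
  have "volume_form \<kappa> \<Omega> u v = volume_form \<kappa> \<Omega> f g"
    by (rule volume_form_cong[OF open_\<Omega>]) (use f g closure_subset[of \<Omega>] in \<open>auto simp: restr_def\<close>)
  also have "\<dots> = (\<Sum>j\<in>{1..J}. volume_form \<kappa> (\<omega> j) f g)"
    by (rule volume_form_decompose[OF f(1) g(1)])
  also have "\<dots> = (\<Sum>j\<in>{1..J}. volume_form \<kappa> (\<omega> j) (restr (closure (\<omega> j)) u) (restr (closure (\<omega> j)) v))"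
  proof (rule sum.cong[OF refl])
    fix j assume j: "j \<in> {1..J}"
    show "volume_form \<kappa> (\<omega> j) f g = volume_form \<kappa> (\<omega> j) (restr (closure (\<omega> j)) u) (restr (closure (\<omega> j)) v)"
      by (rule volume_form_cong[OF open_subdomain[OF j]])
        (use f g \<Gamma>_closure(2)[OF j] closure_subset[of "\<omega> j"] in \<open>auto simp: restr_def\<close>)
  qed
  finally have vol: "volume_form \<kappa> \<Omega> u v
      = (\<Sum>j\<in>{1..J}. volume_form \<kappa> (\<omega> j) (restr (closure (\<omega> j)) u) (restr (closure (\<omega> j)) v))" .
  have "A_OG \<T> k \<Omega> Q \<kappa> \<A> x y = volume_form \<kappa> \<Omega> u v + bpair (\<A> (restr \<Gamma> u, p)) (restr \<Gamma> v, q)"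
    using y by (simp add: A_OG_def xy)
  also have "\<dots> = A (split_dom x) (split_dom y)"
    using split_dom_V[OF y] by (simp add: A_apply vol) (simp add: split_dom_def xy)
  finally show ?thesis .
qed

lemma A_OG_outside: "y \<notin> Vh_OG \<T> k \<Omega> Q \<Longrightarrow> A_OG \<T> k \<Omega> Q \<kappa> \<A> x y = 0"
  by (cases x; cases y) (simp add: A_OG_def)

lemma Vh_OG_subspace: "cvec.subspace (Vh_OG \<T> k \<Omega> Q)"
  unfolding Vh_OG_def by (intro subspace_Times Vh_subspace Q)

lemma Vh_OG_fin_dim: "fin_dim (Vh_OG \<T> k \<Omega> Q)"
  unfolding Vh_OG_def by (intro fin_dim_Times Vh_fin_dim Q_fin_dim)

lemma transmission_spaces:
  assumes "impedance W mtr_cnj T" "hermitian_ip_on V ip"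
  shows "transmission_spaces V W X A B R T mtr_cnj ip"
proof
  show "mtr_cnj (R x) \<in> R ` X" if "x \<in> X" for x
    using that Vh_cnj by (simp add: mtr_cnj_R)
qed (use assms V_subspace V_fin_dim W_subspace Vh_subspace Vh_fin_dim A_lin A_cdual B_image R_image
    R_inj mtr_cnj_W clinear_imp_clinear_on[OF clinear_B] clinear_imp_clinear_on[OF clinear_R] in auto)

theorem dim_kernel:
  assumes T: "impedance W mtr_cnj T" and ip: "hermitian_ip_on V ip"
    and alternatives: "bij_betw (impedance_op V A B T) V (cdual V) \<or>
       (\<forall>q\<in>Q. distr_cnj q \<in> Q) \<and>
       (\<forall>v\<in>H12 \<Omega>. \<forall>q\<in>Hm12 \<Omega>. Im (bpair (\<A> (v, q)) (fun_cnj v, distr_cnj q)) \<le> 0)"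
  shows "cvec.dim (ker_on (Vh_OG \<T> k \<Omega> Q) (A_OG \<T> k \<Omega> Q \<kappa> \<A>))
    = cvec.dim (ker_on V A \<inter> ker_on V B)
      + cvec.dim (ker_on (cdual W) (\<lambda>p. p + exchange_op X R T (scattering_op V (ip_norm ip) A B T p)))"
proof -
  interpret transmission_spaces V W X A B R T mtr_cnj ip by (rule transmission_spaces[OF T ip])
  \<comment> \<open>The two alternatives are merged here; nothing after this depends on which one
    holds.\<close>
  have ops: "(\<forall>f\<in>cdual W. adj V B f \<in> impedance_op V A B T ` V) \<and>
      (\<forall>u\<in>V. impedance_op V A B T u = 0 \<longrightarrow> B u = 0)"
    using alternatives
  proof
    assume "bij_betw (impedance_op V A B T) V (cdual V)"
    from bijective_op[OF this] show ?thesis by blast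
  next
    assume b: "(\<forall>q\<in>Q. distr_cnj q \<in> Q) \<and>
       (\<forall>v\<in>H12 \<Omega>. \<forall>q\<in>Hm12 \<Omega>. Im (bpair (\<A> (v, q)) (fun_cnj v, distr_cnj q)) \<le> 0)"
    have Im: "Im (A v (vol_cnj v)) \<le> 0" if "v \<in> V" for v using Im_A_vol_cnj b that by blast
    have C: "vol_cnj v \<in> V" if "v \<in> V" for v using vol_cnj_V b that by blast
    from dissipative_op[of vol_cnj, OF C vol_cnj_involutive B_vol_cnj mtr_cnj_zero Im]
    show ?thesis by blast
  qed
  interpret transmission_problem V W X A B R T mtr_cnj ip
    by unfold_locales (use ops in auto)
  let ?D = "Vh_OG \<T> k \<Omega> Q" and ?A = "A_OG \<T> k \<Omega> Q \<kappa> \<A>"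
  have ker: "ker_on ?D ?A = {x \<in> ?D. split_dom x \<in> K}"
  proof -
    have "?A x = 0 \<longleftrightarrow> split_dom x \<in> K" if x: "x \<in> ?D" for x
    proof -
      have "?A x = 0 \<longleftrightarrow> (\<forall>y\<in>?D. ?A x y = 0)"
        using A_OG_outside[of _ x] by (auto simp: fun_eq_iff)
      \<comment> \<open>Testing with all global functions amounts to testing with all compatible
        families, which are the image of \<open>split_dom\<close>.\<close>
      also have "\<dots> \<longleftrightarrow> (\<forall>U\<in>split_dom ` ?D. A (split_dom x) U = 0)"
        using A_split_dom[OF x] by simp
      also have "\<dots> \<longleftrightarrow> split_dom x \<in> K"
        unfolding split_dom_image using split_dom_V[OF x] split_dom_compatible[OF x] by (auto simp: K_def)
      finally show ?thesis .
    qed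
    then show ?thesis by (auto simp: ker_on_def)
  qed
  have sub: "cvec.subspace (ker_on ?D ?A)"
  proof -
    have "ker_on ?D ?A = ?D \<inter> {x. split_dom x \<in> K}" by (auto simp: ker)
    then show ?thesis
      using cvec.subspace_inter[OF Vh_OG_subspace
          cvec_pair.linear_subspace_linear_preimage[OF clinear_split_dom K_subspace]] by simp
  qed
  have "split_dom ` ker_on ?D ?A = K"
  proof (intro antisym subsetI)
    fix U assume U: "U \<in> K"
    then have "U \<in> split_dom ` ?D" unfolding split_dom_image by (auto simp: K_def)
    then show "U \<in> split_dom ` ker_on ?D ?A" using U ker by auto
  qed (auto simp: ker)
  moreover have "cvec.dim (split_dom ` ker_on ?D ?A) = cvec.dim (ker_on ?D ?A)"
    by (rule dim_image_eq[OF sub fin_dim_subset[OF Vh_OG_fin_dim] clinear_imp_clinear_on[OF clinear_split_dom]])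
      (use split_dom_inj in \<open>auto simp: ker_on_def\<close>)
  ultimately show ?thesis using dim_kernel by simp
qed

end

subsection \<open>The kernel dimension formula\<close>

theorem mainTheorem3:
  fixes \<Omega> :: "(real^'d::finite) set"
    and \<T> :: "(real^'d) set set"
    and k J :: nat
    and \<kappa> :: "'d cfun"
    and \<A> :: "'d cfun \<times> 'd cdistr \<Rightarrow> 'd cdistr \<times> 'd cfun"
    and Q :: "'d cdistr set"
    and \<omega> :: "nat \<Rightarrow> (real^'d) set"
    and T :: "'d mtr \<Rightarrow> ('d mtr \<Rightarrow> complex)"
    and ip :: "'d mvol \<Rightarrow> 'd mvol \<Rightarrow> complex"
  defines "V \<equiv> VV_vol \<T> k \<Omega> Q J \<omega>"
    and "W \<equiv> VV_tr \<T> k \<Omega> J \<omega>"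
    and "X \<equiv> Vh \<T> k (skeleton \<Omega> J \<omega>)"
    and "A \<equiv> A_multi \<T> k \<Omega> Q J \<omega> \<kappa> \<A>"
    and "B \<equiv> trace_B J \<omega>"
    and "R \<equiv> restriction_R \<Omega> J \<omega>"
  defines "S \<equiv> scattering_op V (ip_norm ip) A B T"
    and "E \<equiv> exchange_op X R T"
  assumes dimension: "CARD('d) = 2 \<or> CARD('d) = 3"
    and mesh: "simplicial_mesh \<T>" "\<Omega> = interior (\<Union>\<T>)"
    and degree: "1 \<le> k"
    and wavenumber: "\<kappa> \<in> borel_measurable lebesgue"
      "\<exists>C. AE x in lebesgue. cmod (\<kappa> x) \<le> C"
      "\<forall>x\<in>\<Omega>. 0 \<le> Im ((\<kappa> x)\<^sup>2)"
      "\<exists>k0::real. 0 < k0 \<and> (\<forall>x. x \<notin> \<Omega> \<longrightarrow> \<kappa> x = of_real k0)"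
    and boundary_op: "bounded_boundary_op \<Omega> \<A>"
    and boundary_space: "Q \<subseteq> Hm12 \<Omega>" "cvec.subspace Q"
      "\<exists>F. finite F \<and> Q = cvec.span F"
    and subdomains: "\<forall>j\<in>{1..J}. polyhedral_union \<T> (\<omega> j)"
      "disjoint_family_on \<omega> {1..J}"
      "closure \<Omega> = (\<Union>j\<in>{1..J}. closure (\<omega> j))"
    and impedance_T: "impedance W mtr_cnj T"
    and inner_product: "hermitian_ip_on V ip"
    and alternatives:
      "bij_betw (impedance_op V A B T) V (cdual V) \<or>
       (\<forall>q\<in>Q. distr_cnj q \<in> Q) \<and>
       (\<forall>v\<in>H12 \<Omega>. \<forall>q\<in>Hm12 \<Omega>. Im (bpair (\<A> (v, q)) (fun_cnj v, distr_cnj q)) \<le> 0)"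
  shows "cvec.dim (ker_on (Vh_OG \<T> k \<Omega> Q) (A_OG \<T> k \<Omega> Q \<kappa> \<A>))
       = cvec.dim (ker_on V A \<inter> ker_on V B)
       + cvec.dim (ker_on (cdual W) (\<lambda>p. p + E (S p)))"
proof -
  interpret domain_decomposition \<T> \<Omega> k \<kappa> \<A> Q J \<omega>
    using mesh wavenumber boundary_op boundary_space subdomains by unfold_locales auto
  show ?thesis
    using dim_kernel[of T ip] impedance_T inner_product alternatives
    unfolding S_def E_def V_def W_def X_def A_def B_def R_def by blast
qed

end
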